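(* The shape optimization problem $(P)$, $$\min_{\omega\in\mathcal O}J(\omega),\qquad J(\omega)=\frac12\int_B\kappa|\mathbf E(\omega)-\mathbf E_d|^2\,dx+\int_\omega dx,$$ where $\mathbf E(\omega)\in\mathbf H_0(\mathbf{curl})$ is the unique solution of the variational inequality $$a(\mathbf E,\mathbf v-\mathbf E)+j_c\int_\omega|\mathbf v|\,dx-j_c\int_\omega|\mathbf E|\,dx\ge\int_\Omega\mathbf f\cdot(\mathbf v-\mathbf E)\,dx\quad\forall\mathbf v\in\mathbf H_0(\mathbf{curl}),$$ has an optimal solution $\omega_\star\in\mathcal O$.
   Context: Setting. $\Omega\subset\mathbb R^3$ is a bounded Lipschitz domain and $B\subset\Omega$ is a Lipschitz domain. $\mathbf H_0(\mathbf{curl})$ is the closure of $C_0^\infty(\Omega)^3$ in $\mathbf H(\mathbf{curl})=\{\mathbf v\in L^2(\Omega)^3:\mathbf{curl}\,\mathbf v\in L^2(\Omega)^3\}$ with the graph norm. $\mathcal C^1(B,\cdot)$ is the Banach space of $C^1$ functions on $B$ that are bounded together with their first derivatives. Standing assumptions: $\mathbf E_d\in\mathcal C^1(B,\mathbb R^3)$; $\kappa\in\mathcal C^1(B)$ with $\kappa:B\to(0,\infty)$; $j_c>0$; $\epsilon,\nu:\Omega\to\mathbb R^{3\times3}$ lie in $L^\infty(\Omega,\mathbb R^{3\times3})\cap\mathcal C^1(B,\mathbb R^{3\times3})$, are symmetric and uniformly positive definite ($\xi^{\mathsf T}\nu(x)\xi\ge\underline\nu|\xi|^2$, $\xi^{\mathsf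 T}\epsilon(x)\xi\ge\underline\epsilon|\xi|^2$ for a.e. $x\in\Omega$, all $\xi\in\mathbb R^3$, with $\underline\nu,\underline\epsilon>0$); $\mathbf f\in L^2(\Omega)^3$ with $\mathbf f|_B\in\mathcal C^1(B,\mathbb R^3)$. $a(\mathbf v,\mathbf w)=\int_\Omega\nu\,\mathbf{curl}\,\mathbf v\cdot\mathbf{curl}\,\mathbf w\,dx+\int_\Omega\epsilon\mathbf v\cdot\mathbf w\,dx$. Admissible shapes. $\mathcal O$ (assumed nonempty) is the class of all open sets $\omega\subset B$ that are Lipschitz with uniform Lipschitz constant $L$ (fixed), understood in the standard uniform sense (Lipschitz constant and size of the local graph charts uniform over boundary points and over $\mathcal O$), so that the following known compactness theorem holds: every sequence in $\mathcal O$ has a subsequence converging to some $\omega\in\mathcal O$ both in the sense of Hausdorff (Hausdorff convergence of the compact sets $\overline B\setminus\omega_n$ to $\overline B\setminus\omega$) and in the sense of characteristic functions ($\chi_{\omega_n}\to\chi_\omega$ in $L^p(\Omega)$ for all $1\le p<\infty$). *)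

theory Defs
  imports "HOL-Analysis.Analysis"
begin

section \<open>Lipschitz sets\<close>

text \<open>
  \<open>lipschitz_chart L r U x\<close>: inside the ball of radius \<open>r\<close> around \<open>x\<close>, and in a suitable
  orthonormal frame centred at \<open>x\<close>, the set \<open>U\<close> is the strict epigraph of an \<open>L\<close>-Lipschitz
  function of the first two coordinates.
\<close>

definition lipschitz_chart :: "real \<Rightarrow> real \<Rightarrow> (real^3) set \<Rightarrow> real^3 \<Rightarrow> bool" where
  "lipschitz_chart L r U x \<longleftrightarrow>
     (\<exists>(T :: real^3 \<Rightarrow> real^3) (g :: real^2 \<Rightarrow> real).
        orthogonal_transformation T \<and> L-lipschitz_on UNIV g \<and>
        U \<inter> ball x r = {y \<in> ball x r. g (vector [T (y - x) $ 1, T (y - x) $ 2]) < T (y - x) $ 3})"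

definition lipschitz_domain :: "(real^3) set \<Rightarrow> bool" where
  "lipschitz_domain U \<longleftrightarrow>
     open U \<and> connected U \<and> U \<noteq> {} \<and> (\<forall>x\<in>frontier U. \<exists>L. \<exists>r>0. lipschitz_chart L r U x)"

text \<open>
  The admissible shapes: the Lipschitz constant \<open>L\<close> and the chart size \<open>r\<close> are the same for all
  boundary points and all shapes. Shapes need not be connected; the empty set has no boundary
  points and is admissible.
\<close>

definition admissible :: "(real^3) set \<Rightarrow> real \<Rightarrow> real \<Rightarrow> (real^3) set set" where
  "admissible B L r = {\<omega>. open \<omega> \<and> \<omega> \<subseteq> B \<and> (\<forall>x\<in>frontier \<omega>. lipschitz_chart L r \<omega> x)}"


section \<open>Function spaces\<close>

text \<open>
  Elements of Lebesgue and Sobolev spaces are represented by functions on the whole space, of which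
  only the values almost everywhere on the domain matter.
\<close>

definition L2_fields :: "(real^3) set \<Rightarrow> (real^3 \<Rightarrow> real^3) set" where
  "L2_fields \<Omega> = {v. v \<in> borel_measurable (lebesgue_on \<Omega>) \<and>
                     integrable (lebesgue_on \<Omega>) (\<lambda>x. (norm (v x))\<^sup>2)}"

definition Linf :: "(real^3) set \<Rightarrow> (real^3 \<Rightarrow> real^3^3) set" where
  "Linf \<Omega> = {f. f \<in> borel_measurable (lebesgue_on \<Omega>) \<and>
                (\<exists>M. AE x in lebesgue_on \<Omega>. norm (f x) \<le> M)}"

definition C1_bounded :: "(real^3) set \<Rightarrow> (real^3 \<Rightarrow> 'b::real_normed_vector) set" where
  "C1_bounded B = {f. \<exists>f' :: real^3 \<Rightarrow> ((real^3) \<Rightarrow>\<^sub>L 'b).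
     (\<forall>x\<in>B. (f has_derivative blinfun_apply (f' x)) (at x)) \<and>
     continuous_on B f' \<and> bounded (f ` B) \<and> bounded (f' ` B)}"

definition partial :: "3 \<Rightarrow> (real^3 \<Rightarrow> real^3) \<Rightarrow> real^3 \<Rightarrow> real^3" where
  "partial i f x = frechet_derivative f (at x) (axis i 1)"

primrec Ck :: "nat \<Rightarrow> (real^3 \<Rightarrow> real^3) \<Rightarrow> bool" where
  "Ck 0 f \<longleftrightarrow> continuous_on UNIV f"
| "Ck (Suc k) f \<longleftrightarrow> f differentiable_on UNIV \<and> (\<forall>i. Ck k (partial i f))"

text \<open>\<open>C\<^sub>0\<^sup>\<infinity>(\<Omega>)\<^sup>3\<close>, the fields being extended by zero to the whole space:\<close>

definition test_fields :: "(real^3) set \<Rightarrow> (real^3 \<Rightarrow> real^3) set" where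
  "test_fields \<Omega> = {\<phi>. (\<forall>k. Ck k \<phi>) \<and> compact (closure {x. \<phi> x \<noteq> 0}) \<and>
                       closure {x. \<phi> x \<noteq> 0} \<subseteq> \<Omega>}"

definition classical_curl :: "(real^3 \<Rightarrow> real^3) \<Rightarrow> real^3 \<Rightarrow> real^3" where
  "classical_curl \<phi> x = vector
     [partial 2 \<phi> x $ 3 - partial 3 \<phi> x $ 2,
      partial 3 \<phi> x $ 1 - partial 1 \<phi> x $ 3,
      partial 1 \<phi> x $ 2 - partial 2 \<phi> x $ 1]"

definition has_weak_curl :: "(real^3) set \<Rightarrow> (real^3 \<Rightarrow> real^3) \<Rightarrow> (real^3 \<Rightarrow> real^3) \<Rightarrow> bool" where
  "has_weak_curl \<Omega> v w \<longleftrightarrow>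
     (\<forall>\<phi>\<in>test_fields \<Omega>. (\<integral>x. w x \<bullet> \<phi> x \<partial>lebesgue_on \<Omega>) = (\<integral>x. v x \<bullet> classical_curl \<phi> x \<partial>lebesgue_on \<Omega>))"

definition Hcurl :: "(real^3) set \<Rightarrow> (real^3 \<Rightarrow> real^3) set" where
  "Hcurl \<Omega> = {v \<in> L2_fields \<Omega>. \<exists>w\<in>L2_fields \<Omega>. has_weak_curl \<Omega> v w}"

text \<open>The weak curl of a field in \<open>Hcurl \<Omega>\<close> (unique up to null sets):\<close>

definition curl :: "(real^3) set \<Rightarrow> (real^3 \<Rightarrow> real^3) \<Rightarrow> real^3 \<Rightarrow> real^3" where
  "curl \<Omega> v = (SOME w. w \<in> L2_fields \<Omega> \<and> has_weak_curl \<Omega> v w)"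

definition Hcurl_norm :: "(real^3) set \<Rightarrow> (real^3 \<Rightarrow> real^3) \<Rightarrow> real" where
  "Hcurl_norm \<Omega> v = sqrt ((\<integral>x. (norm (v x))\<^sup>2 \<partial>lebesgue_on \<Omega>) +
                          (\<integral>x. (norm (curl \<Omega> v x))\<^sup>2 \<partial>lebesgue_on \<Omega>))"

definition H0curl :: "(real^3) set \<Rightarrow> (real^3 \<Rightarrow> real^3) set" where
  "H0curl \<Omega> = {v \<in> Hcurl \<Omega>. \<forall>e>0. \<exists>\<phi>\<in>test_fields \<Omega>. Hcurl_norm \<Omega> (\<lambda>x. v x - \<phi> x) < e}"


section \<open>The state problem and the cost functional\<close>

definition coefficient :: "(real^3) set \<Rightarrow> (real^3) set \<Rightarrow> (real^3 \<Rightarrow> real^3^3) \<Rightarrow> bool" where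
  "coefficient \<Omega> B c \<longleftrightarrow> c \<in> Linf \<Omega> \<and> c \<in> C1_bounded B \<and>
     (AE x in lebesgue_on \<Omega>. transpose (c x) = c x) \<and>
     (\<exists>c0>0. AE x in lebesgue_on \<Omega>. \<forall>\<xi>. c0 * (norm \<xi>)\<^sup>2 \<le> \<xi> \<bullet> (c x *v \<xi>))"

definition bilin ::
  "(real^3) set \<Rightarrow> (real^3 \<Rightarrow> real^3^3) \<Rightarrow> (real^3 \<Rightarrow> real^3^3) \<Rightarrow>
   (real^3 \<Rightarrow> real^3) \<Rightarrow> (real^3 \<Rightarrow> real^3) \<Rightarrow> real" where
  "bilin \<Omega> \<nu> \<epsilon> v w =
     (\<integral>x. (\<nu> x *v curl \<Omega> v x) \<bullet> curl \<Omega> w x \<partial>lebesgue_on \<Omega>) +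
     (\<integral>x. (\<epsilon> x *v v x) \<bullet> w x \<partial>lebesgue_on \<Omega>)"

definition solves_VI ::
  "(real^3) set \<Rightarrow> (real^3 \<Rightarrow> real^3^3) \<Rightarrow> (real^3 \<Rightarrow> real^3^3) \<Rightarrow> real \<Rightarrow> (real^3 \<Rightarrow> real^3) \<Rightarrow>
   (real^3) set \<Rightarrow> (real^3 \<Rightarrow> real^3) \<Rightarrow> bool" where
  "solves_VI \<Omega> \<nu> \<epsilon> jc f \<omega> E \<longleftrightarrow> E \<in> H0curl \<Omega> \<and>
     (\<forall>v\<in>H0curl \<Omega>.
        bilin \<Omega> \<nu> \<epsilon> E (\<lambda>x. v x - E x)
          + jc * (\<integral>x. norm (v x) \<partial>lebesgue_on \<omega>) - jc * (\<integral>x. norm (E x) \<partial>lebesgue_on \<omega>)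
        \<ge> (\<integral>x. f x \<bullet> (v x - E x) \<partial>lebesgue_on \<Omega>))"

definition state ::
  "(real^3) set \<Rightarrow> (real^3 \<Rightarrow> real^3^3) \<Rightarrow> (real^3 \<Rightarrow> real^3^3) \<Rightarrow> real \<Rightarrow> (real^3 \<Rightarrow> real^3) \<Rightarrow>
   (real^3) set \<Rightarrow> real^3 \<Rightarrow> real^3" where
  "state \<Omega> \<nu> \<epsilon> jc f \<omega> = (SOME E. solves_VI \<Omega> \<nu> \<epsilon> jc f \<omega> E)"

definition cost ::
  "(real^3) set \<Rightarrow> (real^3) set \<Rightarrow> (real^3 \<Rightarrow> real^3^3) \<Rightarrow> (real^3 \<Rightarrow> real^3^3) \<Rightarrow> real \<Rightarrow>
   (real^3 \<Rightarrow> real^3) \<Rightarrow> (real^3 \<Rightarrow> real) \<Rightarrow> (real^3 \<Rightarrow> real^3) \<Rightarrow> (real^3) set \<Rightarrow> real" where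
  "cost \<Omega> B \<nu> \<epsilon> jc f \<kappa> Ed \<omega> =
     1/2 * (\<integral>x. \<kappa> x * (norm (state \<Omega> \<nu> \<epsilon> jc f \<omega> x - Ed x))\<^sup>2 \<partial>lebesgue_on B) + measure lebesgue \<omega>"

end

(*
  The state is the minimizer of a strongly convex energy on H_0(curl).  By the parallelogram law a
  minimizing sequence is Cauchy, so completeness of the graph norm (the weak curl is a closed
  operator) replaces weak compactness.  Testing the variational inequalities of two shapes with each
  other's solutions bounds the squared L^2 distance of the states by a constant times the measure of
  the symmetric difference of the shapes.  Hence uniqueness, and continuity of J under convergence of
  characteristic functions.

  Compactness of the admissible class: after passing to a diagonal subsequence every basic open set
  is eventually contained in the shapes, eventually disjoint from them, or eventually neither.  Let A
  and C be the unions of the basic sets of the first and second kind.  A point outside both is a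
  limit of boundary points, and there the charts (compactness of the orthogonal group,
  Arzela-Ascoli for the graph functions) converge to a chart of A whose graph is the complement of
  A and C.  So A is admissible, the complement of A and C is null, and the characteristic functions
  converge almost everywhere.
*)

theory Submission
  imports Defs "HOL-Complex_Analysis.Great_Picard" "HOL-Library.Diagonal_Subsequence"
begin

section \<open>Compactness of the admissible shapes\<close>

text \<open>Fields are functions, not classes modulo null sets, and \<open>curl\<close> and
  \<open>state\<close> are arbitrary choices of representatives. Hence every form is only positive
  semidefinite, linearity of the curl holds almost everywhere, and uniqueness of the weak curl must
  come first; it is proved with explicit smooth bumps and differentiation of integrals. The
  nonsmooth term calls for no regularization: convexity and a Lipschitz bound in the L^2 norm are
  enough for existence. In the stability estimate it survives only on the symmetric difference of
  two shapes, where Cauchy-Schwarz against an indicator turns it into the square root of a measure.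
  For the shapes the obstacle is that the chart subsequence depends on the boundary point, and there
  are uncountably many points. Codes attached to countably many basic sets remove it: once they are
  eventually constant, containment or disjointness seen along one chart subsequence holds along the
  whole sequence.\<close>

lemma diagonal_eventually_constant:
  fixes c :: "nat \<Rightarrow> nat \<Rightarrow> 'c::finite"
  obtains k where "strict_mono (k :: nat \<Rightarrow> nat)" "\<And>i. \<exists>v. \<forall>\<^sub>F n in sequentially. c i (k n) = v"
proof -
  interpret subseqs "\<lambda>i s. \<exists>v. \<forall>\<^sub>F n in sequentially. c i (s n) = v"
  proof
    fix i and s :: "nat \<Rightarrow> nat"
    \<comment> \<open>The values lie in a finite type, so one of them recurs infinitely often along
      \<open>s\<close>; restricting to its indices makes row \<open>i\<close> constant.\<close>
    obtain v where "infinite {n \<in> UNIV. c i (s n) = v}"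
      using pigeonhole_infinite_rel[of "UNIV::nat set" "UNIV::'c set" "\<lambda>n v. c i (s n) = v"] by auto
    then obtain r where "strict_mono (r :: nat \<Rightarrow> nat)" "\<And>n. r n \<in> {n \<in> UNIV. c i (s n) = v}"
      using infinite_enumerate by blast
    then show "\<exists>r'. strict_mono r' \<and> (\<exists>v. \<forall>\<^sub>F n in sequentially. c i ((s \<circ> r') n) = v)" by auto
  qed
  show ?thesis
  proof (rule that[OF subseq_diagseq])
    fix i
    have "\<exists>v. \<forall>\<^sub>F n in sequentially. c i ((diagseq \<circ> (+) (Suc i)) n) = v"
    proof (rule diagseq_holds)
      fix r s :: "nat \<Rightarrow> nat" and i
      assume "strict_mono r" "\<exists>v. \<forall>\<^sub>F n in sequentially. c i (s n) = v"
      then show "\<exists>v. \<forall>\<^sub>F n in sequentially. c i ((s \<circ> r) n) = v"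
        using eventually_subseq[of r] by fastforce
    qed
    then obtain v where "\<forall>\<^sub>F n in sequentially. c i (diagseq (n + Suc i)) = v"
      by (auto simp: o_def add.commute)
    \<comment> \<open>The diagonal refines the choice for row \<open>i\<close> only from index
      \<open>Suc i\<close> on; a shift does not change what holds eventually.\<close>
    then show "\<exists>v. \<forall>\<^sub>F n in sequentially. c i (diagseq n) = v"
      by (subst (asm) eventually_sequentially_seg) blast
  qed
qed

text \<open>Arzela-Ascoli on a ball: \<open>g n 0 = 0\<close> and the common constant bound the
  family there. A chart needs a graph function that is Lipschitz on the whole plane, so the limit on
  the ball is extended by composing it with the nearest-point projection, which is
  1-Lipschitz.\<close>

lemma lipschitz_on_UNIV_compact:
  fixes g :: "nat \<Rightarrow> 'a::euclidean_space \<Rightarrow> real"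
  assumes g: "\<And>n. L-lipschitz_on UNIV (g n)" and g0: "\<And>n. g n 0 = 0"
  obtains k h where "strict_mono (k :: nat \<Rightarrow> nat)" "L-lipschitz_on UNIV h"
    "\<And>p. norm p \<le> R \<Longrightarrow> (\<lambda>n. g (k n) p) \<longlonglongrightarrow> h p"
proof (cases "R \<ge> 0")
  case False
  then show ?thesis using that[of id "g 0"] g by (smt (verit) norm_ge_zero strict_mono_id)
next
  case True
  have L: "L \<ge> 0" using g lipschitz_on_nonneg by blast
  have lip: "\<bar>g n x - g n y\<bar> \<le> L * norm (x - y)" for n x y
    using lipschitz_onD[OF g, of x y] by (simp add: dist_norm)
  let ?S = "cball (0::'a) R"
  obtain h0 and k :: "nat \<Rightarrow> nat" where k: "strict_mono k"
    and unif: "\<And>e. 0 < e \<Longrightarrow> \<exists>N. \<forall>n x. n \<ge> N \<and> x \<in> ?S \<longrightarrow> norm (g (k n) x - h0 x) < e"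
  proof (rule Arzela_Ascoli[of ?S g "L * R"])
    show "norm (g n x) \<le> L * R" if "x \<in> ?S" for n x
      using lip[of n x 0] g0 that L by (smt (verit) diff_zero mem_cball_0 mult_left_mono real_norm_def)
    show "\<exists>d>0. \<forall>n y. y \<in> ?S \<and> norm (x - y) < d \<longrightarrow> norm (g n x - g n y) < e" if "e > 0" for x e
    proof (intro exI conjI allI impI)
      \<comment> \<open>\<open>L + 1\<close> instead of \<open>L\<close> keeps the modulus finite
        when \<open>L\<close> is zero.\<close>
      show "e / (L + 1) > 0" using L that by simp
      fix n y assume "y \<in> ?S \<and> norm (x - y) < e / (L + 1)"
      then have "norm (x - y) * (L + 1) < e" using L by (simp add: pos_less_divide_eq)
      then have "L * norm (x - y) < e" using norm_ge_zero[of "x - y"] by (simp add: algebra_simps del: norm_ge_zero) 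
      then show "norm (g n x - g n y) < e" using lip[of n x y] by simp
    qed
  qed auto
  have lim: "(\<lambda>n. g (k n) p) \<longlonglongrightarrow> h0 p" if "p \<in> ?S" for p
    using unif that unfolding LIMSEQ_iff by blast
  have h0: "L-lipschitz_on ?S h0"
  proof (rule lipschitz_onI)
    fix x y assume xy: "x \<in> ?S" "y \<in> ?S"
    have "(\<lambda>n. dist (g (k n) x) (g (k n) y)) \<longlonglongrightarrow> dist (h0 x) (h0 y)"
      by (intro tendsto_intros lim xy)
    then show "dist (h0 x) (h0 y) \<le> L * dist x y"
      by (rule LIMSEQ_le_const2) (use g lipschitz_onD in blast)
  qed (rule L)
  have cp: "closest_point ?S x \<in> ?S" for x
    by (rule closest_point_in_set) (use True in auto)
  have "L-lipschitz_on UNIV (\<lambda>x. h0 (closest_point ?S x))"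
  proof (rule lipschitz_onI)
    fix x y
    have "dist (h0 (closest_point ?S x)) (h0 (closest_point ?S y)) \<le> L * dist (closest_point ?S x) (closest_point ?S y)"
      by (rule lipschitz_onD[OF h0 cp cp])
    also have "\<dots> \<le> L * dist x y"
      by (intro mult_left_mono closest_point_lipschitz L) (use True in auto)
    finally show "dist (h0 (closest_point ?S x)) (h0 (closest_point ?S y)) \<le> L * dist x y" .
  qed (rule L)
  moreover have "(\<lambda>n. g (k n) p) \<longlonglongrightarrow> h0 (closest_point ?S p)" if "norm p \<le> R" for p
    using lim[of p] closest_point_self[of p ?S] that by simp
  ultimately show ?thesis using that k by blast
qed

section \<open>Graph charts and their height functions\<close>

definition base_point :: "real^3 \<Rightarrow> real^2" where
  "base_point z = vector [z $ 1, z $ 2]"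

lemma base_point_diff: "base_point (x - y) = base_point x - base_point y"
  by (simp add: base_point_def vec_eq_iff forall_2 vector_2)

lemma norm_base_point_le: "norm (base_point z) \<le> norm z"
  unfolding norm_vec_def L2_set_def base_point_def
  by (simp add: sum_2 sum_3 vector_2)

lemma base_point_0 [simp]: "base_point 0 = 0"
  using norm_base_point_le[of 0] by simp

lemma base_point_add_axis [simp]: "base_point (z + c *\<^sub>R axis 3 1) = base_point z"
  by (simp add: base_point_def vec_eq_iff forall_2 vector_2 axis_def)

text \<open>Positive inside the shape described by the chart, negative outside.\<close>

definition height :: "(real^3 \<Rightarrow> real^3) \<Rightarrow> (real^2 \<Rightarrow> real) \<Rightarrow> real^3 \<Rightarrow> real^3 \<Rightarrow> real" where
  "height T g x y = T (y - x) $ 3 - g (base_point (T (y - x)))"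

lemma lipschitz_chart_iff_height:
  "lipschitz_chart L r U x \<longleftrightarrow>
     (\<exists>T g. orthogonal_transformation T \<and> L-lipschitz_on UNIV g \<and>
            (\<forall>y\<in>ball x r. y \<in> U \<longleftrightarrow> 0 < height T g x y))"
proof -
  have "U \<inter> ball x r = {y \<in> ball x r. P y} \<longleftrightarrow> (\<forall>y\<in>ball x r. y \<in> U \<longleftrightarrow> P y)" for P by blast
  then show ?thesis unfolding lipschitz_chart_def height_def base_point_def by simp
qed

lemma norm_orthogonal_diff:
  "orthogonal_transformation T \<Longrightarrow> norm (T x - T y) = norm (x - y)"
  by (metis orthogonal_transformation_def orthogonal_transformation_norm linear_diff)

text \<open>\<open>T\<close> is an isometry and \<open>base_point\<close> a contraction, so the
  vertical coordinate contributes 1 and the graph function \<open>L\<close>.\<close>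

lemma height_lipschitz:
  assumes T: "orthogonal_transformation T" and g: "L-lipschitz_on UNIV g"
  shows "\<bar>height T g x y - height T g x z\<bar> \<le> (1 + L) * norm (y - z)"
proof -
  have L: "L \<ge> 0" using g lipschitz_on_nonneg by blast
  have n: "norm (T (y - x) - T (z - x)) = norm (y - z)"
    using norm_orthogonal_diff[OF T] by simp
  have "\<bar>T (y - x) $ 3 - T (z - x) $ 3\<bar> \<le> norm (y - z)"
    using component_le_norm_cart[of "T (y - x) - T (z - x)" 3] n by simp
  moreover have "\<bar>g (base_point (T (y - x))) - g (base_point (T (z - x)))\<bar> \<le> L * norm (y - z)"
  proof -
    have "\<bar>g (base_point (T (y - x))) - g (base_point (T (z - x)))\<bar>
        \<le> L * norm (base_point (T (y - x)) - base_point (T (z - x)))"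
      using lipschitz_onD[OF g, of "base_point (T (y - x))" "base_point (T (z - x))"] by (simp add: dist_norm)
    also have "\<dots> \<le> L * norm (y - z)"
      unfolding base_point_diff[symmetric] n[symmetric]
      using L norm_base_point_le mult_left_mono by blast
    finally show ?thesis .
  qed
  ultimately show ?thesis unfolding height_def by (simp add: algebra_simps abs_if split: if_splits)
qed

text \<open>The vertical direction of the chart, pulled back by \<open>T\<close>. It depends on
  \<open>T\<close> alone and raises the height at unit speed, so every zero of a height is
  approached by points of either sign.\<close>

lemma height_vertical:
  assumes T: "orthogonal_transformation T"
  obtains e where "norm e = 1" "\<And>g x y c. height T g x (y + c *\<^sub>R e) = height T g x y + c"
proof -
  obtain e where e: "T e = axis 3 1"
    using orthogonal_transformation_surj[OF T] by (metis surj_def)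
  have lin: "linear T" using T by (simp add: orthogonal_transformation_def)
  have "norm e = 1" using orthogonal_transformation_norm[OF T, of e] e by (simp add: norm_axis_1)
  moreover have "height T g x (y + c *\<^sub>R e) = height T g x y + c" for g x y c
  proof -
    have "T (y + c *\<^sub>R e - x) = T (y - x) + c *\<^sub>R axis 3 1"
      using lin e by (simp add: algebra_simps linear_add linear_scale linear_diff)
    moreover have "(axis 3 1 :: real^3) $ 3 = 1" by (simp add: axis_def)
    ultimately show ?thesis unfolding height_def by simp
  qed
  ultimately show ?thesis using that by blast
qed

text \<open>The zero set is the image of the plane with third coordinate 0 under a Lipschitz map:
  lift to the graph, undo \<open>T\<close>, translate. Lipschitz maps of the space into itself
  preserve null sets.\<close>

lemma negligible_height_zero:
  assumes T: "orthogonal_transformation T" and g: "L-lipschitz_on UNIV g"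
  shows "negligible {y. height T g x y = 0}"
proof -
  obtain S where S: "orthogonal_transformation S" "\<And>z. S (T z) = z"
    using orthogonal_transformation_inv[OF T] orthogonal_transformation_inj[OF T] inv_f_f by metis
  have linS: "linear S" using S by (simp add: orthogonal_transformation_def)
  let ?F = "\<lambda>z. x + S (z + g (base_point z) *\<^sub>R axis 3 1)"
  have "negligible (?F ` {z :: real^3. z $ 3 = 0})"
  proof (rule negligible_locally_Lipschitz_image[OF _ negligible_standard_hyperplane_cart])
    fix z :: "real^3"
    have "norm (?F y - ?F z) \<le> (1 + L) * norm (y - z)" for y
    proof -
      have "norm (?F y - ?F z) = norm ((y - z) + (g (base_point y) - g (base_point z)) *\<^sub>R axis 3 1 :: real^3)"
        using norm_orthogonal_diff[OF S(1), of "y + g (base_point y) *\<^sub>R axis 3 1" "z + g (base_point z) *\<^sub>R axis 3 1"]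
        by (simp add: algebra_simps)
      also have "\<dots> \<le> norm (y - z) + \<bar>g (base_point y) - g (base_point z)\<bar>"
        by (rule norm_triangle_le) (simp add: norm_axis_1)
      also have "\<bar>g (base_point y) - g (base_point z)\<bar> \<le> L * norm (base_point y - base_point z)"
        using lipschitz_onD[OF g, of "base_point y" "base_point z"] by (simp add: dist_norm)
      also have "L * norm (base_point y - base_point z) \<le> L * norm (y - z)"
        unfolding base_point_diff[symmetric] using g lipschitz_on_nonneg norm_base_point_le mult_left_mono by blast
      finally show ?thesis by (simp add: algebra_simps)
    qed
    then show "\<exists>T B. open T \<and> z \<in> T \<and> (\<forall>y\<in>{z. z $ 3 = 0} \<inter> T. norm (?F y - ?F z) \<le> B * norm (y - z))"
      by blast
  qed simp
  moreover have "{y. height T g x y = 0} \<subseteq> ?F ` {z. z $ 3 = 0}"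
  proof
    fix y assume "y \<in> {y. height T g x y = 0}"
    then have h: "T (y - x) $ 3 = g (base_point (T (y - x)))" by (simp add: height_def)
    \<comment> \<open>The foot of the point on the plane; lifting it by \<open>g\<close> gives back
      \<open>T (y - x)\<close> because the height vanishes.\<close>
    define z where "z = T (y - x) + (- (T (y - x) $ 3)) *\<^sub>R axis 3 1"
    have "base_point z = base_point (T (y - x))" unfolding z_def by (rule base_point_add_axis)
    then have "z + g (base_point z) *\<^sub>R axis 3 1 = T (y - x)" using h by (simp add: z_def)
    then have "y = ?F z" using S(2) by simp
    moreover have "z $ 3 = 0" by (simp add: z_def axis_def)
    ultimately show "y \<in> ?F ` {z. z $ 3 = 0}" by blast
  qed
  ultimately show ?thesis by (rule negligible_subset)
qed

text \<open>The operator norms are at most 1, so a subsequence converges in the finite-dimensional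
  space of linear maps; preservation of norms passes to the limit and characterizes
  orthogonality.\<close>

lemma orthogonal_transformation_compact:
  fixes T :: "nat \<Rightarrow> 'a::euclidean_space \<Rightarrow> 'a"
  assumes T: "\<And>n. orthogonal_transformation (T n)"
  obtains k S where "strict_mono (k :: nat \<Rightarrow> nat)" "orthogonal_transformation S"
    "\<And>x. (\<lambda>n. T (k n) x) \<longlonglongrightarrow> S x"
proof -
  define A where "A n = Blinfun (T n)" for n
  have bl: "bounded_linear (T n)" for n
    using T by (simp add: orthogonal_transformation_def linear_conv_bounded_linear)
  have A: "blinfun_apply (A n) x = T n x" for n x
    unfolding A_def by (simp add: bounded_linear_Blinfun_apply[OF bl])
  have "norm (A n) \<le> 1" for n
    by (rule norm_blinfun_bound) (simp_all add: A orthogonal_transformation_norm[OF T])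
  then have "bounded (range A)" by (auto simp: bounded_iff)
  then obtain B k where k: "strict_mono (k :: nat \<Rightarrow> nat)" and "(A \<circ> k) \<longlonglongrightarrow> B"
    using bounded_imp_convergent_subsequence by blast
  then have lim: "(\<lambda>n. T (k n) x) \<longlonglongrightarrow> blinfun_apply B x" for x
    using blinfun.tendsto[OF _ tendsto_const, of "A \<circ> k" B sequentially x] by (simp add: A o_def)
  have "norm (blinfun_apply B x) = norm x" for x
  proof (rule LIMSEQ_unique)
    show "(\<lambda>n. norm (T (k n) x)) \<longlonglongrightarrow> norm (blinfun_apply B x)" by (intro tendsto_norm lim)
    show "(\<lambda>n. norm (T (k n) x)) \<longlonglongrightarrow> norm x" by (simp add: orthogonal_transformation_norm[OF T])
  qed
  then have "orthogonal_transformation (blinfun_apply B)"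
    by (simp add: orthogonal_transformation blinfun.bounded_linear_right bounded_linear.linear)
  then show ?thesis using that k lim by blast
qed

text \<open>A frontier point has height \<open>- g 0\<close> in its own chart. A positive value
  would put it into the open set \<open>U\<close>, a negative one would keep a whole neighbourhood
  outside \<open>U\<close>. This normalizes the graph functions for Arzela-Ascoli.\<close>

lemma height_frontier:
  assumes "open U" "x \<in> frontier U" "r > 0" and T: "orthogonal_transformation T" and g: "L-lipschitz_on UNIV g"
    and chart: "\<forall>y\<in>ball x r. y \<in> U \<longleftrightarrow> 0 < height T g x y"
  shows "g 0 = 0"
proof -
  have L: "L \<ge> 0" using g lipschitz_on_nonneg by blast
  have "linear T" using T by (simp add: orthogonal_transformation_def)
  then have h: "height T g x x = - g 0" by (simp add: height_def linear_0)
  have "x \<notin> U" using assms(1,2) by (simp add: frontier_def interior_open)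
  then have "g 0 \<ge> 0" using chart \<open>r > 0\<close> h by (metis centre_in_ball neg_0_less_iff_less not_le)
  moreover have "\<not> g 0 > 0"
  proof
    assume pos: "g 0 > 0"
    \<comment> \<open>Within \<open>g 0 / (1 + L)\<close> the height cannot climb from
      \<open>- g 0\<close> to a positive value; within \<open>r\<close> the chart is valid.\<close>
    define d where "d = min r (g 0 / (1 + L))"
    have "d > 0" using pos L \<open>r > 0\<close> by (simp add: d_def)
    have "ball x d \<inter> U = {}"
    proof (rule ccontr)
      assume "ball x d \<inter> U \<noteq> {}"
      then obtain y where y: "y \<in> ball x d" "y \<in> U" by blast
      then have "0 < height T g x y" using chart by (auto simp: d_def)
      moreover have "\<bar>height T g x y - height T g x x\<bar> \<le> (1 + L) * norm (y - x)"
        using height_lipschitz[OF T g] .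
      moreover have "(1 + L) * norm (y - x) < g 0"
      proof -
        have "norm (y - x) < g 0 / (1 + L)" using y by (simp add: d_def dist_norm norm_minus_commute)
        then show ?thesis using L by (simp add: pos_less_divide_eq mult.commute)
      qed
      ultimately show False using h by linarith
    qed
    then have "x \<notin> closure U" using \<open>d > 0\<close>
      by (metis Int_emptyI centre_in_ball disjoint_iff open_Int_closure_eq_empty open_ball)
    then show False using assms(2) by (simp add: frontier_def)
  qed
  ultimately show ?thesis by linarith
qed

text \<open>A strict sign of the limit height is shared by the heights of late charts, uniformly on
  a small ball. Balls rather than points are produced so that basic open sets fit inside. Nothing is
  claimed on the limit graph itself.\<close>

lemma limit_chart:
  assumes "r > 0" and opn: "\<And>n. open (\<omega> n)" and fr: "\<And>n. x n \<in> frontier (\<omega> n)"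
    and chart: "\<And>n. lipschitz_chart L r (\<omega> n) (x n)" and lim: "x \<longlonglongrightarrow> z"
  obtains k T g where "strict_mono (k :: nat \<Rightarrow> nat)" "orthogonal_transformation T" "L-lipschitz_on UNIV g"
    "\<And>y. y \<in> ball z r \<Longrightarrow> height T g z y > 0 \<Longrightarrow> \<exists>e>0. \<forall>\<^sub>F n in sequentially. ball y e \<subseteq> \<omega> (k n)"
    "\<And>y. y \<in> ball z r \<Longrightarrow> height T g z y < 0 \<Longrightarrow> \<exists>e>0. \<forall>\<^sub>F n in sequentially. ball y e \<inter> \<omega> (k n) = {}"
proof -
  obtain T g where T: "\<And>n. orthogonal_transformation (T n)" and g: "\<And>n. L-lipschitz_on UNIV (g n)"
    and Tg: "\<And>n. \<forall>y\<in>ball (x n) r. y \<in> \<omega> n \<longleftrightarrow> 0 < height (T n) (g n) (x n) y"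
    using chart unfolding lipschitz_chart_iff_height by metis
  have L: "L \<ge> 0" using g lipschitz_on_nonneg by blast
  have g0: "g n 0 = 0" for n using height_frontier[OF opn fr \<open>r > 0\<close> T g Tg] .
  obtain k1 S where k1: "strict_mono (k1 :: nat \<Rightarrow> nat)" and S: "orthogonal_transformation S"
    and limS: "\<And>x. (\<lambda>n. T (k1 n) x) \<longlonglongrightarrow> S x"
    using orthogonal_transformation_compact[of T, OF T] by blast
  obtain k2 h where k2: "strict_mono (k2 :: nat \<Rightarrow> nat)" and h: "L-lipschitz_on UNIV h"
    and limh: "\<And>p. norm p \<le> r \<Longrightarrow> (\<lambda>n. g (k1 (k2 n)) p) \<longlonglongrightarrow> h p"
    using lipschitz_on_UNIV_compact[of L "\<lambda>n. g (k1 n)" r] g g0 by blast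
  define k where "k = k1 \<circ> k2"
  have k: "strict_mono k" unfolding k_def by (rule strict_mono_o[OF k1 k2])
  have limT: "(\<lambda>n. T (k n) y) \<longlonglongrightarrow> S y" for y
    using LIMSEQ_subseq_LIMSEQ[OF limS k2, of y] by (simp add: k_def o_def)
  have limx: "(\<lambda>n. x (k n)) \<longlonglongrightarrow> z" using LIMSEQ_subseq_LIMSEQ[OF lim k] by (simp add: o_def)
  let ?h = "\<lambda>n. height (T (k n)) (g (k n)) (x (k n))"
  \<comment> \<open>Both the transformation and its centre vary; as \<open>T (k n)\<close> is an
    isometry, moving the centre costs exactly \<open>norm (x (k n) - z)\<close>.\<close>
  have limTx: "(\<lambda>n. T (k n) (y - x (k n))) \<longlonglongrightarrow> S (y - z)" for y
  proof -
    have "(\<lambda>n. norm (T (k n) (y - x (k n)) - T (k n) (y - z))) \<longlonglongrightarrow> 0"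
    proof -
      have "norm (T (k n) (y - x (k n)) - T (k n) (y - z)) = norm (x (k n) - z)" for n
        using norm_orthogonal_diff[OF T, of "k n" "y - x (k n)" "y - z"] by (simp add: norm_minus_commute)
      then show ?thesis using tendsto_norm_zero[OF LIM_zero[OF limx]] by simp
    qed
    then have "(\<lambda>n. T (k n) (y - x (k n)) - T (k n) (y - z)) \<longlonglongrightarrow> 0" by (rule tendsto_norm_zero_cancel)
    from tendsto_add[OF this limT[of "y - z"]] show ?thesis by simp
  qed
  have limh': "(\<lambda>n. ?h n y) \<longlonglongrightarrow> height S h z y" if y: "y \<in> ball z r" for y
  proof -
    let ?p = "base_point (S (y - z))" and ?q = "\<lambda>n. base_point (T (k n) (y - x (k n)))"
    have "norm ?p \<le> r"
      using norm_base_point_le[of "S (y - z)"] orthogonal_transformation_norm[OF S, of "y - z"] y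
      by (simp add: dist_norm norm_minus_commute)
    then have 1: "(\<lambda>n. g (k n) ?p) \<longlonglongrightarrow> h ?p" using limh by (simp add: k_def)
    \<comment> \<open>The argument of \<open>g (k n)\<close> moves with \<open>n\<close>, while
      convergence is known only at fixed points of norm at most \<open>r\<close>; the common
      Lipschitz constant allows freezing it at \<open>?p\<close>.\<close>
    have 2: "(\<lambda>n. g (k n) (?q n) - g (k n) ?p) \<longlonglongrightarrow> 0"
    proof (rule Lim_null_comparison)
      show "\<forall>\<^sub>F n in sequentially. norm (g (k n) (?q n) - g (k n) ?p) \<le> L * norm (T (k n) (y - x (k n)) - S (y - z))"
      proof (rule always_eventually, rule allI)
        fix n
        have "norm (g (k n) (?q n) - g (k n) ?p) \<le> L * norm (?q n - ?p)"
          using lipschitz_onD[OF g, of "?q n" ?p "k n"] by (simp add: dist_norm)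
        also have "\<dots> \<le> L * norm (T (k n) (y - x (k n)) - S (y - z))"
          unfolding base_point_diff[symmetric] using L norm_base_point_le mult_left_mono by blast
        finally show "norm (g (k n) (?q n) - g (k n) ?p) \<le> L * norm (T (k n) (y - x (k n)) - S (y - z))" .
      qed
      show "(\<lambda>n. L * norm (T (k n) (y - x (k n)) - S (y - z))) \<longlonglongrightarrow> 0"
        using tendsto_mult[OF tendsto_const tendsto_norm_zero[OF LIM_zero[OF limTx[of y]]], of L] by simp
    qed
    have "(\<lambda>n. g (k n) (?q n)) \<longlonglongrightarrow> h ?p" using tendsto_add[OF 2 1] by simp
    then show ?thesis unfolding height_def by (intro tendsto_intros limTx)
  qed
  have near: "\<exists>e>0. \<forall>\<^sub>F n in sequentially. \<forall>w\<in>ball y e. w \<in> ball (x (k n)) r \<and> \<bar>?h n w - height S h z y\<bar> < c"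
    if y: "y \<in> ball z r" and "c > 0" for y c
  proof -
    \<comment> \<open>Two of the three shares of \<open>r - dist z y\<close> pay for the
      displacement of the centre and of \<open>w\<close>, so \<open>w\<close> stays in the chart
      ball. The second bound limits the variation of the height over the ball to
      \<open>c / 2\<close>; convergence at \<open>y\<close> supplies the other half.\<close>
    define e where "e = min ((r - dist z y) / 3) (c / (2 * (1 + L)))"
    have e: "e > 0" using y \<open>c > 0\<close> L by (simp add: e_def)
    have "\<forall>\<^sub>F n in sequentially. dist (x (k n)) z < e" using limx e by (rule tendstoD)
    moreover have "\<forall>\<^sub>F n in sequentially. dist (?h n y) (height S h z y) < c / 2"
      using limh'[OF y] \<open>c > 0\<close> by (intro tendstoD) auto
    ultimately have "\<forall>\<^sub>F n in sequentially. \<forall>w\<in>ball y e. w \<in> ball (x (k n)) r \<and> \<bar>?h n w - height S h z y\<bar> < c"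
    proof eventually_elim
      case (elim n)
      show ?case
      proof
        fix w assume w: "w \<in> ball y e"
        have "dist (x (k n)) w \<le> dist (x (k n)) z + dist z y + dist y w"
          using dist_triangle[of "x (k n)" w z] dist_triangle[of z w y] by linarith
        moreover have "3 * e \<le> r - dist z y" using min.cobounded1[of "(r - dist z y) / 3" "c / (2 * (1 + L))"] unfolding e_def[symmetric] by simp
        ultimately have 1: "w \<in> ball (x (k n)) r" using elim(1) w e by simp
        have "\<bar>?h n w - ?h n y\<bar> \<le> (1 + L) * norm (w - y)" by (rule height_lipschitz[OF T g])
        also have "\<dots> \<le> (1 + L) * (c / (2 * (1 + L)))"
          by (rule mult_left_mono) (use w L in \<open>auto simp: e_def dist_norm norm_minus_commute\<close>)
        also have "\<dots> = c / 2" using L by (simp add: field_simps)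
        finally have "\<bar>?h n w - ?h n y\<bar> \<le> c / 2" .
        moreover have "\<bar>?h n y - height S h z y\<bar> < c / 2" using elim(2) by (simp add: dist_real_def)
        ultimately have "\<bar>?h n w - height S h z y\<bar> < c" by argo
        then show "w \<in> ball (x (k n)) r \<and> \<bar>?h n w - height S h z y\<bar> < c" using 1 by simp
      qed
    qed
    then show ?thesis using e by blast
  qed
  show ?thesis
  proof (rule that[OF k S h])
    fix y assume y: "y \<in> ball z r" and pos: "height S h z y > 0"
    obtain e where "e > 0" and ev: "\<forall>\<^sub>F n in sequentially. \<forall>w\<in>ball y e. w \<in> ball (x (k n)) r \<and> \<bar>?h n w - height S h z y\<bar> < height S h z y"
      using near[OF y pos] by blast
    from ev have "\<forall>\<^sub>F n in sequentially. ball y e \<subseteq> \<omega> (k n)"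
    proof eventually_elim
      case (elim n)
      show ?case
      proof
        fix w assume w: "w \<in> ball y e"
        have "0 < ?h n w" using bspec[OF elim w] by (simp add: abs_less_iff)
        then show "w \<in> \<omega> (k n)" using elim w Tg by blast
      qed
    qed
    then show "\<exists>e>0. \<forall>\<^sub>F n in sequentially. ball y e \<subseteq> \<omega> (k n)" using \<open>e > 0\<close> by blast
  next
    fix y assume y: "y \<in> ball z r" and neg: "height S h z y < 0"
    obtain e where "e > 0" and ev: "\<forall>\<^sub>F n in sequentially. \<forall>w\<in>ball y e. w \<in> ball (x (k n)) r \<and> \<bar>?h n w - height S h z y\<bar> < - height S h z y"
      using near[OF y, of "- height S h z y"] neg by auto
    from ev have "\<forall>\<^sub>F n in sequentially. ball y e \<inter> \<omega> (k n) = {}"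
    proof eventually_elim
      case (elim n)
      have "w \<notin> \<omega> (k n)" if w: "w \<in> ball y e" for w
      proof -
        have "\<not> 0 < ?h n w" using bspec[OF elim w] by (simp add: abs_less_iff)
        then show ?thesis using elim w Tg by blast
      qed
      then show ?case by blast
    qed
    then show "\<exists>e>0. \<forall>\<^sub>F n in sequentially. ball y e \<inter> \<omega> (k n) = {}" using \<open>e > 0\<close> by blast
  qed
qed

text \<open>Eventual agreement at almost every point is the form from which dominated convergence
  makes the measures of the symmetric differences tend to zero. An empty limit needs no separate
  treatment, since it has no frontier.\<close>

lemma admissible_compact:
  assumes "r > 0" and adm: "\<And>n. \<omega> n \<in> admissible B L r"
  obtains k A where "strict_mono (k :: nat \<Rightarrow> nat)" "A \<in> admissible B L r"
    "negligible {x. \<not> (\<forall>\<^sub>F n in sequentially. x \<in> \<omega> (k n) \<longleftrightarrow> x \<in> A)}"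
proof -
  have opn: "open (\<omega> n)" and sub: "\<omega> n \<subseteq> B" and chart: "\<And>x. x \<in> frontier (\<omega> n) \<Longrightarrow> lipschitz_chart L r (\<omega> n) x" for n
    using adm[of n] by (auto simp: admissible_def)
  obtain \<B> :: "(real^3) set set" where \<B>: "countable \<B>" "topological_basis \<B>"
    using ex_countable_basis by blast
  have "\<B> \<noteq> {}" using \<B>(2) by (metis UNIV_I empty_iff open_UNIV topological_basisE)
  define U where "U = from_nat_into \<B>"
  have ranU: "range U = \<B>" unfolding U_def using \<B>(1) \<open>\<B> \<noteq> {}\<close> by (rule range_from_nat_into[rotated])
  have openU: "open (U i)" for i using \<B>(2) ranU topological_basis_open by blast
  have baseU: "\<exists>i. x \<in> U i \<and> U i \<subseteq> W" if "open W" "x \<in> W" for x W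
    using topological_basisE[OF \<B>(2) that] ranU by (metis rangeE)
  \<comment> \<open>Two Booleans per basic set: containment and disjointness. A nonempty basic set
    cannot have both; one that has neither meets the shape and its complement.\<close>
  obtain k where k: "strict_mono (k :: nat \<Rightarrow> nat)"
    and code: "\<And>i. \<exists>v. \<forall>\<^sub>F n in sequentially. (U i \<subseteq> \<omega> (k n), U i \<inter> \<omega> (k n) = {}) = v"
    using diagonal_eventually_constant[of "\<lambda>i n. (U i \<subseteq> \<omega> n, U i \<inter> \<omega> n = {})"] by blast
  define A where "A = (\<Union>i\<in>{i. \<forall>\<^sub>F n in sequentially. U i \<subseteq> \<omega> (k n)}. U i)"
  define C where "C = (\<Union>i\<in>{i. \<forall>\<^sub>F n in sequentially. U i \<inter> \<omega> (k n) = {}}. U i)"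
  have oA: "open A" and oC: "open C" unfolding A_def C_def using openU by auto
  have evA: "\<forall>\<^sub>F n in sequentially. x \<in> \<omega> (k n)" if "x \<in> A" for x
    using that unfolding A_def by (auto elim: eventually_mono)
  have evC: "\<forall>\<^sub>F n in sequentially. x \<notin> \<omega> (k n)" if "x \<in> C" for x
    using that unfolding C_def by (auto elim: eventually_mono)
  have AC: "A \<inter> C = {}"
  proof (rule ccontr)
    assume "A \<inter> C \<noteq> {}"
    then obtain x where "x \<in> A" "x \<in> C" by blast
    from eventually_conj[OF evA[OF this(1)] evC[OF this(2)]] show False by simp
  qed
  \<comment> \<open>The codes are eventually constant along the whole sequence, so a code observed
    along a subsequence \<open>m\<close> is the eventual one. The chart subsequences may therefore
    depend on the point without further diagonalization.\<close>
  have subseqA: "y \<in> A" if "e > 0" "strict_mono m" "\<forall>\<^sub>F n in sequentially. ball y e \<subseteq> \<omega> (k (m n))"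
    for y e and m :: "nat \<Rightarrow> nat"
  proof -
    obtain i where i: "y \<in> U i" "U i \<subseteq> ball y e" using baseU[of "ball y e" y] \<open>e > 0\<close> by auto
    obtain v where v: "\<forall>\<^sub>F n in sequentially. (U i \<subseteq> \<omega> (k n), U i \<inter> \<omega> (k n) = {}) = v" using code by blast
    have "\<forall>\<^sub>F n in sequentially. fst v"
      using that(3) eventually_subseq[OF that(2) v] by eventually_elim (use i in auto)
    then have "fst v" by simp
    then have "\<forall>\<^sub>F n in sequentially. U i \<subseteq> \<omega> (k n)" using v \<open>fst v\<close> by (auto elim!: eventually_mono)
    then show ?thesis using i unfolding A_def by blast
  qed
  have subseqC: "y \<in> C" if "e > 0" "strict_mono m" "\<forall>\<^sub>F n in sequentially. ball y e \<inter> \<omega> (k (m n)) = {}"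
    for y e and m :: "nat \<Rightarrow> nat"
  proof -
    obtain i where i: "y \<in> U i" "U i \<subseteq> ball y e" using baseU[of "ball y e" y] \<open>e > 0\<close> by auto
    obtain v where v: "\<forall>\<^sub>F n in sequentially. (U i \<subseteq> \<omega> (k n), U i \<inter> \<omega> (k n) = {}) = v" using code by blast
    have "\<forall>\<^sub>F n in sequentially. snd v"
      using that(3) eventually_subseq[OF that(2) v]
    proof eventually_elim
      case (elim n)
      then have "U i \<inter> \<omega> (k (m n)) = {}" using i(2) by blast
      then show ?case using elim(2) by auto
    qed
    then have "snd v" by simp
    then have "\<forall>\<^sub>F n in sequentially. U i \<inter> \<omega> (k n) = {}" using v \<open>snd v\<close> by (auto elim!: eventually_mono)
    then show ?thesis using i unfolding C_def by blast
  qed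
  \<comment> \<open>For a basic set around \<open>x\<close> inside the ball both codes are
    eventually false, so the ball meets the shape and its complement; being connected, it meets the
    frontier.\<close>
  have meets: "\<forall>\<^sub>F n in sequentially. ball x e \<inter> frontier (\<omega> (k n)) \<noteq> {}" if x: "x \<notin> A" "x \<notin> C" and "e > 0" for x e
  proof -
    obtain i where i: "x \<in> U i" "U i \<subseteq> ball x e" using baseU[of "ball x e" x] \<open>e > 0\<close> by auto
    obtain v where v: "\<forall>\<^sub>F n in sequentially. (U i \<subseteq> \<omega> (k n), U i \<inter> \<omega> (k n) = {}) = v" using code by blast
    have "\<not> fst v"
    proof
      assume "fst v"
      then have "\<forall>\<^sub>F n in sequentially. U i \<subseteq> \<omega> (k n)" using v \<open>fst v\<close> by (auto elim!: eventually_mono)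
      then show False using x i unfolding A_def by blast
    qed
    moreover have "\<not> snd v"
    proof
      assume "snd v"
      then have "\<forall>\<^sub>F n in sequentially. U i \<inter> \<omega> (k n) = {}" using v \<open>snd v\<close> by (auto elim!: eventually_mono)
      then show False using x i unfolding C_def by blast
    qed
    ultimately show ?thesis using v
    proof (elim eventually_mono)
      fix n assume *: "\<not> fst v" "\<not> snd v" "(U i \<subseteq> \<omega> (k n), U i \<inter> \<omega> (k n) = {}) = v"
      show "ball x e \<inter> frontier (\<omega> (k n)) \<noteq> {}"
      proof (rule connected_Int_frontier)
        have "\<not> U i \<subseteq> \<omega> (k n)" "U i \<inter> \<omega> (k n) \<noteq> {}" using * by auto
        then show "ball x e \<inter> \<omega> (k n) \<noteq> {}" "ball x e - \<omega> (k n) \<noteq> {}" using i(2) by blast+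
      qed simp
    qed
  qed
  have local: "\<exists>T g. orthogonal_transformation T \<and> L-lipschitz_on UNIV g \<and>
      (\<forall>y\<in>ball x r. (y \<in> A \<longleftrightarrow> 0 < height T g x y) \<and> (y \<in> A \<union> C \<longleftrightarrow> height T g x y \<noteq> 0))"
    if x: "x \<notin> A" "x \<notin> C" for x
  proof -
    \<comment> \<open>\<open>closest_point\<close> needs a nonempty set, so the sequence is started
      where the frontiers are nonempty.\<close>
    obtain N where N: "\<And>n. n \<ge> N \<Longrightarrow> frontier (\<omega> (k n)) \<noteq> {}"
      using meets[OF x, of 1] unfolding eventually_sequentially by fastforce
    define m where "m n = N + n" for n
    have m: "strict_mono m" by (simp add: m_def strict_mono_def)
    define p where "p n = closest_point (frontier (\<omega> (k (m n)))) x" for n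
    have p: "p n \<in> frontier (\<omega> (k (m n)))" for n
      unfolding p_def by (rule closest_point_in_set) (use N in \<open>auto simp: m_def\<close>)
    have "p \<longlonglongrightarrow> x"
    proof (rule tendstoI)
      fix e :: real assume "e > 0"
      have "\<forall>\<^sub>F n in sequentially. ball x e \<inter> frontier (\<omega> (k (m n))) \<noteq> {}"
        using eventually_subseq[OF m meets[OF x \<open>e > 0\<close>]] .
      then show "\<forall>\<^sub>F n in sequentially. dist (p n) x < e"
      proof eventually_elim
        case (elim n)
        then obtain q where q: "q \<in> frontier (\<omega> (k (m n)))" "dist x q < e" by auto
        have "dist x (p n) \<le> dist x q" unfolding p_def by (rule closest_point_le[OF _ q(1)]) simp
        then show ?case using q by (simp add: dist_commute)
      qed
    qed
    then obtain j T g where j: "strict_mono (j :: nat \<Rightarrow> nat)" and T: "orthogonal_transformation T" and g: "L-lipschitz_on UNIV g"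
      and pos: "\<And>y. y \<in> ball x r \<Longrightarrow> height T g x y > 0 \<Longrightarrow> \<exists>e>0. \<forall>\<^sub>F n in sequentially. ball y e \<subseteq> \<omega> (k (m (j n)))"
      and neg: "\<And>y. y \<in> ball x r \<Longrightarrow> height T g x y < 0 \<Longrightarrow> \<exists>e>0. \<forall>\<^sub>F n in sequentially. ball y e \<inter> \<omega> (k (m (j n))) = {}"
      using limit_chart[of r "\<lambda>n. \<omega> (k (m n))" p L x] \<open>r > 0\<close> opn p chart by blast
    have mj: "strict_mono (\<lambda>n. m (j n))" using strict_mono_o[OF m j] by (simp add: o_def)
    have posA: "y \<in> A" if "y \<in> ball x r" "height T g x y > 0" for y
      using pos[OF that] subseqA[OF _ mj] by blast
    have negC: "y \<in> C" if "y \<in> ball x r" "height T g x y < 0" for y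
      using neg[OF that] subseqC[OF _ mj] by blast
    obtain d where d: "norm d = 1" "\<And>g x y c. height T g x (y + c *\<^sub>R d) = height T g x y + c"
      using height_vertical[OF T] by blast
    \<comment> \<open>Steps of length \<open>e/2\<close> up and down reach \<open>A\<close> and
      \<open>C\<close> in every neighbourhood of a graph point; as \<open>A\<close> and
      \<open>C\<close> are open and disjoint, the point lies in neither.\<close>
    have zero: "y \<notin> A \<union> C" if y: "y \<in> ball x r" "height T g x y = 0" for y
    proof -
      have meet: "W \<inter> A \<noteq> {} \<and> W \<inter> C \<noteq> {}" if W: "open W" "y \<in> W" for W
      proof -
        have "open (W \<inter> ball x r)" "y \<in> W \<inter> ball x r" using W y by auto
        then obtain e where e: "e > 0" "ball y e \<subseteq> W \<inter> ball x r" using open_contains_ball by blast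
        have "y + (e/2) *\<^sub>R d \<in> ball y e" "y + (-(e/2)) *\<^sub>R d \<in> ball y e"
          using e(1) d(1) by (auto simp: dist_norm)
        moreover have "height T g x (y + (e/2) *\<^sub>R d) > 0" "height T g x (y + (-(e/2)) *\<^sub>R d) < 0"
          using e(1) y(2) by (simp_all only: d(2))
        ultimately show ?thesis using posA negC e(2) by (meson disjoint_iff le_inf_iff subsetD)
      qed
      show ?thesis using meet[OF oA] meet[OF oC] AC by blast
    qed
    have "\<forall>y\<in>ball x r. (y \<in> A \<longleftrightarrow> 0 < height T g x y) \<and> (y \<in> A \<union> C \<longleftrightarrow> height T g x y \<noteq> 0)"
    proof
      fix y assume y: "y \<in> ball x r"
      consider "height T g x y > 0" | "height T g x y < 0" | "height T g x y = 0" by linarith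
      then show "(y \<in> A \<longleftrightarrow> 0 < height T g x y) \<and> (y \<in> A \<union> C \<longleftrightarrow> height T g x y \<noteq> 0)"
      proof cases
        case 1 then show ?thesis using posA[OF y] by simp
      next
        case 2 then show ?thesis using negC[OF y] AC by auto
      next
        case 3 then show ?thesis using zero[OF y] by simp
      qed
    qed
    then show ?thesis using T g by blast
  qed
  \<comment> \<open>Local null sets suffice: near each of its points the remainder lies in the graph
    of a limit chart.\<close>
  have "negligible (- (A \<union> C))"
  proof (rule iffD2[OF locally_negligible_alt], rule ballI)
    fix x assume x: "x \<in> - (A \<union> C)"
    then obtain T g where T: "orthogonal_transformation T" and g: "L-lipschitz_on UNIV g"
      and "\<forall>y\<in>ball x r. y \<in> A \<union> C \<longleftrightarrow> height T g x y \<noteq> 0" using local[of x] by blast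
    then have "- (A \<union> C) \<inter> ball x r \<subseteq> {y. height T g x y = 0}" by auto
    then have "negligible (- (A \<union> C) \<inter> ball x r)"
      using negligible_height_zero[OF T g] negligible_subset by blast
    then show "\<exists>U. openin (top_of_set (- (A \<union> C))) U \<and> x \<in> U \<and> negligible U"
      using x \<open>r > 0\<close> by (intro exI[of _ "- (A \<union> C) \<inter> ball x r"]) auto
  qed
  moreover have "{x. \<not> (\<forall>\<^sub>F n in sequentially. x \<in> \<omega> (k n) \<longleftrightarrow> x \<in> A)} \<subseteq> - (A \<union> C)"
  proof -
    have "\<forall>\<^sub>F n in sequentially. x \<in> \<omega> (k n) \<longleftrightarrow> x \<in> A" if "x \<in> A \<union> C" for x
    proof (cases "x \<in> A")
      case True then show ?thesis using evA[OF True] by simp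
    next
      case False then show ?thesis using evC[of x] that by simp
    qed
    then show ?thesis by blast
  qed
  ultimately have neg: "negligible {x. \<not> (\<forall>\<^sub>F n in sequentially. x \<in> \<omega> (k n) \<longleftrightarrow> x \<in> A)}"
    by (rule negligible_subset)
  have "A \<subseteq> B"
  proof
    fix x assume "x \<in> A"
    then have "\<exists>n. x \<in> \<omega> (k n)" using eventually_happens[OF evA] by auto
    then show "x \<in> B" using sub by blast
  qed
  moreover have "lipschitz_chart L r A x" if "x \<in> frontier A" for x
  proof -
    have "x \<notin> A" using that oA by (simp add: frontier_def interior_open)
    moreover have "x \<notin> C"
      using that AC oC open_Int_closure_eq_empty[of C A] by (auto simp: frontier_def)
    ultimately show ?thesis using local[of x] unfolding lipschitz_chart_iff_height by blast
  qed
  ultimately have "A \<in> admissible B L r" using oA by (simp add: admissible_def)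
  then show ?thesis using that k neg by blast
qed

section \<open>Quadratic minimization\<close>

text \<open>Only semidefinite, because the vectors are functions: a field that vanishes almost
  everywhere has zero energy. With \<open>zero\<close>, the single combination
  \<open>u + c v\<close> encodes closure under both operations; symmetry supplies linearity in the
  second argument.\<close>

locale psd_form =
  fixes V :: "('a \<Rightarrow> 'b::real_vector) set" and a :: "('a \<Rightarrow> 'b) \<Rightarrow> ('a \<Rightarrow> 'b) \<Rightarrow> real"
  assumes zero: "(\<lambda>_. 0) \<in> V"
    and closed: "\<And>u v c. u \<in> V \<Longrightarrow> v \<in> V \<Longrightarrow> (\<lambda>x. u x + c *\<^sub>R v x) \<in> V"
    and sym: "\<And>u v. u \<in> V \<Longrightarrow> v \<in> V \<Longrightarrow> a u v = a v u"
    and lin: "\<And>u v w c. u \<in> V \<Longrightarrow> v \<in> V \<Longrightarrow> w \<in> V \<Longrightarrow>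
                a (\<lambda>x. u x + c *\<^sub>R v x) w = a u w + c * a v w"
    and nonneg: "\<And>u. u \<in> V \<Longrightarrow> 0 \<le> a u u"
begin

lemma diff_closed: "u \<in> V \<Longrightarrow> v \<in> V \<Longrightarrow> (\<lambda>x. u x - v x) \<in> V"
  using closed[of u v "-1"] by simp

lemma square_add:
  assumes "u \<in> V" "v \<in> V"
  shows "a (\<lambda>x. u x + c *\<^sub>R v x) (\<lambda>x. u x + c *\<^sub>R v x) = a u u + 2 * c * a u v + c\<^sup>2 * a v v"
proof -
  let ?w = "\<lambda>x. u x + c *\<^sub>R v x"
  have w: "?w \<in> V" using assms closed by blast
  have "a ?w ?w = a u ?w + c * a v ?w" using assms w lin by blast
  also have "a u ?w = a u u + c * a v u" using sym[OF assms(1) w] lin[OF assms assms(1)] by simp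
  also have "a v ?w = a u v + c * a v v" using sym[OF assms(2) w] lin[OF assms assms(2)] by simp
  finally show ?thesis using sym[OF assms] by (simp add: algebra_simps power2_eq_square)
qed

lemma form_cauchy_schwarz:
  assumes u: "u \<in> V" and v: "v \<in> V"
  shows "\<bar>a u v\<bar> \<le> sqrt (a u u) * sqrt (a v v)"
proof -
  have *: "0 \<le> a u u + 2 * c * a u v + c\<^sup>2 * a v v" for c
    using nonneg[OF closed[OF u v, of c]] square_add[OF u v] by simp
  have "(a u v)\<^sup>2 \<le> a u u * a v v"
  proof (cases "a v v = 0")
    case True
    have "a u v = 0"
    proof (rule ccontr)
      assume n: "a u v \<noteq> 0"
      \<comment> \<open>With \<open>a v v = 0\<close> the quadratic in \<open>c\<close> is affine;
        at this \<open>c\<close> it equals -1.\<close>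
      show False using *[of "- (a u u + 1) / (2 * a u v)"] n True nonneg[OF u] by (simp add: field_simps)
    qed
    then show ?thesis using True by simp
  next
    case False
    then have "a v v > 0" using nonneg[OF v] by simp
    \<comment> \<open>The minimizer of the quadratic in \<open>c\<close>.\<close>
    then show ?thesis using *[of "- a u v / a v v"]
      by (simp add: field_simps power2_eq_square)
  qed
  then have "sqrt ((a u v)\<^sup>2) \<le> sqrt (a u u * a v v)" by (rule real_sqrt_le_mono)
  then show ?thesis by (simp add: real_sqrt_mult)
qed

lemma form_tendsto_0:
  assumes "u \<in> V" "\<And>n. d n \<in> V" "(\<lambda>n. a (d n) (d n)) \<longlonglongrightarrow> 0"
  shows "(\<lambda>n. a u (d n)) \<longlonglongrightarrow> 0"
proof (rule Lim_null_comparison)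
  show "\<forall>\<^sub>F n in sequentially. norm (a u (d n)) \<le> sqrt (a u u) * sqrt (a (d n) (d n))"
    using form_cauchy_schwarz assms by simp
  show "(\<lambda>n. sqrt (a u u) * sqrt (a (d n) (d n))) \<longlonglongrightarrow> 0"
    using tendsto_mult[OF tendsto_const tendsto_real_sqrt[OF assms(3)], of "sqrt (a u u)"] by simp
qed

lemma form_square_tendsto:
  assumes u: "u \<in> V" and s: "\<And>n. s n \<in> V" 
    and lim: "(\<lambda>n. a (\<lambda>x. s n x - u x) (\<lambda>x. s n x - u x)) \<longlonglongrightarrow> 0"
  shows "(\<lambda>n. a (s n) (s n)) \<longlonglongrightarrow> a u u"
proof -
  let ?d = "\<lambda>n x. s n x - u x"
  have d: "?d n \<in> V" for n using diff_closed[OF s u] .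
  have "a (s n) (s n) = a u u + 2 * a u (?d n) + a (?d n) (?d n)" for n
    using square_add[OF u d, of 1 n] by simp
  moreover have "(\<lambda>n. a u u + 2 * a u (?d n) + a (?d n) (?d n)) \<longlonglongrightarrow> a u u + 2 * 0 + 0"
    by (intro tendsto_intros lim form_tendsto_0 u d)
  ultimately show ?thesis by simp
qed

text \<open>The parallelogram law, with the midpoint written as a step from \<open>u\<close> towards
  \<open>v\<close>, the form in which convexity of the functional is assumed.\<close>

lemma midpoint_identity:
  assumes u: "u \<in> V" and v: "v \<in> V"
  defines "m \<equiv> \<lambda>x. u x + (1/2) *\<^sub>R (v x - u x)"
  shows "a m m = (a u u + a v v) / 2 - a (\<lambda>x. v x - u x) (\<lambda>x. v x - u x) / 4"
proof -
  let ?d = "\<lambda>x. v x - u x"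
  have d: "?d \<in> V" using diff_closed[OF v u] .
  have "a m m = a u u + a u ?d + a ?d ?d / 4"
    unfolding m_def using square_add[OF u d, of "1/2"] by (simp add: power2_eq_square)
  moreover have "a v v = a u u + 2 * a u ?d + a ?d ?d"
    using square_add[OF u d, of 1] by simp
  ultimately show ?thesis by (simp add: field_simps)
qed

text \<open>The midpoint identity makes every minimizing sequence of the energy
  \<open>a v v / 2 + \<psi> v\<close> a Cauchy sequence, so that no weak compactness is needed.\<close>

lemma variational_inequality_solvable:
  assumes complete: "\<And>s. (\<And>n. s n \<in> V) \<Longrightarrow>
      (\<And>e. e > 0 \<Longrightarrow> \<exists>N::nat. \<forall>m\<ge>N. \<forall>n\<ge>N. a (\<lambda>x. s m x - s n x) (\<lambda>x. s m x - s n x) < e) \<Longrightarrow>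
      \<exists>u\<in>V. (\<lambda>n. a (\<lambda>x. s n x - u x) (\<lambda>x. s n x - u x)) \<longlonglongrightarrow> 0"
    and conv: "\<And>u v t. u \<in> V \<Longrightarrow> v \<in> V \<Longrightarrow> 0 \<le> t \<Longrightarrow> t \<le> 1 \<Longrightarrow>
      \<psi> (\<lambda>x. u x + t *\<^sub>R (v x - u x)) \<le> \<psi> u + t * (\<psi> v - \<psi> u)"
    and lip: "\<And>u v. u \<in> V \<Longrightarrow> v \<in> V \<Longrightarrow>
      \<bar>\<psi> u - \<psi> v\<bar> \<le> C * sqrt (a (\<lambda>x. u x - v x) (\<lambda>x. u x - v x))"
  shows "\<exists>u\<in>V. \<forall>v\<in>V. a u (\<lambda>x. v x - u x) + \<psi> v - \<psi> u \<ge> 0"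
proof -
  define F where "F v = a v v / 2 + \<psi> v" for v
  \<comment> \<open>The functional decreases at most linearly in \<open>q\<close>, and
    \<open>q\<^sup>2 / 2 - C * q\<close> is at least \<open>- C\<^sup>2 / 2\<close>.\<close>
  have lower: "F v \<ge> \<psi> (\<lambda>_. 0) - C\<^sup>2 / 2" if v: "v \<in> V" for v
  proof -
    define q where "q = sqrt (a v v)"
    have "\<psi> v \<ge> \<psi> (\<lambda>_. 0) - C * q" using lip[OF v zero] by (simp add: q_def abs_le_iff)
    moreover have "a v v = q\<^sup>2" using nonneg[OF v] by (simp add: q_def)
    moreover have "(q - C)\<^sup>2 \<ge> 0" by simp
    ultimately show ?thesis unfolding F_def by (simp add: power2_diff algebra_simps)
  qed
  define I where "I = Inf (F ` V)"
  have bdd: "bdd_below (F ` V)" using lower by (intro bdd_belowI2) blast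
  have I: "I \<le> F v" if "v \<in> V" for v unfolding I_def using bdd that by (simp add: cINF_lower)
  have "\<exists>v\<in>V. F v < I + 1 / real (Suc n)" for n
    using cInf_lessD[of "F ` V" "I + 1 / real (Suc n)"] zero unfolding I_def by auto
  then obtain s where s: "\<And>n. s n \<in> V" and Fs: "\<And>n. F (s n) < I + 1 / real (Suc n)" by metis
  define \<delta> where "\<delta> n = 1 / real (Suc n)" for n
  \<comment> \<open>The energy of the midpoint is at least \<open>I\<close> and at most the mean of
    the two energies minus one eighth of the squared distance (4 from the midpoint identity, 2 from
    the factor in \<open>F\<close>). The mean exceeds \<open>I\<close> by less than
    \<open>(\<delta> m + \<delta> n) / 2\<close>; clearing the 8 gives the constant 4.\<close>
  have cauchy: "a (\<lambda>x. s m x - s n x) (\<lambda>x. s m x - s n x) \<le> 4 * (\<delta> m + \<delta> n)" for m n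
  proof -
    let ?m = "\<lambda>x. s n x + (1/2) *\<^sub>R (s m x - s n x)"
    have "?m \<in> V" using closed[OF s diff_closed[OF s s]] .
    then have "I \<le> F ?m" by (rule I)
    also have "F ?m \<le> (F (s n) + F (s m)) / 2 - a (\<lambda>x. s m x - s n x) (\<lambda>x. s m x - s n x) / 8"
      using midpoint_identity[OF s s, of n m] conv[OF s s, of "1/2" n m]
      unfolding F_def by simp argo
    finally show ?thesis using Fs[of n] Fs[of m] unfolding \<delta>_def[symmetric] by argo
  qed
  obtain u where u: "u \<in> V" and lim: "(\<lambda>n. a (\<lambda>x. s n x - u x) (\<lambda>x. s n x - u x)) \<longlonglongrightarrow> 0"
  proof -
    have "\<exists>N::nat. \<forall>m\<ge>N. \<forall>n\<ge>N. a (\<lambda>x. s m x - s n x) (\<lambda>x. s m x - s n x) < e" if "e > 0" for e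
    proof -
      obtain N where N: "\<delta> N < e / 8" using nat_approx_posE[of "e/8"] \<open>e > 0\<close> by (auto simp: \<delta>_def)
      have "a (\<lambda>x. s m x - s n x) (\<lambda>x. s m x - s n x) < e" if "m \<ge> N" "n \<ge> N" for m n
      proof -
        have "\<delta> m \<le> \<delta> N" "\<delta> n \<le> \<delta> N"
          using that by (simp_all add: \<delta>_def frac_le)
        then show ?thesis using cauchy[of m n] N by argo
      qed
      then show ?thesis by blast
    qed
    then show ?thesis using complete[of s] s that by blast
  qed
  have Fu: "F u \<le> I"
  proof (rule LIMSEQ_le)
    have "(\<lambda>n. \<psi> (s n) - \<psi> u) \<longlonglongrightarrow> 0"
    proof (rule Lim_null_comparison)
      show "\<forall>\<^sub>F n in sequentially. norm (\<psi> (s n) - \<psi> u) \<le> C * sqrt (a (\<lambda>x. s n x - u x) (\<lambda>x. s n x - u x))"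
        using lip[OF s u] by simp
      show "(\<lambda>n. C * sqrt (a (\<lambda>x. s n x - u x) (\<lambda>x. s n x - u x))) \<longlonglongrightarrow> 0"
        using tendsto_mult[OF tendsto_const tendsto_real_sqrt[OF lim], of C] by simp
    qed
    then have "(\<lambda>n. \<psi> (s n)) \<longlonglongrightarrow> \<psi> u" by (simp add: LIM_zero_iff)
    then show "(\<lambda>n. F (s n)) \<longlonglongrightarrow> F u" unfolding F_def
      by (intro tendsto_intros form_square_tendsto u s lim) auto
    show "(\<lambda>n. I + 1 / real (Suc n)) \<longlonglongrightarrow> I"
      using tendsto_add[OF tendsto_const LIMSEQ_inverse_real_of_nat, of I] by (simp add: inverse_eq_divide)
    show "\<exists>N. \<forall>n\<ge>N. F (s n) \<le> I + 1 / real (Suc n)" using Fs less_imp_le by blast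
  qed
  have "0 \<le> a u (\<lambda>x. v x - u x) + \<psi> v - \<psi> u" if v: "v \<in> V" for v
  proof (rule field_le_epsilon)
    fix e :: real assume "e > 0"
    let ?d = "\<lambda>x. v x - u x"
    have d: "?d \<in> V" using diff_closed[OF v u] .
    \<comment> \<open>Comparing \<open>F u\<close> with the value after a step \<open>t\<close>
      towards \<open>v\<close> and dividing by \<open>t\<close> leaves an error
      \<open>t * a ?d ?d / 2\<close>; this \<open>t\<close> makes it at most \<open>e\<close>. The
      \<open>+ 1\<close> covers directions of zero energy.\<close>
    define t where "t = min 1 (e / (a ?d ?d + 1))"
    have t: "0 < t" "t \<le> 1" "t * a ?d ?d \<le> e"
    proof -
      have p: "a ?d ?d \<ge> 0" using nonneg d by blast
      show "0 < t" "t \<le> 1" using \<open>e > 0\<close> p by (auto simp: t_def)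
      have "t * a ?d ?d \<le> e / (a ?d ?d + 1) * a ?d ?d" by (rule mult_right_mono) (auto simp: t_def p)
      also have "\<dots> \<le> e" using p \<open>e > 0\<close> by (simp add: field_simps)
      finally show "t * a ?d ?d \<le> e" .
    qed
    have "F u \<le> F (\<lambda>x. u x + t *\<^sub>R ?d x)" using Fu I[OF closed[OF u d, of t]] by (rule order_trans)
    also have "\<dots> \<le> (a u u + 2 * t * a u ?d + t\<^sup>2 * a ?d ?d) / 2 + (\<psi> u + t * (\<psi> v - \<psi> u))"
      using conv[OF u v, of t] t unfolding F_def square_add[OF u d, of t] by simp
    finally have "0 \<le> t * a u ?d + t\<^sup>2 * a ?d ?d / 2 + t * (\<psi> v - \<psi> u)"
      unfolding F_def by (simp add: add_divide_distrib)
    also have "\<dots> = t * (a u ?d + t * a ?d ?d / 2 + (\<psi> v - \<psi> u))"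
      by (simp add: algebra_simps power2_eq_square)
    finally have "0 \<le> a u ?d + t * a ?d ?d / 2 + (\<psi> v - \<psi> u)"
      using t(1) by (simp add: zero_le_mult_iff)
    then show "0 \<le> a u ?d + \<psi> v - \<psi> u + e" using t(3) \<open>e > 0\<close> by argo
  qed
  then show ?thesis using u by blast
qed

end

section \<open>Square integrable fields\<close>

definition square_integrable :: "'a measure \<Rightarrow> ('a \<Rightarrow> 'b::euclidean_space) \<Rightarrow> bool" where
  "square_integrable M v \<longleftrightarrow> v \<in> borel_measurable M \<and> integrable M (\<lambda>x. (norm (v x))\<^sup>2)"

lemma L2_fields_iff: "v \<in> L2_fields \<Omega> \<longleftrightarrow> square_integrable (lebesgue_on \<Omega>) v"
  by (simp add: L2_fields_def square_integrable_def)

lemma square_integrable_measurable [measurable_dest]: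
  "square_integrable M v \<Longrightarrow> v \<in> borel_measurable M"
  by (simp add: square_integrable_def)

lemma square_integrable_zero: "square_integrable M (\<lambda>_. 0)"
  by (simp add: square_integrable_def)

lemma power2_sum_le: "(a + b :: real)\<^sup>2 \<le> 2 * a\<^sup>2 + 2 * b\<^sup>2"
  using zero_le_power2[of "a - b"] by (simp add: power2_sum power2_diff)

lemma norm_add_square_le:
  "(norm (x + y :: 'a::real_normed_vector))\<^sup>2 \<le> 2 * (norm x)\<^sup>2 + 2 * (norm y)\<^sup>2"
  by (rule order_trans[OF power_mono[OF norm_triangle_ineq] power2_sum_le]) simp

lemma square_integrable_bound:
  assumes "v \<in> borel_measurable M" "integrable M g" "AE x in M. (norm (v x))\<^sup>2 \<le> g x"
  shows "square_integrable M v"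
  unfolding square_integrable_def
proof
  show "integrable M (\<lambda>x. (norm (v x))\<^sup>2)"
    by (rule Bochner_Integration.integrable_bound[OF assms(2)]) (use assms in auto)
qed (use assms in auto)

lemma square_integrable_add_scaleR:
  assumes "square_integrable M u" "square_integrable M v"
  shows "square_integrable M (\<lambda>x. u x + c *\<^sub>R v x)"
proof (rule square_integrable_bound)
  note [measurable] = assms
  show "(\<lambda>x. u x + c *\<^sub>R v x) \<in> borel_measurable M" by measurable
  show "integrable M (\<lambda>x. 2 * (norm (u x))\<^sup>2 + 2 * c\<^sup>2 * (norm (v x))\<^sup>2)"
    using assms by (simp add: square_integrable_def)
  show "AE x in M. (norm (u x + c *\<^sub>R v x))\<^sup>2 \<le> 2 * (norm (u x))\<^sup>2 + 2 * c\<^sup>2 * (norm (v x))\<^sup>2"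
  proof (rule AE_I2)
    fix x show "(norm (u x + c *\<^sub>R v x))\<^sup>2 \<le> 2 * (norm (u x))\<^sup>2 + 2 * c\<^sup>2 * (norm (v x))\<^sup>2"
      using norm_add_square_le[of "u x" "c *\<^sub>R v x"] by (simp add: power_mult_distrib)
  qed
qed

lemma square_integrable_diff:
  "square_integrable M u \<Longrightarrow> square_integrable M v \<Longrightarrow> square_integrable M (\<lambda>x. u x - v x)"
  using square_integrable_add_scaleR[of M u v "-1"] by simp

text \<open>Young's inequality. The factor \<open>c\<close> leaves room for a bounded matrix
  coefficient between the two fields.\<close>

lemma integrable_inner_of_bound:
  assumes "square_integrable M u" "square_integrable M v"
    and "g \<in> borel_measurable M" "AE x in M. \<bar>g x\<bar> \<le> c * (norm (u x) * norm (v x))" "c \<ge> 0"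
  shows "integrable M (g :: _ \<Rightarrow> real)"
proof (rule Bochner_Integration.integrable_bound)
  show "integrable M (\<lambda>x. c * ((norm (u x))\<^sup>2 + (norm (v x))\<^sup>2))"
    using assms by (simp add: square_integrable_def)
  show "AE x in M. norm (g x) \<le> norm (c * ((norm (u x))\<^sup>2 + (norm (v x))\<^sup>2))"
    using assms(4)
  proof eventually_elim
    case (elim x)
    have "2 * (norm (u x) * norm (v x)) \<le> (norm (u x))\<^sup>2 + (norm (v x))\<^sup>2"
      using sum_squares_bound[of "norm (u x)" "norm (v x)"] by simp
    moreover have "norm (u x) * norm (v x) \<ge> 0" by simp
    ultimately have "norm (u x) * norm (v x) \<le> (norm (u x))\<^sup>2 + (norm (v x))\<^sup>2" by linarith
    then have "c * (norm (u x) * norm (v x)) \<le> c * ((norm (u x))\<^sup>2 + (norm (v x))\<^sup>2)"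
      using \<open>c \<ge> 0\<close> by (rule mult_left_mono)
    then show ?case using elim by simp
  qed
qed (use assms in auto)

lemma integrable_inner:
  "square_integrable M u \<Longrightarrow> square_integrable M v \<Longrightarrow> integrable M (\<lambda>x. u x \<bullet> v x)"
  by (rule integrable_inner_of_bound[where c=1 and u=u and v=v])
     (auto simp: Cauchy_Schwarz_ineq2 square_integrable_def)

lemma (in finite_measure) square_integrable_imp_integrable:
  assumes "square_integrable M v"
  shows "integrable M v"
proof (rule Bochner_Integration.integrable_bound)
  show "integrable M (\<lambda>x. 1 + (norm (v x))\<^sup>2)"
    using assms by (simp add: square_integrable_def)
  show "AE x in M. norm (v x) \<le> norm (1 + (norm (v x))\<^sup>2)"
  proof (rule AE_I2)
    fix x
    have "2 * norm (v x) * 1 \<le> (norm (v x))\<^sup>2 + 1\<^sup>2" by (rule sum_squares_bound)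
    then show "norm (v x) \<le> norm (1 + (norm (v x))\<^sup>2)" using norm_ge_zero[of "v x"] by (simp del: norm_ge_zero)
  qed
qed (use assms in \<open>auto simp: square_integrable_def\<close>)

lemma psd_form_inner: "psd_form {v. square_integrable M v} (\<lambda>u v. \<integral>x. u x \<bullet> v x \<partial>M)"
proof
  fix u v w :: "'a \<Rightarrow> 'b" and c
  assume [simplified]: "u \<in> {v. square_integrable M v}" "v \<in> {v. square_integrable M v}" "w \<in> {v. square_integrable M v}"
  then show "(\<integral>x. (u x + c *\<^sub>R v x) \<bullet> w x \<partial>M) = (\<integral>x. u x \<bullet> w x \<partial>M) + c * (\<integral>x. v x \<bullet> w x \<partial>M)"
    by (simp add: inner_add_left integrable_inner)
qed (auto simp: square_integrable_zero square_integrable_add_scaleR inner_commute)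

text \<open>The Riesz-Fischer argument: increments along a fast subsequence are summable in L^1,
  hence pointwise almost everywhere, and Fatou's lemma turns the pointwise limit into an L^2 limit
  of the whole sequence. Finiteness of the measure enters where L^2 bounds become L^1
  bounds.\<close>

lemma (in finite_measure) square_integrable_complete:
  fixes s :: "nat \<Rightarrow> 'a \<Rightarrow> 'b::euclidean_space"
  assumes s: "\<And>n. square_integrable M (s n)"
    and cauchy: "\<And>e. e > 0 \<Longrightarrow> \<exists>N. \<forall>m\<ge>N. \<forall>n\<ge>N. (\<integral>x. (norm (s m x - s n x))\<^sup>2 \<partial>M) < e"
  shows "\<exists>v. square_integrable M v \<and> (\<lambda>n. \<integral>x. (norm (s n x - v x))\<^sup>2 \<partial>M) \<longlonglongrightarrow> 0"
proof -
  note [measurable] = s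
  have int: "integrable M (\<lambda>x. (norm (s m x - s n x))\<^sup>2)" for m n
    using square_integrable_diff[OF s s] by (simp add: square_integrable_def)
  \<comment> \<open>Squared increments below \<open>(1/4)^i\<close> give L^1 increments of order
    \<open>(1/2)^i\<close>, which are summable.\<close>
  obtain k where k: "strict_mono (k :: nat \<Rightarrow> nat)"
    and small: "\<And>i m n. m \<ge> k i \<Longrightarrow> n \<ge> k i \<Longrightarrow> (\<integral>x. (norm (s m x - s n x))\<^sup>2 \<partial>M) < (1/4)^i"
  proof -
    define P where "P i K \<longleftrightarrow> (\<forall>m\<ge>K. \<forall>n\<ge>K. (\<integral>x. (norm (s m x - s n x))\<^sup>2 \<partial>M) < (1/4)^i)" for i K
    have "\<exists>k. \<forall>n. P n (k n) \<and> k n < k (Suc n)"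
    proof (rule dependent_nat_choice)
      show "\<exists>x. P 0 x" using cauchy[of 1] by (simp add: P_def)
      fix K i
      obtain N where "P (Suc i) N" using cauchy[of "(1/4)^Suc i"] by (auto simp: P_def)
      then have "P (Suc i) (max N (Suc K))" by (auto simp: P_def)
      then show "\<exists>y. P (Suc i) y \<and> K < y" by (intro exI[of _ "max N (Suc K)"]) auto
    qed
    then show ?thesis using that unfolding P_def strict_mono_Suc_iff by blast
  qed
  define d where "d i x = norm (s (k (Suc i)) x - s (k i) x)" for i x
  have d_meas [measurable]: "d i \<in> borel_measurable M" for i unfolding d_def by measurable
  have d_int: "(\<integral>\<^sup>+x. ennreal (d i x) \<partial>M) \<le> ennreal ((measure M (space M) + 1) * (1/2)^i)" for i
  proof -
    have sq: "integrable M (\<lambda>x. (d i x)\<^sup>2)" unfolding d_def by (rule int)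
    have kk: "k i \<le> k (Suc i)" using k by (simp add: strict_mono_less_eq)
    have "(\<integral>x. (d i x)\<^sup>2 \<partial>M) \<le> (1/4)^i"
      unfolding d_def using small[of i "k (Suc i)" "k i"] kk by simp
    then have le: "2^i * (\<integral>x. (d i x)\<^sup>2 \<partial>M) \<le> (1/2)^i"
      using mult_left_mono[of _ "(1/4)^i" "2^i::real"] by (simp add: power_mult_distrib[symmetric])
    \<comment> \<open>Weighted AM-GM: the first term integrates to \<open>(1/2)^i\<close> times the
      total mass, the second to at most \<open>(1/2)^i\<close> by the choice of the
      subsequence.\<close>
    have "(\<integral>\<^sup>+x. ennreal (d i x) \<partial>M) \<le> (\<integral>\<^sup>+x. ennreal ((1/2)^i + 2^i * (d i x)\<^sup>2) \<partial>M)"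
    proof (intro nn_integral_mono ennreal_leI)
      fix x
      have "0 \<le> 2^i * (d i x - (1/2)^i)\<^sup>2" by simp
      also have "\<dots> = (1/2)^i + 2^i * (d i x)\<^sup>2 - 2 * d i x"
        by (simp add: power2_diff power2_eq_square algebra_simps power_mult_distrib[symmetric])
      finally have "2 * d i x \<le> (1/2)^i + 2^i * (d i x)\<^sup>2" by simp
      moreover have "0 \<le> d i x" by (simp add: d_def)
      ultimately show "d i x \<le> (1/2)^i + 2^i * (d i x)\<^sup>2" by linarith
    qed
    also have "\<dots> = ennreal (\<integral>x. (1/2)^i + 2^i * (d i x)\<^sup>2 \<partial>M)"
      by (intro nn_integral_eq_integral) (use sq in auto)
    also have "(\<integral>x. (1/2)^i + 2^i * (d i x)\<^sup>2 \<partial>M) \<le> (measure M (space M) + 1) * (1/2)^i"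
      using sq le by (simp add: algebra_simps)
    finally show ?thesis by (simp add: ennreal_leI)
  qed
  have "(\<integral>\<^sup>+x. (\<Sum>i. ennreal (d i x)) \<partial>M) = (\<Sum>i. \<integral>\<^sup>+x. ennreal (d i x) \<partial>M)"
    by (rule nn_integral_suminf) simp
  also have "\<dots> \<le> (\<Sum>i. ennreal ((measure M (space M) + 1) * (1/2)^i))"
    by (intro suminf_le d_int) auto
  also have "\<dots> = ennreal (\<Sum>i. (measure M (space M) + 1) * (1/2)^i)"
    by (rule suminf_ennreal2) (auto intro!: summable_mult summable_geometric)
  finally have "(\<integral>\<^sup>+x. (\<Sum>i. ennreal (d i x)) \<partial>M) \<noteq> \<infinity>"
    using ennreal_less_top leD top_greatest by (metis infinity_ennreal_def)
  then have "AE x in M. (\<Sum>i. ennreal (d i x)) \<noteq> \<infinity>"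
    by (intro nn_integral_PInf_AE) auto
  then have conv: "AE x in M. convergent (\<lambda>i. s (k i) x)"
  proof eventually_elim
    case (elim x)
    have "summable (\<lambda>i. d i x)"
      by (rule summable_suminf_not_top) (use elim in \<open>auto simp: d_def\<close>)
    then have "summable (\<lambda>i. s (k (Suc i)) x - s (k i) x)"
      unfolding d_def by (rule summable_norm_cancel)
    then have "(\<lambda>n. \<Sum>i<n. s (k (Suc i)) x - s (k i) x) \<longlonglongrightarrow> (\<Sum>i. s (k (Suc i)) x - s (k i) x)"
      by (rule summable_LIMSEQ)
    then have "(\<lambda>n. s (k n) x - s (k 0) x) \<longlonglongrightarrow> (\<Sum>i. s (k (Suc i)) x - s (k i) x)"
      by (simp only: sum_lessThan_telescope[where f="\<lambda>i. s (k i) x"])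
    from tendsto_add[OF this tendsto_const[of "s (k 0) x"]] show ?case
      by (auto intro: convergentI)
  qed
  \<comment> \<open>Where the subsequence diverges the value of \<open>lim\<close> is arbitrary, but
    this happens only on a null set.\<close>
  define v where "v x = lim (\<lambda>i. s (k i) x)" for x
  have v_meas [measurable]: "v \<in> borel_measurable M" unfolding v_def by measurable
  have lim: "AE x in M. (\<lambda>i. s (k i) x) \<longlonglongrightarrow> v x"
    using conv by eventually_elim (simp add: v_def convergent_LIMSEQ_iff)
  \<comment> \<open>A bound valid for all pairs of indices beyond \<open>N\<close> survives when the
    second index runs to infinity along the subsequence; \<open>k i\<close> is beyond
    \<open>N\<close> as soon as \<open>i\<close> is.\<close>
  have fatou: "(\<integral>\<^sup>+x. ennreal ((norm (s n x - v x))\<^sup>2) \<partial>M) \<le> ennreal e"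
    if N: "\<And>m n. m \<ge> N \<Longrightarrow> n \<ge> N \<Longrightarrow> (\<integral>x. (norm (s m x - s n x))\<^sup>2 \<partial>M) < e" and "n \<ge> N" for e N n
  proof -
    have "(\<integral>\<^sup>+x. ennreal ((norm (s n x - v x))\<^sup>2) \<partial>M) =
          (\<integral>\<^sup>+x. liminf (\<lambda>i. ennreal ((norm (s n x - s (k i) x))\<^sup>2)) \<partial>M)"
      using lim
    proof (intro nn_integral_cong_AE, eventually_elim)
      case (elim x)
      have "(\<lambda>i. ennreal ((norm (s n x - s (k i) x))\<^sup>2)) \<longlonglongrightarrow> ennreal ((norm (s n x - v x))\<^sup>2)"
        by (intro tendsto_intros elim tendsto_ennrealI)
      from lim_imp_Liminf[OF _ this] show ?case by simp
    qed
    also have "\<dots> \<le> liminf (\<lambda>i. \<integral>\<^sup>+x. ennreal ((norm (s n x - s (k i) x))\<^sup>2) \<partial>M)"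
      by (rule nn_integral_liminf) simp
    also have "\<dots> \<le> liminf (\<lambda>i. ennreal e)"
    proof (rule Liminf_mono)
      show "\<forall>\<^sub>F i in sequentially. (\<integral>\<^sup>+x. ennreal ((norm (s n x - s (k i) x))\<^sup>2) \<partial>M) \<le> ennreal e"
        using eventually_ge_at_top[of N]
      proof eventually_elim
        case (elim i)
        have "k i \<ge> N" using seq_suble[OF k, of i] elim by simp
        then have "(\<integral>x. (norm (s n x - s (k i) x))\<^sup>2 \<partial>M) \<le> e" using N[OF \<open>n \<ge> N\<close>] by (simp add: less_imp_le)
        then show ?case by (subst nn_integral_eq_integral) (use int in \<open>auto intro: ennreal_leI\<close>)
      qed
    qed
    also have "\<dots> = ennreal e" by (simp add: Liminf_const)
    finally show ?thesis .
  qed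
  have fatou': "integrable M (\<lambda>x. (norm (s n x - v x))\<^sup>2) \<and> (\<integral>x. (norm (s n x - v x))\<^sup>2 \<partial>M) \<le> e"
    if N: "\<And>m n. m \<ge> N \<Longrightarrow> n \<ge> N \<Longrightarrow> (\<integral>x. (norm (s m x - s n x))\<^sup>2 \<partial>M) < e" and "n \<ge> N" for e N n
  proof
    have "0 \<le> (\<integral>x. (norm (s n x - s n x))\<^sup>2 \<partial>M)" by simp
    then have e: "e \<ge> 0" using N[OF \<open>n \<ge> N\<close> \<open>n \<ge> N\<close>] by linarith
    have F: "(\<integral>\<^sup>+x. ennreal ((norm (s n x - v x))\<^sup>2) \<partial>M) \<le> ennreal e"
      by (rule fatou) (use that in auto)
    show i: "integrable M (\<lambda>x. (norm (s n x - v x))\<^sup>2)"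
      using F by (intro integrableI_bounded) (auto simp: le_less_trans)
    show "(\<integral>x. (norm (s n x - v x))\<^sup>2 \<partial>M) \<le> e"
      using F e i by (subst (asm) nn_integral_eq_integral) auto
  qed
  obtain N where N: "\<And>m n. m \<ge> N \<Longrightarrow> n \<ge> N \<Longrightarrow> (\<integral>x. (norm (s m x - s n x))\<^sup>2 \<partial>M) < 1"
    using cauchy[of 1] by auto
  have "square_integrable M (\<lambda>x. s N x - v x)"
    using fatou'[of N 1 N] N by (simp add: square_integrable_def)
  then have "square_integrable M v"
    using square_integrable_diff[OF s[of N], of "\<lambda>x. s N x - v x"] by simp
  moreover have "(\<lambda>n. \<integral>x. (norm (s n x - v x))\<^sup>2 \<partial>M) \<longlonglongrightarrow> 0"
  proof (rule LIMSEQ_I)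
    fix e :: real assume "e > 0"
    obtain N where N: "\<And>m n. m \<ge> N \<Longrightarrow> n \<ge> N \<Longrightarrow> (\<integral>x. (norm (s m x - s n x))\<^sup>2 \<partial>M) < e/2"
      using cauchy[of "e/2"] \<open>e > 0\<close> by auto
    have "norm ((\<integral>x. (norm (s n x - v x))\<^sup>2 \<partial>M) - 0) < e" if "n \<ge> N" for n
    proof -
      have "(\<integral>x. (norm (s n x - v x))\<^sup>2 \<partial>M) \<ge> 0" by simp
      then show ?thesis using fatou'[of N "e/2" n] N that \<open>e > 0\<close> by simp
    qed
    then show "\<exists>N. \<forall>n\<ge>N. norm ((\<integral>x. (norm (s n x - v x))\<^sup>2 \<partial>M) - 0) < e" by blast
  qed
  ultimately show ?thesis by blast
qed

section \<open>Test fields and integration by parts\<close>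

lemma partial_eq: "(f has_derivative D) (at x) \<Longrightarrow> partial i f x = D (axis i 1)"
  unfolding partial_def by (simp add: frechet_derivative_at[symmetric])

lemma differentiable_on_UNIV_D:
  assumes "f differentiable_on UNIV"
  shows "(f has_derivative frechet_derivative f (at x)) (at x)"
  using assms by (simp add: differentiable_on_def frechet_derivative_works)

lemma Ck_add_scaleR: "Ck k f \<Longrightarrow> Ck k g \<Longrightarrow> Ck k (\<lambda>x. f x + c *\<^sub>R g x)"
proof (induction k arbitrary: f g)
  case 0
  then show ?case by (auto intro!: continuous_intros)
next
  case (Suc k)
  have d: "((\<lambda>x. f x + c *\<^sub>R g x) has_derivative
      (\<lambda>h. frechet_derivative f (at x) h + c *\<^sub>R frechet_derivative g (at x) h)) (at x)" for x
    using Suc.prems by (auto intro!: derivative_intros differentiable_on_UNIV_D)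
  then have "(\<lambda>x. f x + c *\<^sub>R g x) differentiable_on UNIV"
    by (auto simp: differentiable_on_def differentiable_def)
  moreover have "partial i (\<lambda>x. f x + c *\<^sub>R g x) = (\<lambda>x. partial i f x + c *\<^sub>R partial i g x)" for i
    using partial_eq[OF d] by (auto simp: partial_def)
  ultimately show ?case using Suc by simp
qed

lemma test_fields_zero: "(\<lambda>_. 0) \<in> test_fields \<Omega>"
proof -
  have p: "partial i (\<lambda>_. 0) = (\<lambda>_. 0)" for i
    using partial_eq[OF has_derivative_const] by (auto simp: fun_eq_iff)
  have "Ck k (\<lambda>_. 0)" for k by (induction k) (auto simp: p)
  then show ?thesis by (simp add: test_fields_def)
qed

lemma test_fields_add_scaleR:
  assumes "\<phi> \<in> test_fields \<Omega>" "\<psi> \<in> test_fields \<Omega>"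
  shows "(\<lambda>x. \<phi> x + c *\<^sub>R \<psi> x) \<in> test_fields \<Omega>"
proof -
  have "{x. \<phi> x + c *\<^sub>R \<psi> x \<noteq> 0} \<subseteq> {x. \<phi> x \<noteq> 0} \<union> {x. \<psi> x \<noteq> 0}" by auto
  then have sub: "closure {x. \<phi> x + c *\<^sub>R \<psi> x \<noteq> 0} \<subseteq> closure {x. \<phi> x \<noteq> 0} \<union> closure {x. \<psi> x \<noteq> 0}"
    unfolding closure_Un[symmetric] by (rule closure_mono)
  have \<phi>: "\<forall>k. Ck k \<phi>" "compact (closure {x. \<phi> x \<noteq> 0})" "closure {x. \<phi> x \<noteq> 0} \<subseteq> \<Omega>"
    and \<psi>: "\<forall>k. Ck k \<psi>" "compact (closure {x. \<psi> x \<noteq> 0})" "closure {x. \<psi> x \<noteq> 0} \<subseteq> \<Omega>"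
    using assms by (simp_all add: test_fields_def)
  have "compact ((closure {x. \<phi> x \<noteq> 0} \<union> closure {x. \<psi> x \<noteq> 0}) \<inter> closure {x. \<phi> x + c *\<^sub>R \<psi> x \<noteq> 0})"
    by (intro compact_Int_closed compact_Un \<phi> \<psi> closed_closure)
  then have "compact (closure {x. \<phi> x + c *\<^sub>R \<psi> x \<noteq> 0})"
    by (simp only: inf.absorb2[OF sub])
  moreover have "closure {x. \<phi> x + c *\<^sub>R \<psi> x \<noteq> 0} \<subseteq> \<Omega>"
    by (rule order_trans[OF sub Un_least[OF \<phi>(3) \<psi>(3)]])
  moreover have "\<forall>k. Ck k (\<lambda>x. \<phi> x + c *\<^sub>R \<psi> x)"
    using Ck_add_scaleR[OF \<phi>(1)[rule_format] \<psi>(1)[rule_format]] by simp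
  ultimately show ?thesis by (simp add: test_fields_def)
qed

lemma test_fieldsE:
  assumes "\<phi> \<in> test_fields \<Omega>"
  obtains K where "compact K" "K \<subseteq> \<Omega>" "\<And>x. x \<notin> K \<Longrightarrow> \<phi> x = 0" "\<And>x i. x \<notin> K \<Longrightarrow> partial i \<phi> x = 0"
    "continuous_on UNIV \<phi>" "\<And>i. continuous_on UNIV (partial i \<phi>)"
    "\<And>x. (\<phi> has_derivative frechet_derivative \<phi> (at x)) (at x)"
proof -
  let ?K = "closure {x. \<phi> x \<noteq> 0}"
  have Ck: "\<forall>k. Ck k \<phi>" and K: "compact ?K" "?K \<subseteq> \<Omega>" using assms by (simp_all add: test_fields_def)
  have "Ck 0 \<phi>" "Ck (Suc 0) \<phi>" using Ck by blast+
  then have *: "continuous_on UNIV \<phi>" "\<And>i. continuous_on UNIV (partial i \<phi>)" "\<phi> differentiable_on UNIV" by auto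
  have 0: "\<phi> x = 0" if "x \<notin> ?K" for x using that closure_subset[of "{x. \<phi> x \<noteq> 0}"] by blast
  have p: "partial i \<phi> x = 0" if x: "x \<notin> ?K" for x i
  proof -
    have "(\<phi> has_derivative (\<lambda>_. 0)) (at x)"
    proof (rule has_derivative_transform_within_open[OF has_derivative_const])
      show "open (- ?K)" by (rule open_Compl[OF closed_closure])
      show "x \<in> - ?K" using x by (simp only: Compl_iff not_False_eq_True)
      show "0 = \<phi> y" if "y \<in> - ?K" for y using 0[OF ComplD[OF that]] by (rule sym)
    qed
    from partial_eq[OF this] show ?thesis .
  qed
  show ?thesis by (rule that[of ?K]) (fact K 0 p *(1,2) differentiable_on_UNIV_D[OF *(3)])+
qed

section \<open>Integrals of compactly supported fields\<close>

lemma integrable_lborel_compact_support: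
  fixes f :: "'a::euclidean_space \<Rightarrow> 'b::{banach, second_countable_topology}"
  assumes "continuous_on UNIV f" "compact K" "\<And>x. x \<notin> K \<Longrightarrow> f x = 0"
  shows "integrable lborel f"
proof -
  have "integrable lborel (\<lambda>x. indicator K x *\<^sub>R f x)"
    using assms continuous_on_subset by (intro borel_integrable_compact) blast+
  also have "(\<lambda>x. indicator K x *\<^sub>R f x) = f" using assms(3) by (auto simp: fun_eq_iff indicator_def)
  finally show ?thesis .
qed

text \<open>Transfers integrals between the domain and the whole space. Integration by parts takes
  place on the whole space, where Lebesgue measure is translation invariant and no boundary
  appears.\<close>

lemma lebesgue_on_compact_support:
  fixes f :: "'a::euclidean_space \<Rightarrow> 'b::{banach, second_countable_topology}"
  assumes "continuous_on UNIV f" "compact K" "\<And>x. x \<notin> K \<Longrightarrow> f x = 0" "\<Omega> \<in> sets lebesgue" "K \<subseteq> \<Omega>"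
  shows "integrable (lebesgue_on \<Omega>) f" "(\<integral>x. f x \<partial>lebesgue_on \<Omega>) = (\<integral>x. f x \<partial>lborel)"
proof -
  have eq: "(\<lambda>x. indicator \<Omega> x *\<^sub>R f x) = f" using assms(3,5) by (auto simp: fun_eq_iff indicator_def)
  have m: "f \<in> borel_measurable lborel" using assms(1) by (simp add: borel_measurable_continuous_onI)
  have "integrable lborel f" by (rule integrable_lborel_compact_support[OF assms(1-3)])
  then show "integrable (lebesgue_on \<Omega>) f"
    using assms(4) m by (simp add: integrable_restrict_space eq integrable_completion)
  show "(\<integral>x. f x \<partial>lebesgue_on \<Omega>) = (\<integral>x. f x \<partial>lborel)"
    using assms(4) m by (simp add: integral_restrict_space eq integral_completion)
qed

text \<open>By translation invariance of Lebesgue measure all difference quotients of \<open>h\<close> have integral zero.\<close>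

lemma integral_directional_derivative_eq_0:
  fixes h :: "'a::euclidean_space \<Rightarrow> real"
  assumes D: "\<And>x. (h has_derivative D x) (at x)" and cont: "continuous_on UNIV (\<lambda>x. D x e)"
    and K: "compact K" and h0: "\<And>x. x \<notin> K \<Longrightarrow> h x = 0"
  shows "(\<integral>x. D x e \<partial>lborel) = 0"
proof -
  have conth: "continuous_on UNIV h"
    using has_derivative_continuous[OF D] by (simp add: continuous_on_eq_continuous_within)
  have meas [measurable]: "h \<in> borel_measurable borel"
    using conth by (rule borel_measurable_continuous_onI)
  have inth: "integrable lborel h" by (rule integrable_lborel_compact_support[OF conth K h0])
  have D0: "D x e = 0" if "x \<notin> K" for x
  proof -
    have "(h has_derivative (\<lambda>_. 0)) (at x)"
    proof (rule has_derivative_transform_within_open[OF has_derivative_const])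
      show "open (- K)" "x \<in> - K" "\<And>y. y \<in> - K \<Longrightarrow> 0 = h y"
        using that h0 K by (auto simp: compact_imp_closed open_Compl)
    qed
    from has_derivative_unique[OF D this] show ?thesis by simp
  qed
  have "compact ((\<lambda>x. D x e) ` K)" by (rule compact_continuous_image[OF continuous_on_subset[OF cont] K]) simp
  then have "bounded ((\<lambda>x. D x e) ` K)" by (rule compact_imp_bounded)
  then obtain M where M: "\<And>x. x \<in> K \<Longrightarrow> \<bar>D x e\<bar> \<le> M" by (auto simp: bounded_iff)
  obtain R where R: "K \<subseteq> cball 0 R"
    using compact_imp_bounded[OF K] by (auto simp: bounded_iff subset_iff)
  \<comment> \<open>The maximum with 0 covers an empty \<open>K\<close>, where \<open>M\<close> may
    be negative, and the points off \<open>K\<close>, where the derivative vanishes.\<close>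
  define C where "C = max 0 M"
  have C: "\<bar>D x e\<bar> \<le> C" for x using M[of x] D0[of x] by (cases "x \<in> K") (auto simp: C_def)
  define q where "q n x = (h (x + (1 / real (Suc n)) *\<^sub>R e) - h x) * real (Suc n)" for n x
  \<comment> \<open>By the mean value theorem the quotients are values of the directional
    derivative, so \<open>C\<close> bounds them uniformly in \<open>n\<close>.\<close>
  have q_bound: "\<bar>q n x\<bar> \<le> C" for n x
  proof -
    let ?t = "1 / real (Suc n)"
    have "\<exists>s. 0 < s \<and> s < ?t \<and> h (x + ?t *\<^sub>R e) - h (x + 0 *\<^sub>R e) = (?t - 0) * D (x + s *\<^sub>R e) e"
    proof (rule MVT2[of 0 ?t "\<lambda>s. h (x + s *\<^sub>R e)" "\<lambda>s. D (x + s *\<^sub>R e) e"])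
      fix s :: real
      have "((\<lambda>s. h (x + s *\<^sub>R e)) has_derivative (\<lambda>r. D (x + s *\<^sub>R e) (r *\<^sub>R e))) (at s)"
        by (rule has_derivative_compose[OF _ D]) (auto intro!: derivative_eq_intros)
      moreover have "linear (D (x + s *\<^sub>R e))" by (rule has_derivative_linear[OF D])
      ultimately show "DERIV (\<lambda>s. h (x + s *\<^sub>R e)) s :> D (x + s *\<^sub>R e) e"
        by (simp add: has_field_derivative_def linear_scale mult_commute_abs)
    qed simp
    then obtain s where "h (x + ?t *\<^sub>R e) - h x = ?t * D (x + s *\<^sub>R e) e" by auto
    then have "q n x = D (x + s *\<^sub>R e) e" by (simp add: q_def)
    then show ?thesis using C by simp
  qed
  \<comment> \<open>Translations by at most \<open>norm e\<close> keep all quotients supported in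
    one ball; \<open>C\<close> times its indicator is the dominating function.\<close>
  have q_supp: "q n x = 0" if "x \<notin> cball (0::'a) (R + norm e)" for n x
  proof -
    have "norm x > R + norm e" using that by simp
    moreover have "norm ((1 / real (Suc n)) *\<^sub>R e) \<le> norm e" by (simp add: divide_le_eq mult_le_cancel_left1)
    moreover have "norm (x + (1 / real (Suc n)) *\<^sub>R e) \<ge> norm x - norm ((1 / real (Suc n)) *\<^sub>R e)"
      using norm_diff_ineq by blast
    ultimately have "norm (x + (1 / real (Suc n)) *\<^sub>R e) > R" "norm x > R" using norm_ge_zero[of e] by linarith+
    then have "x \<notin> cball 0 R" "x + (1 / real (Suc n)) *\<^sub>R e \<notin> cball 0 R" by (simp_all del: of_nat_Suc)
    then have "x \<notin> K" "x + (1 / real (Suc n)) *\<^sub>R e \<notin> K" using R by blast+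
    then show ?thesis using h0 by (simp add: q_def)
  qed
  have q_lim: "(\<lambda>n. q n x) \<longlonglongrightarrow> D x e" for x
  proof -
    have "((\<lambda>s. h (x + s *\<^sub>R e)) has_derivative (\<lambda>r. D (x + 0 *\<^sub>R e) (r *\<^sub>R e))) (at 0)"
      by (rule has_derivative_compose[OF _ D]) (auto intro!: derivative_eq_intros)
    moreover have "linear (D x)" by (rule has_derivative_linear[OF D])
    ultimately have "DERIV (\<lambda>s. h (x + s *\<^sub>R e)) 0 :> D x e"
      by (simp add: has_field_derivative_def linear_scale mult_commute_abs)
    then have "((\<lambda>s. (h (x + s *\<^sub>R e) - h x) / s) \<longlongrightarrow> D x e) (at 0)"
      by (simp add: DERIV_def)
    moreover have "filterlim (\<lambda>n. 1 / real (Suc n)) (at 0) sequentially"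
      using LIMSEQ_inverse_real_of_nat by (simp add: filterlim_at inverse_eq_divide del: of_nat_Suc)
    ultimately have "(\<lambda>n. (h (x + (1 / real (Suc n)) *\<^sub>R e) - h x) / (1 / real (Suc n))) \<longlonglongrightarrow> D x e"
      by (rule filterlim_compose)
    then show ?thesis by (simp add: q_def)
  qed
  have "(\<lambda>n. \<integral>x. q n x \<partial>lborel) \<longlonglongrightarrow> (\<integral>x. D x e \<partial>lborel)"
  proof (rule integral_dominated_convergence[where w="\<lambda>x. C * indicator (cball (0::'a) (R + norm e)) x"])
    show "(\<lambda>x. D x e) \<in> borel_measurable lborel" using cont by (simp add: borel_measurable_continuous_onI)
    show "q n \<in> borel_measurable lborel" for n unfolding q_def by measurable
    have "emeasure lborel (cball (0::'a) (R + norm e)) < \<infinity>" by (rule emeasure_bounded_finite) simp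
    then show "integrable lborel (\<lambda>x. C * indicator (cball (0::'a) (R + norm e)) x)"
      by (intro integrable_mult_right integrable_real_indicator) auto
    show "AE x in lborel. norm (q n x) \<le> C * indicator (cball (0::'a) (R + norm e)) x" for n
      using q_bound q_supp by (auto intro!: AE_I2 simp: indicator_def)
  qed (use q_lim in auto)
  moreover have "(\<integral>x. q n x \<partial>lborel) = 0" for n
  proof -
    let ?c = "(1 / real (Suc n)) *\<^sub>R e"
    have shift: "integrable lborel (\<lambda>x. h (x + ?c))" "(\<integral>x. h (x + ?c) \<partial>lborel) = (\<integral>x. h x \<partial>lborel)"
    proof -
      have "integrable (distr lborel borel ((+) ?c)) h" using inth by (simp add: lborel_distr_plus)
      then show "integrable lborel (\<lambda>x. h (x + ?c))"
        by (subst (asm) integrable_distr_eq) (auto simp: add.commute)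
      have "(\<integral>x. h x \<partial>lborel) = (\<integral>x. h x \<partial>distr lborel borel ((+) ?c))" by (simp add: lborel_distr_plus)
      also have "\<dots> = (\<integral>x. h (?c + x) \<partial>lborel)" by (rule integral_distr) auto
      finally show "(\<integral>x. h (x + ?c) \<partial>lborel) = (\<integral>x. h x \<partial>lborel)" by (simp add: add.commute)
    qed
    have "(\<integral>x. q n x \<partial>lborel) = (\<integral>x. h (x + ?c) - h x \<partial>lborel) * real (Suc n)"
      unfolding q_def by (rule integral_mult_left_zero)
    then show ?thesis using shift inth by simp
  qed
  ultimately show ?thesis by (simp add: LIMSEQ_const_iff)
qed

lemma continuous_on_classical_curl:
  assumes "\<And>i. continuous_on UNIV (partial i \<phi>)"
  shows "continuous_on UNIV (classical_curl \<phi>)"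
proof -
  have "classical_curl \<phi> = (\<lambda>x. (partial 2 \<phi> x $ 3 - partial 3 \<phi> x $ 2) *\<^sub>R axis 1 1 +
      (partial 3 \<phi> x $ 1 - partial 1 \<phi> x $ 3) *\<^sub>R axis 2 1 +
      (partial 1 \<phi> x $ 2 - partial 2 \<phi> x $ 1) *\<^sub>R axis 3 1)"
    by (auto simp: fun_eq_iff classical_curl_def vec_eq_iff forall_3 axis_def)
  then show ?thesis using assms by (auto intro!: continuous_intros)
qed

lemma test_field_square_integrable:
  assumes "\<phi> \<in> test_fields \<Omega>" "\<Omega> \<in> sets lebesgue"
  shows "square_integrable (lebesgue_on \<Omega>) \<phi>" "square_integrable (lebesgue_on \<Omega>) (classical_curl \<phi>)"
proof -
  obtain K where K: "compact K" "K \<subseteq> \<Omega>" "\<And>x. x \<notin> K \<Longrightarrow> \<phi> x = 0" "\<And>x i. x \<notin> K \<Longrightarrow> partial i \<phi> x = 0"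
    and c: "continuous_on UNIV \<phi>" "\<And>i. continuous_on UNIV (partial i \<phi>)"
    using test_fieldsE[OF assms(1)] by metis
  have *: "square_integrable (lebesgue_on \<Omega>) v"
    if "continuous_on UNIV v" "\<And>x. x \<notin> K \<Longrightarrow> v x = 0" for v :: "real^3 \<Rightarrow> real^3"
    unfolding square_integrable_def
  proof
    show "v \<in> borel_measurable (lebesgue_on \<Omega>)"
      using lebesgue_on_compact_support(1)[OF that(1) K(1) that(2) assms(2) K(2)] by auto
    show "integrable (lebesgue_on \<Omega>) (\<lambda>x. (norm (v x))\<^sup>2)"
      by (rule lebesgue_on_compact_support(1)[OF _ K(1) _ assms(2) K(2)])
         (use that in \<open>auto intro!: continuous_intros\<close>)
  qed
  show "square_integrable (lebesgue_on \<Omega>) \<phi>" using * c K by blast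
  show "square_integrable (lebesgue_on \<Omega>) (classical_curl \<phi>)"
  proof (rule *)
    show "continuous_on UNIV (classical_curl \<phi>)" by (rule continuous_on_classical_curl[OF c(2)])
    show "classical_curl \<phi> x = 0" if "x \<notin> K" for x
      using K(4)[OF that] by (simp add: classical_curl_def vec_eq_iff forall_3)
  qed
qed

text \<open>The partial derivative of a product of two components has integral zero; the product
  rule splits it into the two sides.\<close>

lemma integral_partial_product:
  assumes \<phi>: "\<phi> \<in> test_fields \<Omega>" and \<psi>: "\<psi> \<in> test_fields \<Omega>"
  shows "integrable lborel (\<lambda>x. partial i \<phi> x $ k * \<psi> x $ l)"
    "(\<integral>x. partial i \<phi> x $ k * \<psi> x $ l \<partial>lborel) = - (\<integral>x. \<phi> x $ k * partial i \<psi> x $ l \<partial>lborel)"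
proof -
  obtain K where K: "compact K" "\<And>x. x \<notin> K \<Longrightarrow> \<phi> x = 0" "\<And>x i. x \<notin> K \<Longrightarrow> partial i \<phi> x = 0"
    and c: "continuous_on UNIV \<phi>" "\<And>i. continuous_on UNIV (partial i \<phi>)"
    and d: "\<And>x. (\<phi> has_derivative frechet_derivative \<phi> (at x)) (at x)"
    using test_fieldsE[OF \<phi>] by metis
  have c': "continuous_on UNIV \<psi>" "\<And>i. continuous_on UNIV (partial i \<psi>)"
    and d': "\<And>x. (\<psi> has_derivative frechet_derivative \<psi> (at x)) (at x)"
    using test_fieldsE[OF \<psi>] by metis+
  show 1: "integrable lborel (\<lambda>x. partial i \<phi> x $ k * \<psi> x $ l)"
    by (rule integrable_lborel_compact_support[OF _ K(1)]) (use K c c' in \<open>auto intro!: continuous_intros\<close>)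
  have 2: "integrable lborel (\<lambda>x. \<phi> x $ k * partial i \<psi> x $ l)"
    by (rule integrable_lborel_compact_support[OF _ K(1)]) (use K c c' in \<open>auto intro!: continuous_intros\<close>)
  have "(\<integral>x. \<phi> x $ k * frechet_derivative \<psi> (at x) (axis i 1) $ l + frechet_derivative \<phi> (at x) (axis i 1) $ k * \<psi> x $ l \<partial>lborel) = 0"
  proof (rule integral_directional_derivative_eq_0[where h="\<lambda>x. \<phi> x $ k * \<psi> x $ l" and K=K and e="axis i 1" and
       D="\<lambda>x y. \<phi> x $ k * frechet_derivative \<psi> (at x) y $ l + frechet_derivative \<phi> (at x) y $ k * \<psi> x $ l"])
    show "((\<lambda>x. \<phi> x $ k * \<psi> x $ l) has_derivative (\<lambda>y. \<phi> x $ k * frechet_derivative \<psi> (at x) y $ l + frechet_derivative \<phi> (at x) y $ k * \<psi> x $ l)) (at x)" for x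
      by (intro has_derivative_mult bounded_linear.has_derivative[OF bounded_linear_vec_nth] d d')
    show "continuous_on UNIV (\<lambda>x. \<phi> x $ k * frechet_derivative \<psi> (at x) (axis i 1) $ l + frechet_derivative \<phi> (at x) (axis i 1) $ k * \<psi> x $ l)"
      unfolding partial_def[symmetric] using c c' by (auto intro!: continuous_intros)
  qed (use K in auto)
  then have "(\<integral>x. \<phi> x $ k * partial i \<psi> x $ l + partial i \<phi> x $ k * \<psi> x $ l \<partial>lborel) = 0"
    unfolding partial_def .
  then show "(\<integral>x. partial i \<phi> x $ k * \<psi> x $ l \<partial>lborel) = - (\<integral>x. \<phi> x $ k * partial i \<psi> x $ l \<partial>lborel)"
    using 1 2 by simp
qed

text \<open>The curl is formally self-adjoint: each of the six products changes sign under
  integration by parts, and the antisymmetric pattern changes sign once more when the two fields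
  exchange roles. Together with square integrability this places test fields in
  \<open>Hcurl\<close>.\<close>

lemma test_field_has_weak_curl:
  assumes \<phi>: "\<phi> \<in> test_fields \<Omega>" and \<Omega>: "\<Omega> \<in> sets lebesgue"
  shows "has_weak_curl \<Omega> \<phi> (classical_curl \<phi>)"
  unfolding has_weak_curl_def
proof
  fix \<psi> assume \<psi>: "\<psi> \<in> test_fields \<Omega>"
  obtain K where K: "compact K" "K \<subseteq> \<Omega>" "\<And>x. x \<notin> K \<Longrightarrow> \<phi> x = 0" "\<And>x i. x \<notin> K \<Longrightarrow> partial i \<phi> x = 0"
    and c: "continuous_on UNIV \<phi>" "\<And>i. continuous_on UNIV (partial i \<phi>)"
    using test_fieldsE[OF \<phi>] by metis
  have c': "continuous_on UNIV \<psi>" "\<And>i. continuous_on UNIV (partial i \<psi>)"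
    using test_fieldsE[OF \<psi>] by metis+
  have curl0: "classical_curl \<phi> x = 0" if "x \<notin> K" for x
    using K(4)[OF that] by (simp add: classical_curl_def vec_eq_iff forall_3)
  define P where "P i k l = (\<integral>x. partial i \<phi> x $ k * \<psi> x $ l \<partial>lborel)" for i k l :: 3
  \<comment> \<open>\<open>Q\<close> takes the two component indices in exchanged order, so that
    integration by parts reads \<open>P i k l = - Q i l k\<close>.\<close>
  define Q where "Q i l k = (\<integral>x. partial i \<psi> x $ l * \<phi> x $ k \<partial>lborel)" for i k l :: 3
  note intP = integral_partial_product(1)[OF \<phi> \<psi>] and intQ = integral_partial_product(1)[OF \<psi> \<phi>]
  have PQ: "P i k l = - Q i l k" for i k l
    unfolding P_def Q_def using integral_partial_product(2)[OF \<phi> \<psi>, of i k l] by (simp add: mult.commute)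
  have "(\<integral>x. classical_curl \<phi> x \<bullet> \<psi> x \<partial>lebesgue_on \<Omega>) = (\<integral>x. classical_curl \<phi> x \<bullet> \<psi> x \<partial>lborel)"
    by (rule lebesgue_on_compact_support(2)[OF _ K(1) _ \<Omega> K(2)])
       (use c c' curl0 in \<open>auto intro!: continuous_intros continuous_on_classical_curl\<close>)
  also have "\<dots> = P 2 3 1 - P 3 2 1 + (P 3 1 2 - P 1 3 2) + (P 1 2 3 - P 2 1 3)"
    unfolding P_def using intP
    by (simp add: classical_curl_def inner_vec_def sum_3 left_diff_distrib)
  also have "\<dots> = Q 2 3 1 - Q 3 2 1 + (Q 3 1 2 - Q 1 3 2) + (Q 1 2 3 - Q 2 1 3)"
    unfolding PQ by simp
  also have "\<dots> = (\<integral>x. \<phi> x \<bullet> classical_curl \<psi> x \<partial>lborel)"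
    unfolding Q_def using intQ
    by (simp add: classical_curl_def inner_vec_def sum_3 right_diff_distrib mult.commute)
  also have "\<dots> = (\<integral>x. \<phi> x \<bullet> classical_curl \<psi> x \<partial>lebesgue_on \<Omega>)"
    by (rule lebesgue_on_compact_support(2)[OF _ K(1) _ \<Omega> K(2), symmetric])
       (use c c' K in \<open>auto intro!: continuous_intros continuous_on_classical_curl\<close>)
  finally show "(\<integral>x. classical_curl \<phi> x \<bullet> \<psi> x \<partial>lebesgue_on \<Omega>) = (\<integral>x. \<phi> x \<bullet> classical_curl \<psi> x \<partial>lebesgue_on \<Omega>)" .
qed

section \<open>Bump functions and the fundamental lemma\<close>

text \<open>\<open>flat 0\<close> is the standard smooth function that vanishes to infinite order at
  0. The powers of \<open>1 / t\<close> are those that differentiation produces, so the linear span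
  of the family is closed under derivatives.\<close>

definition flat :: "nat \<Rightarrow> real \<Rightarrow> real" where
  "flat m t = (if t > 0 then (1 / t) ^ m * exp (- (1 / t)) else 0)"

text \<open>From the right, substituting \<open>1 / t\<close> leaves a power divided by an
  exponential at infinity.\<close>

lemma flat_tendsto_0: "(flat m \<longlongrightarrow> 0) (at 0)"
proof -
  have "((\<lambda>x::real. x ^ m / exp x) \<longlongrightarrow> 0) at_top" by (rule tendsto_power_div_exp_0)
  moreover have "filterlim (\<lambda>t::real. inverse t) at_top (at_right 0)" by (rule filterlim_inverse_at_top_right)
  ultimately have "((\<lambda>t::real. (inverse t) ^ m / exp (inverse t)) \<longlongrightarrow> 0) (at_right 0)"
    by (rule filterlim_compose)
  moreover have "\<forall>\<^sub>F t in at_right 0. (inverse t) ^ m / exp (inverse t) = flat m t"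
    by (auto simp: eventually_at_right_less flat_def exp_minus divide_inverse
        intro: eventually_mono[OF eventually_at_right_less[of "0::real"]])
  ultimately have "(flat m \<longlongrightarrow> 0) (at_right 0)" by (rule Lim_transform_eventually)
  moreover have "(flat m \<longlongrightarrow> 0) (at_left 0)"
  proof (rule Lim_transform_eventually[OF tendsto_const])
    show "\<forall>\<^sub>F t in at_left (0::real). 0 = flat m t"
      unfolding eventually_at_left_field by (intro exI[of _ "-1"]) (auto simp: flat_def)
  qed
  ultimately show ?thesis by (simp add: filterlim_split_at)
qed

text \<open>At 0 the difference quotient of \<open>flat m\<close> is \<open>flat (m + 1)\<close>, so
  the limit at 0 one order higher gives the derivative. Away from 0 it is the product rule on either
  branch.\<close>

lemma flat_has_derivative: "DERIV (flat m) t :> flat (m + 2) t - real m * flat (m + 1) t"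
proof -
  consider "t > 0" | "t < 0" | "t = 0" by linarith
  then show ?thesis
  proof cases
    case 1
    have "DERIV (\<lambda>t. (1 / t) ^ m * exp (- (1 / t))) t :> flat (m + 2) t - real m * flat (m + 1) t"
      using 1 by (auto intro!: derivative_eq_intros simp: flat_def power2_eq_square divide_inverse algebra_simps)
         (cases m; simp add: field_simps)
    then show ?thesis
      by (rule has_field_derivative_transform_within_open[of _ _ _ "{0<..}"]) (use 1 in \<open>auto simp: flat_def\<close>)
  next
    case 2
    have "DERIV (\<lambda>t. 0) t :> flat (m + 2) t - real m * flat (m + 1) t" using 2 by (simp add: flat_def)
    then show ?thesis
      by (rule has_field_derivative_transform_within_open[of _ _ _ "{..<0}"]) (use 2 in \<open>auto simp: flat_def\<close>)
  next
    case 3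
    have "((\<lambda>h. (flat m (0 + h) - flat m 0) / h) \<longlongrightarrow> 0) (at 0)"
    proof (rule Lim_transform_eventually[OF flat_tendsto_0[of "m + 1"]])
      show "\<forall>\<^sub>F h in at 0. flat (m + 1) h = (flat m (0 + h) - flat m 0) / h"
        by (rule always_eventually) (auto simp: flat_def divide_inverse)
    qed
    then have "DERIV (flat m) 0 :> 0" by (simp add: DERIV_def)
    then show ?thesis using 3 by (simp add: flat_def)
  qed
qed

lemma flat_0_bounds: "0 \<le> flat 0 t" "flat 0 t \<le> 1"
  by (auto simp: flat_def)

lemma flat_pos_iff: "flat 0 t \<noteq> 0 \<longleftrightarrow> t > 0"
  by (auto simp: flat_def)

lemma flat_scaled_tendsto: "(\<lambda>n. flat 0 (real (Suc n) * t)) \<longlonglongrightarrow> (if t > 0 then 1 else 0)"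
proof (cases "t > 0")
  case True
  have "(\<lambda>n. exp (- (inverse (real (Suc n)) * (1 / t)))) \<longlonglongrightarrow> exp (- (0 * (1 / t)))"
    by (intro tendsto_intros LIMSEQ_inverse_real_of_nat)
  then show ?thesis using True by (simp add: flat_def divide_inverse zero_less_mult_iff)
next
  case False
  then have "real (Suc n) * t \<le> 0" for n by (simp add: mult_le_0_iff)
  then show ?thesis using False by (simp add: flat_def not_less[symmetric])
qed

text \<open>Closed under partial derivatives, so that membership implies \<^term>\<open>Ck k\<close> for every \<open>k\<close>.\<close>

inductive_set flat_algebra :: "(real^3 \<Rightarrow> real) set" where
  base: "(\<lambda>x. flat m (c * x $ i + d)) \<in> flat_algebra"
| scale: "f \<in> flat_algebra \<Longrightarrow> (\<lambda>x. c * f x) \<in> flat_algebra"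
| add: "f \<in> flat_algebra \<Longrightarrow> g \<in> flat_algebra \<Longrightarrow> (\<lambda>x. f x + g x) \<in> flat_algebra"
| mult: "f \<in> flat_algebra \<Longrightarrow> g \<in> flat_algebra \<Longrightarrow> (\<lambda>x. f x * g x) \<in> flat_algebra"

lemma flat_algebra_derivative:
  assumes "f \<in> flat_algebra"
  shows "\<exists>D. (\<forall>x. (f has_derivative D x) (at x)) \<and> (\<forall>i. (\<lambda>x. D x (axis i 1)) \<in> flat_algebra)"
  using assms
proof induction
  case (base m c j d)
  let ?F = "\<lambda>x::real^3. flat (m + 2) (c * x $ j + d) + (- real m) * flat (m + 1) (c * x $ j + d)"
  have "((\<lambda>x::real^3. flat m (c * x $ j + d)) has_derivative (\<lambda>h. (c * h $ j) * ?F x)) (at x)" for x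
  proof -
    have "((\<lambda>x::real^3. c * x $ j + d) has_derivative (\<lambda>h. c * h $ j)) (at x)"
      by (auto intro!: derivative_eq_intros bounded_linear.has_derivative[OF bounded_linear_vec_nth])
    from has_derivative_compose[OF this flat_has_derivative[unfolded has_field_derivative_def]]
    show ?thesis by (simp add: mult.commute)
  qed
  moreover have "(\<lambda>x. (c * axis i 1 $ j) * ?F x) \<in> flat_algebra" for i
    by (intro flat_algebra.intros)
  ultimately show ?case by (intro exI[of _ "\<lambda>x h. (c * h $ j) * ?F x"]) blast
next
  case (scale f c)
  then obtain D where "\<forall>x. (f has_derivative D x) (at x)" "\<forall>i. (\<lambda>x. D x (axis i 1)) \<in> flat_algebra" by blast
  then show ?case
    by (intro exI[of _ "\<lambda>x h. c * D x h"]) (auto intro: flat_algebra.intros has_derivative_mult_right)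
next
  case (add f g)
  then obtain D E where "\<forall>x. (f has_derivative D x) (at x)" "\<forall>i. (\<lambda>x. D x (axis i 1)) \<in> flat_algebra"
    "\<forall>x. (g has_derivative E x) (at x)" "\<forall>i. (\<lambda>x. E x (axis i 1)) \<in> flat_algebra" by blast
  then show ?case
    by (intro exI[of _ "\<lambda>x h. D x h + E x h"]) (auto intro: flat_algebra.intros has_derivative_add)
next
  case (mult f g)
  then obtain D E where "\<forall>x. (f has_derivative D x) (at x)" "\<forall>i. (\<lambda>x. D x (axis i 1)) \<in> flat_algebra"
    "\<forall>x. (g has_derivative E x) (at x)" "\<forall>i. (\<lambda>x. E x (axis i 1)) \<in> flat_algebra" by blast
  then show ?case
    by (intro exI[of _ "\<lambda>x h. f x * E x h + D x h * g x"])
       (auto intro!: flat_algebra.add flat_algebra.mult mult(1,2) has_derivative_mult)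
qed

lemma flat_algebra_Ck: "f \<in> flat_algebra \<Longrightarrow> Ck k (\<lambda>x. f x *\<^sub>R e)"
proof (induction k arbitrary: f)
  case 0
  then obtain D where "\<forall>x. (f has_derivative D x) (at x)" using flat_algebra_derivative by blast
  then have "continuous_on UNIV f"
    by (intro continuous_at_imp_continuous_on ballI) (blast intro: has_derivative_continuous)
  then show ?case by (auto intro!: continuous_intros)
next
  case (Suc k)
  then obtain D where D: "\<And>x. (f has_derivative D x) (at x)" "\<And>i. (\<lambda>x. D x (axis i 1)) \<in> flat_algebra"
    using flat_algebra_derivative by blast
  have d: "((\<lambda>x. f x *\<^sub>R e) has_derivative (\<lambda>h. D x h *\<^sub>R e)) (at x)" for x
    by (intro has_derivative_scaleR_left D)
  then have "(\<lambda>x. f x *\<^sub>R e) differentiable_on UNIV"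
    by (auto simp: differentiable_on_def differentiable_def)
  moreover have "partial i (\<lambda>x. f x *\<^sub>R e) = (\<lambda>x. D x (axis i 1) *\<^sub>R e)" for i
    using partial_eq[OF d] by (auto simp: fun_eq_iff)
  ultimately show ?case using Suc.IH D(2) by simp
qed

text \<open>Two one-sided profiles per coordinate, one for each face: the set of nonzero values is
  the same open box for every \<open>n\<close>, while the dilation by \<open>Suc n\<close> drives
  the values inside to 1. A product of such profiles stays in \<open>flat_algebra\<close>, which
  gives smoothness.\<close>

definition box_bump :: "nat \<Rightarrow> real^3 \<Rightarrow> real^3 \<Rightarrow> real^3 \<Rightarrow> real" where
  "box_bump n a b x = (\<Prod>i\<in>UNIV. flat 0 (real (Suc n) * (x $ i - a $ i)) * flat 0 (real (Suc n) * (b $ i - x $ i)))"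

lemma prod_UNIV_3: "(\<Prod>i\<in>UNIV. f i) = f 1 * f 2 * f (3::3)" for f :: "3 \<Rightarrow> real"
  unfolding UNIV_3 by (simp add: ac_simps)

lemma box_bump_in_flat_algebra: "box_bump n a b \<in> flat_algebra"
proof -
  have 1: "(\<lambda>x. flat 0 (real (Suc n) * (x $ i - a $ i))) \<in> flat_algebra" for i
    using flat_algebra.base[of 0 "real (Suc n)" i "- real (Suc n) * a $ i"] by (simp add: algebra_simps)
  have 2: "(\<lambda>x. flat 0 (real (Suc n) * (b $ i - x $ i))) \<in> flat_algebra" for i
    using flat_algebra.base[of 0 "- real (Suc n)" i "real (Suc n) * b $ i"] by (simp add: algebra_simps)
  have "(\<lambda>x. (flat 0 (real (Suc n) * (x $ 1 - a $ 1)) * flat 0 (real (Suc n) * (b $ 1 - x $ 1))) *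
      (flat 0 (real (Suc n) * (x $ 2 - a $ 2)) * flat 0 (real (Suc n) * (b $ 2 - x $ 2))) *
      (flat 0 (real (Suc n) * (x $ 3 - a $ 3)) * flat 0 (real (Suc n) * (b $ 3 - x $ 3)))) \<in> flat_algebra"
    by (intro flat_algebra.mult 1 2)
  moreover have "box_bump n a b = (\<lambda>x. (flat 0 (real (Suc n) * (x $ 1 - a $ 1)) * flat 0 (real (Suc n) * (b $ 1 - x $ 1))) *
      (flat 0 (real (Suc n) * (x $ 2 - a $ 2)) * flat 0 (real (Suc n) * (b $ 2 - x $ 2))) *
      (flat 0 (real (Suc n) * (x $ 3 - a $ 3)) * flat 0 (real (Suc n) * (b $ 3 - x $ 3))))"
    unfolding box_bump_def prod_UNIV_3 ..
  ultimately show ?thesis by (simp only:)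
qed

lemma box_bump_bounds: "0 \<le> box_bump n a b x" "box_bump n a b x \<le> 1"
  unfolding box_bump_def by (auto intro!: prod_nonneg prod_le_1 mult_le_one simp: flat_0_bounds)

lemma box_bump_support: "{x. box_bump n a b x \<noteq> 0} = box a b"
  by (auto simp: box_bump_def flat_pos_iff mem_box_cart zero_less_mult_iff)

lemma box_bump_tendsto: "(\<lambda>n. box_bump n a b x) \<longlonglongrightarrow> indicator (box a b) x"
proof -
  have "(\<lambda>n. box_bump n a b x) \<longlonglongrightarrow> (\<Prod>i\<in>UNIV. (if x $ i - a $ i > 0 then 1 else 0) * (if b $ i - x $ i > 0 then 1 else 0))"
    unfolding box_bump_def by (intro tendsto_prod tendsto_mult flat_scaled_tendsto)
  also have "(\<Prod>i\<in>UNIV. (if x $ i - a $ i > 0 then 1 else 0) * (if b $ i - x $ i > 0 then 1 else (0::real))) = indicator (box a b) x"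
    by (auto simp: indicator_def mem_box_cart prod_zero_iff)
  finally show ?thesis .
qed

lemma box_bump_test_field:
  assumes "cbox a b \<subseteq> \<Omega>"
  shows "(\<lambda>x. box_bump n a b x *\<^sub>R e) \<in> test_fields \<Omega>"
proof -
  let ?S = "{x. box_bump n a b x *\<^sub>R e \<noteq> 0}"
  have "?S \<subseteq> box a b" using box_bump_support[of n a b] by auto
  then have "?S \<subseteq> cbox a b" using box_subset_cbox by blast
  then have sub: "closure ?S \<subseteq> cbox a b" by (rule closure_minimal) (rule closed_cbox)
  then have "compact (closure ?S)"
    using bounded_subset[OF bounded_cbox sub] by (simp add: compact_eq_bounded_closed)
  then show ?thesis using sub assms flat_algebra_Ck[OF box_bump_in_flat_algebra]
    unfolding test_fields_def by blast
qed

text \<open>Testing with bumps that tend to the indicator of a box shows that the integral over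
  every closed box in the domain vanishes; differentiating the integral at almost every point
  recovers the value of the field.\<close>

lemma fundamental_lemma:
  fixes w :: "real^3 \<Rightarrow> real^3"
  assumes \<Omega>: "open \<Omega>" and int: "integrable (lebesgue_on \<Omega>) w"
    and orth: "\<And>\<phi>. \<phi> \<in> test_fields \<Omega> \<Longrightarrow> (\<integral>x. w x \<bullet> \<phi> x \<partial>lebesgue_on \<Omega>) = 0"
  shows "AE x in lebesgue_on \<Omega>. w x = 0"
proof -
  have \<Omega>m: "\<Omega> \<in> sets lebesgue" using \<Omega> by auto
  \<comment> \<open>Extension by zero, so that integrals over boxes and their derivatives are taken
    in the whole space.\<close>
  define f where "f x = indicator \<Omega> x *\<^sub>R w x" for x
  have f: "integrable lebesgue f"
    using int \<Omega>m unfolding f_def by (simp add: integrable_restrict_space)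
  have fs: "set_integrable lebesgue S f" if "S \<in> sets lebesgue" for S
    unfolding set_integrable_def by (rule integrable_mult_indicator[OF that f])
  have zero: "integral (cbox a b) f = 0" if ab: "cbox a b \<subseteq> \<Omega>" for a b
  proof -
    have comp: "(\<integral>x. indicator (box a b) x *\<^sub>R f x \<partial>lebesgue) \<bullet> e = 0" for e
    proof -
      let ?g = "\<lambda>n x. f x \<bullet> (box_bump n a b x *\<^sub>R e)"
      have "(\<lambda>n. \<integral>x. ?g n x \<partial>lebesgue) \<longlonglongrightarrow> (\<integral>x. indicator (box a b) x * (f x \<bullet> e) \<partial>lebesgue)"
      proof (rule integral_dominated_convergence[where w="\<lambda>x. norm (f x) * norm e"])
        have "box_bump n a b \<in> borel_measurable lebesgue" for n
        proof -
          obtain D where "\<forall>x. (box_bump n a b has_derivative D x) (at x)"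
            using flat_algebra_derivative[OF box_bump_in_flat_algebra] by blast
          then have "continuous_on UNIV (box_bump n a b)"
            by (intro continuous_at_imp_continuous_on ballI) (blast intro: has_derivative_continuous)
          then show ?thesis by (simp add: borel_measurable_continuous_onI measurable_completion)
        qed
        then show "?g n \<in> borel_measurable lebesgue" for n
          using f by (intro borel_measurable_inner borel_measurable_scaleR) auto
        show "(\<lambda>x. indicator (box a b) x * (f x \<bullet> e)) \<in> borel_measurable lebesgue"
          using f by (intro borel_measurable_times borel_measurable_inner borel_measurable_indicator) auto
        show "integrable lebesgue (\<lambda>x. norm (f x) * norm e)"
          using f by (intro integrable_mult_left integrable_norm)
        show "AE x in lebesgue. (\<lambda>n. ?g n x) \<longlonglongrightarrow> indicator (box a b) x * (f x \<bullet> e)"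
          using tendsto_mult[OF box_bump_tendsto tendsto_const] by auto
        show "AE x in lebesgue. norm (?g n x) \<le> norm (f x) * norm e" for n
        proof (rule AE_I2)
          fix x
          have "norm (?g n x) \<le> norm (f x) * norm (box_bump n a b x *\<^sub>R e)" unfolding real_norm_def by (rule Cauchy_Schwarz_ineq2)
          also have "\<dots> \<le> norm (f x) * norm e"
            using box_bump_bounds[of n a b x] by (intro mult_left_mono) (auto intro: mult_left_le_one_le)
          finally show "norm (?g n x) \<le> norm (f x) * norm e" .
        qed
      qed
      moreover have "(\<integral>x. ?g n x \<partial>lebesgue) = 0" for n
      proof -
        have "(\<integral>x. ?g n x \<partial>lebesgue) = (\<integral>x. w x \<bullet> (box_bump n a b x *\<^sub>R e) \<partial>lebesgue_on \<Omega>)"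
          using \<Omega>m by (simp add: integral_restrict_space f_def mult.left_commute)
        then show ?thesis using orth[OF box_bump_test_field[OF ab]] by simp
      qed
      ultimately have "(\<integral>x. indicator (box a b) x * (f x \<bullet> e) \<partial>lebesgue) = 0"
        by (simp add: LIMSEQ_const_iff)
      moreover have "(\<integral>x. indicator (box a b) x *\<^sub>R f x \<partial>lebesgue) \<bullet> e = (\<integral>x. indicator (box a b) x * (f x \<bullet> e) \<partial>lebesgue)"
        using fs[of "box a b"] unfolding set_integrable_def by (subst integral_inner_left[symmetric]) auto
      ultimately show ?thesis by simp
    qed
    have "integral (cbox a b) f = integral (box a b) f" by (rule integral_open_interval[symmetric])
    also have "\<dots> = (\<integral>x. indicator (box a b) x *\<^sub>R f x \<partial>lebesgue)"
      using set_lebesgue_integral_eq_integral(2)[OF fs[of "box a b"]] by (simp add: set_lebesgue_integral_def)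
    also have "\<dots> = 0" using comp inner_eq_zero_iff by blast
    finally show ?thesis .
  qed
  \<comment> \<open>Prepares the differentiation theorem, which compares \<open>f x\<close> with
    averages over small cubes having \<open>x\<close> as a corner.\<close>
  have "f integrable_on cbox a b" for a b
    by (rule set_lebesgue_integral_eq_integral(1)[OF fs]) simp
  then obtain N where N: "negligible N" and diff: "\<And>x e. \<lbrakk>x \<notin> N; 0 < e\<rbrakk> \<Longrightarrow>
      \<exists>d>0. \<forall>h. 0 < h \<and> h < d \<longrightarrow> norm (integral (cbox x (x + h *\<^sub>R One)) f /\<^sub>R h ^ DIM(real^3) - f x) < e"
    using integrable_ccontinuous_explicit[of f] by blast
  have w0: "w x = 0" if x: "x \<in> \<Omega>" "x \<notin> N" for x
  proof (rule ccontr)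
    assume nz: "w x \<noteq> 0"
    have fx: "f x = w x" using x by (simp add: f_def)
    obtain d where d: "d > 0" and dh: "\<And>h. 0 < h \<Longrightarrow> h < d \<Longrightarrow>
        norm (integral (cbox x (x + h *\<^sub>R One)) f /\<^sub>R h ^ DIM(real^3) - f x) < norm (w x)"
      using diff[OF x(2), of "norm (w x)"] nz by auto
    obtain r where r: "r > 0" "cball x r \<subseteq> \<Omega>" using \<Omega> x(1) open_contains_cball by blast
    \<comment> \<open>Half of \<open>d\<close> makes \<open>h < d\<close> strict; the second bound
      keeps the diagonal \<open>h * norm One\<close> of the cube at most \<open>r\<close>, hence the
      cube inside the domain.\<close>
    define h where "h = min (d / 2) (r / (norm (One::real^3) + 1))"
    have h: "0 < h" "h < d" "h * norm (One::real^3) \<le> r"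
    proof -
      have p: "norm (One::real^3) + 1 > 0" using norm_ge_zero[of "One::real^3"] by linarith
      show "0 < h" "h < d" using d r p by (auto simp: h_def)
      have "h * norm (One::real^3) \<le> r / (norm (One::real^3) + 1) * norm (One::real^3)"
        by (rule mult_right_mono) (auto simp: h_def)
      also have "\<dots> \<le> r" using p r by (simp add: field_simps)
      finally show "h * norm (One::real^3) \<le> r" .
    qed
    have "cbox x (x + h *\<^sub>R One) \<subseteq> cball x r"
    proof
      fix y assume y: "y \<in> cbox x (x + h *\<^sub>R One)"
      have "norm (y - x) \<le> norm (h *\<^sub>R (One :: real^3))"
        by (rule norm_le_componentwise) (use y h(1) in \<open>auto simp: mem_box inner_diff_left inner_add_left\<close>)
      then show "y \<in> cball x r" using h by (simp add: dist_norm norm_minus_commute)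
    qed
    then have "integral (cbox x (x + h *\<^sub>R One)) f = 0" using zero r(2) by blast
    then show False using dh[OF h(1,2)] fx by simp
  qed
  have "N \<in> null_sets lebesgue" using N by (simp add: negligible_iff_null_sets)
  then have "AE x in lebesgue. x \<in> \<Omega> \<longrightarrow> w x = 0"
    by (rule AE_I') (use w0 in auto)
  then show ?thesis using \<Omega>m by (simp add: AE_restrict_space_iff)
qed

section \<open>The energy form\<close>

lemma (in psd_form) parallelogram_le:
  assumes "u \<in> V" "v \<in> V"
  shows "a (\<lambda>x. u x + v x) (\<lambda>x. u x + v x) \<le> 2 * a u u + 2 * a v v"
proof -
  have "0 \<le> a u u - 2 * a u v + a v v"
    using square_add[OF assms, of "-1"] nonneg[OF diff_closed[OF assms]] by simp
  then show ?thesis using square_add[OF assms, of 1] by simp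
qed

text \<open>The norm of a matrix type is the Frobenius norm, so Cauchy-Schwarz applies row by
  row.\<close>

lemma norm_matrix_vector_le: "norm (A *v x) \<le> norm A * norm (x :: real^'n)" for A :: "real^'n^'m"
proof -
  have "norm (A *v x) \<le> L2_set (\<lambda>i. norm (A $ i) * norm x) UNIV"
    unfolding norm_vec_def[of "A *v x"]
    by (rule L2_set_mono) (auto simp: matrix_vector_mul_component Cauchy_Schwarz_ineq2)
  also have "\<dots> = norm A * norm x"
    by (simp add: L2_set_left_distrib norm_vec_def[of A])
  finally show ?thesis .
qed

lemma borel_measurable_matrix_vector:
  fixes c :: "'a \<Rightarrow> real^'n^'m" and u :: "'a \<Rightarrow> real^'n"
  assumes "c \<in> borel_measurable M" "u \<in> borel_measurable M"
  shows "(\<lambda>x. c x *v u x) \<in> borel_measurable M"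
proof (rule borel_measurable_continuous_Pair[OF assms])
  show "continuous_on UNIV (\<lambda>x. fst x *v snd x :: real^'m)"
    unfolding matrix_vector_mult_def by (intro continuous_intros)
qed

text \<open>Just enough for a bounded symmetric semidefinite form. The coefficients of the problem
  and the identity matrix both qualify, so the energy and the graph norm come from one
  construction.\<close>

definition nonneg_coefficient :: "'a measure \<Rightarrow> ('a \<Rightarrow> real^3^3) \<Rightarrow> bool" where
  "nonneg_coefficient M c \<longleftrightarrow> c \<in> borel_measurable M \<and> (\<exists>K. AE x in M. norm (c x) \<le> K) \<and>
     (AE x in M. transpose (c x) = c x) \<and> (AE x in M. \<forall>\<xi>. 0 \<le> \<xi> \<bullet> (c x *v \<xi>))"

lemma nonneg_coefficient_of_coefficient:
  assumes "coefficient \<Omega> B c"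
  shows "nonneg_coefficient (lebesgue_on \<Omega>) c"
proof -
  obtain c0 where "c0 > 0" and c0: "AE x in lebesgue_on \<Omega>. \<forall>\<xi>. c0 * (norm \<xi>)\<^sup>2 \<le> \<xi> \<bullet> (c x *v \<xi>)"
    using assms by (auto simp: coefficient_def)
  from c0 have "AE x in lebesgue_on \<Omega>. \<forall>\<xi>. 0 \<le> \<xi> \<bullet> (c x *v \<xi>)"
  proof eventually_elim
    case (elim x)
    have "0 \<le> c0 * (norm \<xi>)\<^sup>2" for \<xi> :: "real^3" using \<open>c0 > 0\<close> by simp
    then show ?case using elim order_trans by blast
  qed
  then show ?thesis using assms by (simp add: coefficient_def nonneg_coefficient_def Linf_def)
qed

lemma nonneg_coefficient_mat_1: "nonneg_coefficient M (\<lambda>_. mat 1)"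
  by (auto simp: nonneg_coefficient_def intro: exI[of _ "norm (mat 1 :: real^3^3)"])

lemma integrable_coefficient:
  assumes c: "nonneg_coefficient M c" and u: "square_integrable M u" and v: "square_integrable M v"
  shows "integrable M (\<lambda>x. (c x *v u x) \<bullet> v x)"
proof -
  obtain K where K: "AE x in M. norm (c x) \<le> K" using c by (auto simp: nonneg_coefficient_def)
  note [measurable] = u v
  have [measurable]: "c \<in> borel_measurable M" using c by (simp add: nonneg_coefficient_def)
  show ?thesis
  proof (rule integrable_inner_of_bound[OF u v, where c="max 0 K"])
    show "(\<lambda>x. (c x *v u x) \<bullet> v x) \<in> borel_measurable M"
      using borel_measurable_matrix_vector[of c M u] by measurable
    show "AE x in M. \<bar>(c x *v u x) \<bullet> v x\<bar> \<le> max 0 K * (norm (u x) * norm (v x))"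
      using K
    proof eventually_elim
      case (elim x)
      have "\<bar>(c x *v u x) \<bullet> v x\<bar> \<le> norm (c x *v u x) * norm (v x)" by (rule Cauchy_Schwarz_ineq2)
      also have "\<dots> \<le> (norm (c x) * norm (u x)) * norm (v x)"
        by (intro mult_right_mono norm_matrix_vector_le) auto
      also have "\<dots> \<le> (max 0 K * norm (u x)) * norm (v x)"
        by (intro mult_right_mono) (use elim in auto)
      finally show ?case by (simp add: mult.assoc)
    qed
  qed simp
qed

lemma psd_form_coefficient:
  assumes c: "nonneg_coefficient M c"
  shows "psd_form {v. square_integrable M v} (\<lambda>u v. \<integral>x. (c x *v u x) \<bullet> v x \<partial>M)"
proof
  fix u v w :: "'a \<Rightarrow> real^3" and d
  assume [simplified]: "u \<in> {v. square_integrable M v}" "v \<in> {v. square_integrable M v}" "w \<in> {v. square_integrable M v}"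
  then show "(\<integral>x. (c x *v (u x + d *\<^sub>R v x)) \<bullet> w x \<partial>M) = (\<integral>x. (c x *v u x) \<bullet> w x \<partial>M) + d * (\<integral>x. (c x *v v x) \<bullet> w x \<partial>M)"
    by (simp add: matrix_vector_right_distrib matrix_vector_mult_scaleR inner_add_left integrable_coefficient[OF c])
next
  fix u v :: "'a \<Rightarrow> real^3"
  assume [simplified]: "u \<in> {v. square_integrable M v}" "v \<in> {v. square_integrable M v}"
  have "AE x in M. transpose (c x) = c x" using c by (simp add: nonneg_coefficient_def)
  then have "AE x in M. (c x *v u x) \<bullet> v x = (c x *v v x) \<bullet> u x"
    by eventually_elim (metis dot_lmul_matrix inner_commute transpose_matrix_vector)
  then show "(\<integral>x. (c x *v u x) \<bullet> v x \<partial>M) = (\<integral>x. (c x *v v x) \<bullet> u x \<partial>M)"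
    using integrable_coefficient[OF c] \<open>square_integrable M u\<close> \<open>square_integrable M v\<close>
    by (intro integral_cong_AE) auto
next
  fix u :: "'a \<Rightarrow> real^3"
  have "AE x in M. \<forall>\<xi>. 0 \<le> \<xi> \<bullet> (c x *v \<xi>)" using c by (simp add: nonneg_coefficient_def)
  then have "AE x in M. 0 \<le> (c x *v u x) \<bullet> u x" by eventually_elim (simp add: inner_commute)
  then show "0 \<le> (\<integral>x. (c x *v u x) \<bullet> u x \<partial>M)" by (rule integral_nonneg_AE)
qed (auto simp: square_integrable_zero square_integrable_add_scaleR)

section \<open>Weak curls on a bounded open set\<close>

locale bounded_open =
  fixes \<Omega> :: "(real^3) set"
  assumes open_\<Omega>: "open \<Omega>" and bounded_\<Omega>: "bounded \<Omega>"
begin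

abbreviation "M \<equiv> lebesgue_on \<Omega>"

lemma sets_\<Omega> [simp, measurable]: "\<Omega> \<in> sets lebesgue"
  using open_\<Omega> by auto

lemma lmeasurable_\<Omega>: "\<Omega> \<in> lmeasurable"
  using bounded_\<Omega> open_\<Omega> by (simp add: lmeasurable_open)

sublocale finite_measure M
  by (rule finite_measure_lebesgue_on[OF lmeasurable_\<Omega>])

text \<open>\<open>curl\<close> is a choice, and this makes it independent of the choice up to null
  sets. Boundedness of the domain turns the square integrable difference into an integrable one, as
  the fundamental lemma requires.\<close>

lemma weak_curl_unique:
  assumes w: "square_integrable M w" "has_weak_curl \<Omega> v w" and w': "square_integrable M w'" "has_weak_curl \<Omega> v w'"
  shows "AE x in M. w x = w' x"
proof -
  have "AE x in M. w x - w' x = 0"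
  proof (rule fundamental_lemma[OF open_\<Omega>])
    show "integrable M (\<lambda>x. w x - w' x)"
      by (intro square_integrable_imp_integrable square_integrable_diff w w')
    fix \<phi> assume \<phi>: "\<phi> \<in> test_fields \<Omega>"
    have "(\<integral>x. (w x - w' x) \<bullet> \<phi> x \<partial>M) = (\<integral>x. w x \<bullet> \<phi> x \<partial>M) - (\<integral>x. w' x \<bullet> \<phi> x \<partial>M)"
      using w w' test_field_square_integrable(1)[OF \<phi>] by (simp add: inner_diff_left integrable_inner)
    then show "(\<integral>x. (w x - w' x) \<bullet> \<phi> x \<partial>M) = 0"
      using w(2) w'(2) \<phi> by (simp add: has_weak_curl_def)
  qed
  then show ?thesis by simp
qed

lemma Hcurl_iff: "v \<in> Hcurl \<Omega> \<longleftrightarrow> square_integrable M v \<and> (\<exists>w. square_integrable M w \<and> has_weak_curl \<Omega> v w)"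
  by (auto simp: Hcurl_def L2_fields_iff)

lemma Hcurl_square_integrable: "v \<in> Hcurl \<Omega> \<Longrightarrow> square_integrable M v"
  by (simp add: Hcurl_iff)

lemma curl_works:
  assumes "v \<in> Hcurl \<Omega>"
  shows "square_integrable M (curl \<Omega> v)" "has_weak_curl \<Omega> v (curl \<Omega> v)"
  using someI_ex[of "\<lambda>w. w \<in> L2_fields \<Omega> \<and> has_weak_curl \<Omega> v w"] assms
  unfolding curl_def[symmetric] by (auto simp: Hcurl_iff L2_fields_iff)

text \<open>The way to compute with the chosen \<open>curl\<close>: exhibit any square integrable
  weak curl, and the two agree almost everywhere.\<close>

lemma curl_eq:
  assumes "square_integrable M v" "square_integrable M w" "has_weak_curl \<Omega> v w"
  shows "v \<in> Hcurl \<Omega>" "AE x in M. curl \<Omega> v x = w x"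
proof -
  show v: "v \<in> Hcurl \<Omega>" using assms by (auto simp: Hcurl_iff)
  show "AE x in M. curl \<Omega> v x = w x"
    by (rule weak_curl_unique[OF curl_works[OF v] assms(2,3)])
qed

lemma has_weak_curl_add_scaleR:
  assumes "square_integrable M v" "square_integrable M w" "has_weak_curl \<Omega> v w"
    "square_integrable M v'" "square_integrable M w'" "has_weak_curl \<Omega> v' w'"
  shows "has_weak_curl \<Omega> (\<lambda>x. v x + c *\<^sub>R v' x) (\<lambda>x. w x + c *\<^sub>R w' x)"
  using assms unfolding has_weak_curl_def
  by (simp add: inner_add_left integrable_inner test_field_square_integrable)

lemma Hcurl_add_scaleR:
  assumes "v \<in> Hcurl \<Omega>" "v' \<in> Hcurl \<Omega>"
  shows "(\<lambda>x. v x + c *\<^sub>R v' x) \<in> Hcurl \<Omega>"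
    "AE x in M. curl \<Omega> (\<lambda>x. v x + c *\<^sub>R v' x) x = curl \<Omega> v x + c *\<^sub>R curl \<Omega> v' x"
  using curl_eq[OF square_integrable_add_scaleR square_integrable_add_scaleR has_weak_curl_add_scaleR,
      OF Hcurl_square_integrable[OF assms(1)] Hcurl_square_integrable[OF assms(2)]
        curl_works(1)[OF assms(1)] curl_works(1)[OF assms(2)]
        Hcurl_square_integrable[OF assms(1)] curl_works[OF assms(1)]
        Hcurl_square_integrable[OF assms(2)] curl_works[OF assms(2)]]
  by auto

lemma Hcurl_diff:
  assumes "v \<in> Hcurl \<Omega>" "v' \<in> Hcurl \<Omega>"
  shows "(\<lambda>x. v x - v' x) \<in> Hcurl \<Omega>"
    "AE x in M. curl \<Omega> (\<lambda>x. v x - v' x) x = curl \<Omega> v x - curl \<Omega> v' x"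
  using Hcurl_add_scaleR[OF assms, of "-1"] by simp_all

lemma test_fields_Hcurl: "\<phi> \<in> test_fields \<Omega> \<Longrightarrow> \<phi> \<in> Hcurl \<Omega>"
  by (rule curl_eq(1)[OF test_field_square_integrable test_field_has_weak_curl]) auto

lemma psd_form_bilin:
  assumes \<nu>: "nonneg_coefficient M \<nu>" and \<epsilon>: "nonneg_coefficient M \<epsilon>"
  shows "psd_form (Hcurl \<Omega>) (bilin \<Omega> \<nu> \<epsilon>)"
proof -
  interpret n: psd_form "{v. square_integrable M v}" "\<lambda>u v. \<integral>x. (\<nu> x *v u x) \<bullet> v x \<partial>M"
    by (rule psd_form_coefficient[OF \<nu>])
  interpret e: psd_form "{v. square_integrable M v}" "\<lambda>u v. \<integral>x. (\<epsilon> x *v u x) \<bullet> v x \<partial>M"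
    by (rule psd_form_coefficient[OF \<epsilon>])
  show ?thesis
  proof
    show "(\<lambda>_. 0) \<in> Hcurl \<Omega>" using test_fields_Hcurl[OF test_fields_zero] .
  next
    fix u v :: "real^3 \<Rightarrow> real^3" and c assume "u \<in> Hcurl \<Omega>" "v \<in> Hcurl \<Omega>"
    then show "(\<lambda>x. u x + c *\<^sub>R v x) \<in> Hcurl \<Omega>" by (rule Hcurl_add_scaleR(1))
  next
    fix u v :: "real^3 \<Rightarrow> real^3" assume "u \<in> Hcurl \<Omega>" "v \<in> Hcurl \<Omega>"
    then show "bilin \<Omega> \<nu> \<epsilon> u v = bilin \<Omega> \<nu> \<epsilon> v u"
      unfolding bilin_def using n.sym[of "curl \<Omega> u" "curl \<Omega> v"] e.sym[of u v]
      by (simp add: curl_works Hcurl_square_integrable)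
  next
    fix u :: "real^3 \<Rightarrow> real^3" assume "u \<in> Hcurl \<Omega>"
    then show "0 \<le> bilin \<Omega> \<nu> \<epsilon> u u"
      unfolding bilin_def using n.nonneg[of "curl \<Omega> u"] e.nonneg[of u]
      by (simp add: curl_works Hcurl_square_integrable)
  next
    fix u v w :: "real^3 \<Rightarrow> real^3" and c assume uvw: "u \<in> Hcurl \<Omega>" "v \<in> Hcurl \<Omega>" "w \<in> Hcurl \<Omega>"
    \<comment> \<open>The chosen curl of a combination is the combination of the chosen curls only
      almost everywhere; the integral does not see the difference.\<close>
    have "(\<integral>x. (\<nu> x *v curl \<Omega> (\<lambda>x. u x + c *\<^sub>R v x) x) \<bullet> curl \<Omega> w x \<partial>M) =
          (\<integral>x. (\<nu> x *v (curl \<Omega> u x + c *\<^sub>R curl \<Omega> v x)) \<bullet> curl \<Omega> w x \<partial>M)"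
    proof (rule integral_cong_AE)
      show "(\<lambda>x. (\<nu> x *v curl \<Omega> (\<lambda>x. u x + c *\<^sub>R v x) x) \<bullet> curl \<Omega> w x) \<in> borel_measurable M"
        by (intro borel_measurable_integrable integrable_coefficient \<nu> curl_works Hcurl_add_scaleR uvw)
      show "(\<lambda>x. (\<nu> x *v (curl \<Omega> u x + c *\<^sub>R curl \<Omega> v x)) \<bullet> curl \<Omega> w x) \<in> borel_measurable M"
        by (intro borel_measurable_integrable integrable_coefficient \<nu> curl_works square_integrable_add_scaleR uvw)
      show "AE x in M. (\<nu> x *v curl \<Omega> (\<lambda>x. u x + c *\<^sub>R v x) x) \<bullet> curl \<Omega> w x =
          (\<nu> x *v (curl \<Omega> u x + c *\<^sub>R curl \<Omega> v x)) \<bullet> curl \<Omega> w x"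
        using Hcurl_add_scaleR(2)[OF uvw(1,2), of c] by eventually_elim simp
    qed
    then show "bilin \<Omega> \<nu> \<epsilon> (\<lambda>x. u x + c *\<^sub>R v x) w = bilin \<Omega> \<nu> \<epsilon> u w + c * bilin \<Omega> \<nu> \<epsilon> v w"
      unfolding bilin_def
      using n.lin[of "curl \<Omega> u" "curl \<Omega> v" "curl \<Omega> w" c] e.lin[of u v w c] uvw
      by (simp add: curl_works Hcurl_square_integrable algebra_simps)
  qed
qed

text \<open>The inner product of the graph norm, written as an energy with identity coefficients so
  that the lemmas on forms cover it.\<close>

definition graph_form :: "(real^3 \<Rightarrow> real^3) \<Rightarrow> (real^3 \<Rightarrow> real^3) \<Rightarrow> real" where
  "graph_form = bilin \<Omega> (\<lambda>_. mat 1) (\<lambda>_. mat 1)"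

sublocale graph: psd_form "Hcurl \<Omega>" graph_form
  unfolding graph_form_def by (rule psd_form_bilin[OF nonneg_coefficient_mat_1 nonneg_coefficient_mat_1])

lemma graph_form_eq:
  "graph_form v v = (\<integral>x. (norm (v x))\<^sup>2 \<partial>M) + (\<integral>x. (norm (curl \<Omega> v x))\<^sup>2 \<partial>M)"
  by (simp add: graph_form_def bilin_def dot_square_norm)

text \<open>Density is expressed through the square of the graph norm, which the algebra of forms
  handles directly.\<close>

lemma H0curl_iff:
  "v \<in> H0curl \<Omega> \<longleftrightarrow> v \<in> Hcurl \<Omega> \<and>
     (\<forall>e>0. \<exists>\<phi>\<in>test_fields \<Omega>. graph_form (\<lambda>x. v x - \<phi> x) (\<lambda>x. v x - \<phi> x) < e)"
proof -
  have "(\<forall>e>0. \<exists>\<phi>\<in>test_fields \<Omega>. sqrt (g \<phi>) < e) \<longleftrightarrow> (\<forall>e>0. \<exists>\<phi>\<in>test_fields \<Omega>. g \<phi> < e)"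
    for g :: "(real^3 \<Rightarrow> real^3) \<Rightarrow> real"
  proof safe
    fix e :: real assume "e > 0" and *: "\<forall>e>0. \<exists>\<phi>\<in>test_fields \<Omega>. sqrt (g \<phi>) < e"
    then obtain \<phi> where "\<phi> \<in> test_fields \<Omega>" "sqrt (g \<phi>) < sqrt e" by (metis real_sqrt_gt_zero)
    then show "\<exists>\<phi>\<in>test_fields \<Omega>. g \<phi> < e" by auto
  next
    fix e :: real assume "e > 0" and *: "\<forall>e>0. \<exists>\<phi>\<in>test_fields \<Omega>. g \<phi> < e"
    then obtain \<phi> where \<phi>: "\<phi> \<in> test_fields \<Omega>" "g \<phi> < e\<^sup>2" by (metis zero_less_power)
    then have "sqrt (g \<phi>) < e" using \<open>e > 0\<close> by (simp add: real_less_lsqrt)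
    then show "\<exists>\<phi>\<in>test_fields \<Omega>. sqrt (g \<phi>) < e" using \<phi> by blast
  qed
  then show ?thesis unfolding H0curl_def Hcurl_norm_def graph_form_eq by simp
qed

lemma H0curl_Hcurl: "v \<in> H0curl \<Omega> \<Longrightarrow> v \<in> Hcurl \<Omega>"
  by (simp add: H0curl_def)

lemma test_fields_H0curl: "\<phi> \<in> test_fields \<Omega> \<Longrightarrow> \<phi> \<in> H0curl \<Omega>"
  unfolding H0curl_iff
proof safe
  fix e :: real assume "\<phi> \<in> test_fields \<Omega>" "e > 0"
  moreover have "graph_form (\<lambda>x. 0) (\<lambda>x. 0) = 0"
    using graph.lin[OF graph.zero graph.zero graph.zero, of 1] by simp
  ultimately show "\<exists>\<phi>'\<in>test_fields \<Omega>. graph_form (\<lambda>x. \<phi> x - \<phi>' x) (\<lambda>x. \<phi> x - \<phi>' x) < e"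
    by (intro bexI[of _ \<phi>]) auto
qed (rule test_fields_Hcurl)

text \<open>A closure is closed: approximate \<open>v\<close> by \<open>u\<close> and
  \<open>u\<close> by a test field. The parallelogram inequality carries the factor 2 on both terms,
  whence \<open>e / 4\<close> for each.\<close>

lemma H0curl_closed:
  assumes "v \<in> Hcurl \<Omega>" and "\<And>e. e > 0 \<Longrightarrow> \<exists>u\<in>H0curl \<Omega>. graph_form (\<lambda>x. v x - u x) (\<lambda>x. v x - u x) < e"
  shows "v \<in> H0curl \<Omega>"
  unfolding H0curl_iff
proof (intro conjI allI impI assms(1))
  fix e :: real assume "e > 0"
  then obtain u where u: "u \<in> H0curl \<Omega>" "graph_form (\<lambda>x. v x - u x) (\<lambda>x. v x - u x) < e / 4"
    using assms(2)[of "e / 4"] by auto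
  obtain \<phi> where \<phi>: "\<phi> \<in> test_fields \<Omega>" "graph_form (\<lambda>x. u x - \<phi> x) (\<lambda>x. u x - \<phi> x) < e / 4"
    using u(1) \<open>e > 0\<close> unfolding H0curl_iff by (meson divide_pos_pos zero_less_numeral)
  have "graph_form (\<lambda>x. v x - \<phi> x) (\<lambda>x. v x - \<phi> x) < e"
    using graph.parallelogram_le[OF Hcurl_diff(1)[OF assms(1) H0curl_Hcurl[OF u(1)]]
        Hcurl_diff(1)[OF H0curl_Hcurl[OF u(1)] test_fields_Hcurl[OF \<phi>(1)]]] u(2) \<phi>(2) by simp
  then show "\<exists>\<phi>\<in>test_fields \<Omega>. graph_form (\<lambda>x. v x - \<phi> x) (\<lambda>x. v x - \<phi> x) < e" using \<phi>(1) by blast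
qed

lemma H0curl_add_scaleR:
  assumes u: "u \<in> H0curl \<Omega>" and v: "v \<in> H0curl \<Omega>"
  shows "(\<lambda>x. u x + c *\<^sub>R v x) \<in> H0curl \<Omega>"
proof (rule H0curl_closed)
  note uv = H0curl_Hcurl[OF u] H0curl_Hcurl[OF v]
  show "(\<lambda>x. u x + c *\<^sub>R v x) \<in> Hcurl \<Omega>" by (rule Hcurl_add_scaleR(1)[OF uv])
  fix e :: real assume "e > 0"
  \<comment> \<open>Chosen so that the parallelogram bound
    \<open>2 * d + 2 * (c\<^sup>2 * d)\<close> equals \<open>e / 2\<close>.\<close>
  define d where "d = e / (4 * (1 + c\<^sup>2))"
  have d: "d > 0" "2 * d + 2 * (c\<^sup>2 * d) < e"
  proof -
    have p: "1 + c\<^sup>2 > 0" using zero_le_power2[of c] by linarith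
    then show "d > 0" using \<open>e > 0\<close> by (simp add: d_def)
    have "2 * d + 2 * (c\<^sup>2 * d) = 2 * (1 + c\<^sup>2) * d" by (simp add: algebra_simps)
    also have "\<dots> = e / 2" using p by (simp add: d_def field_simps)
    finally show "2 * d + 2 * (c\<^sup>2 * d) < e" using \<open>e > 0\<close> by simp
  qed
  have approx: "\<exists>\<phi>\<in>test_fields \<Omega>. graph_form (\<lambda>x. z x - \<phi> x) (\<lambda>x. z x - \<phi> x) < d" if "z \<in> H0curl \<Omega>" for z
    using that d(1) by (simp add: H0curl_iff)
  obtain \<phi> where \<phi>: "\<phi> \<in> test_fields \<Omega>" "graph_form (\<lambda>x. u x - \<phi> x) (\<lambda>x. u x - \<phi> x) < d"
    using approx[OF u] by (elim bexE)
  obtain \<psi> where \<psi>: "\<psi> \<in> test_fields \<Omega>" "graph_form (\<lambda>x. v x - \<psi> x) (\<lambda>x. v x - \<psi> x) < d"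
    using approx[OF v] by (elim bexE)
  have \<phi>u: "(\<lambda>x. u x - \<phi> x) \<in> Hcurl \<Omega>" and \<psi>v: "(\<lambda>x. v x - \<psi> x) \<in> Hcurl \<Omega>"
    by (rule Hcurl_diff(1)[OF _ test_fields_Hcurl]; fact)+
  have c\<psi>v: "(\<lambda>x. c *\<^sub>R (v x - \<psi> x)) \<in> Hcurl \<Omega>"
    using graph.closed[OF graph.zero \<psi>v, of c] by simp
  have "graph_form (\<lambda>x. c *\<^sub>R (v x - \<psi> x)) (\<lambda>x. c *\<^sub>R (v x - \<psi> x)) = c\<^sup>2 * graph_form (\<lambda>x. v x - \<psi> x) (\<lambda>x. v x - \<psi> x)"
    using graph.square_add[OF graph.zero \<psi>v, of c] graph.lin[OF graph.zero graph.zero, of _ 1]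
      graph.zero \<psi>v by simp
  also have "\<dots> \<le> c\<^sup>2 * d" using \<psi>(2) by (intro mult_left_mono) auto
  finally have "graph_form (\<lambda>x. (u x - \<phi> x) + c *\<^sub>R (v x - \<psi> x)) (\<lambda>x. (u x - \<phi> x) + c *\<^sub>R (v x - \<psi> x)) < e"
    using graph.parallelogram_le[OF \<phi>u c\<psi>v] \<phi>(2) d(2) by argo
  moreover have "(\<lambda>x. (u x - \<phi> x) + c *\<^sub>R (v x - \<psi> x)) = (\<lambda>x. (u x + c *\<^sub>R v x) - (\<phi> x + c *\<^sub>R \<psi> x))"
    by (simp add: fun_eq_iff algebra_simps)
  ultimately show "\<exists>w\<in>H0curl \<Omega>. graph_form (\<lambda>x. u x + c *\<^sub>R v x - w x) (\<lambda>x. u x + c *\<^sub>R v x - w x) < e"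
    using test_fields_H0curl[OF test_fields_add_scaleR[OF \<phi>(1) \<psi>(1), of c]]
    by (intro bexI[of _ "\<lambda>x. \<phi> x + c *\<^sub>R \<psi> x"]) simp_all
qed

text \<open>The weak curl is a closed operator, so the graph norm is complete.\<close>

lemma H0curl_complete:
  assumes s: "\<And>n. s n \<in> H0curl \<Omega>"
    and cauchy: "\<And>e. e > 0 \<Longrightarrow> \<exists>N::nat. \<forall>m\<ge>N. \<forall>n\<ge>N. graph_form (\<lambda>x. s m x - s n x) (\<lambda>x. s m x - s n x) < e"
  shows "\<exists>u\<in>H0curl \<Omega>. (\<lambda>n. graph_form (\<lambda>x. s n x - u x) (\<lambda>x. s n x - u x)) \<longlonglongrightarrow> 0"
proof -
  note sH = H0curl_Hcurl[OF s]
  note sL = Hcurl_square_integrable[OF sH] and cL = curl_works(1)[OF sH]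
  \<comment> \<open>Replaces the chosen curl of a difference by the difference of the chosen curls,
    so that the fields and their curls can be treated as two separate Cauchy sequences in
    L^2.\<close>
  have graph_diff: "graph_form (\<lambda>x. v x - v' x) (\<lambda>x. v x - v' x) =
      (\<integral>x. (norm (v x - v' x))\<^sup>2 \<partial>M) + (\<integral>x. (norm (curl \<Omega> v x - curl \<Omega> v' x))\<^sup>2 \<partial>M)"
    if "v \<in> Hcurl \<Omega>" "v' \<in> Hcurl \<Omega>" for v v'
  proof -
    have "(\<integral>x. (norm (curl \<Omega> (\<lambda>x. v x - v' x) x))\<^sup>2 \<partial>M) = (\<integral>x. (norm (curl \<Omega> v x - curl \<Omega> v' x))\<^sup>2 \<partial>M)"
    proof (rule integral_cong_AE)
      show "AE x in M. (norm (curl \<Omega> (\<lambda>x. v x - v' x) x))\<^sup>2 = (norm (curl \<Omega> v x - curl \<Omega> v' x))\<^sup>2"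
        using Hcurl_diff(2)[OF that] by eventually_elim simp
      note [measurable] = curl_works(1)[OF Hcurl_diff(1)[OF that]] curl_works(1)[OF that(1)] curl_works(1)[OF that(2)]
      show "(\<lambda>x. (norm (curl \<Omega> (\<lambda>x. v x - v' x) x))\<^sup>2) \<in> borel_measurable M"
        "(\<lambda>x. (norm (curl \<Omega> v x - curl \<Omega> v' x))\<^sup>2) \<in> borel_measurable M" by measurable
    qed
    then show ?thesis by (simp add: graph_form_eq)
  qed
  have "\<exists>v. square_integrable M v \<and> (\<lambda>n. \<integral>x. (norm (s n x - v x))\<^sup>2 \<partial>M) \<longlonglongrightarrow> 0"
  proof (rule square_integrable_complete[OF sL])
    fix e :: real assume "e > 0"
    then obtain N where N: "\<And>m n. m \<ge> N \<Longrightarrow> n \<ge> N \<Longrightarrow> graph_form (\<lambda>x. s m x - s n x) (\<lambda>x. s m x - s n x) < e"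
      using cauchy by blast
    have "(\<integral>x. (norm (s m x - s n x))\<^sup>2 \<partial>M) \<le> graph_form (\<lambda>x. s m x - s n x) (\<lambda>x. s m x - s n x)" for m n
      by (simp add: graph_form_eq)
    then show "\<exists>N. \<forall>m\<ge>N. \<forall>n\<ge>N. (\<integral>x. (norm (s m x - s n x))\<^sup>2 \<partial>M) < e" using N le_less_trans by blast
  qed
  then obtain v where v: "square_integrable M v" and limv: "(\<lambda>n. \<integral>x. (norm (s n x - v x))\<^sup>2 \<partial>M) \<longlonglongrightarrow> 0" by blast
  have "\<exists>w. square_integrable M w \<and> (\<lambda>n. \<integral>x. (norm (curl \<Omega> (s n) x - w x))\<^sup>2 \<partial>M) \<longlonglongrightarrow> 0"
  proof (rule square_integrable_complete[OF cL])
    fix e :: real assume "e > 0"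
    then obtain N where N: "\<And>m n. m \<ge> N \<Longrightarrow> n \<ge> N \<Longrightarrow> graph_form (\<lambda>x. s m x - s n x) (\<lambda>x. s m x - s n x) < e"
      using cauchy by blast
    have "(\<integral>x. (norm (curl \<Omega> (s m) x - curl \<Omega> (s n) x))\<^sup>2 \<partial>M) \<le> graph_form (\<lambda>x. s m x - s n x) (\<lambda>x. s m x - s n x)" for m n
      by (simp add: graph_diff sH)
    then show "\<exists>N. \<forall>m\<ge>N. \<forall>n\<ge>N. (\<integral>x. (norm (curl \<Omega> (s m) x - curl \<Omega> (s n) x))\<^sup>2 \<partial>M) < e" using N le_less_trans by blast
  qed
  then obtain w where w: "square_integrable M w" and limw: "(\<lambda>n. \<integral>x. (norm (curl \<Omega> (s n) x - w x))\<^sup>2 \<partial>M) \<longlonglongrightarrow> 0" by blast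
  interpret L: psd_form "{v :: real^3 \<Rightarrow> real^3. square_integrable M v}" "\<lambda>u v. \<integral>x. u x \<bullet> v x \<partial>M"
    by (rule psd_form_inner)
  \<comment> \<open>L^2 convergence passes to integrals against a fixed field. Applied to both sides
    of the identity defining the weak curl, it shows that the limit \<open>w\<close> of the curls is
    a weak curl of the limit \<open>v\<close>.\<close>
  have pairing: "(\<lambda>n. \<integral>x. t n x \<bullet> \<phi> x \<partial>M) \<longlonglongrightarrow> (\<integral>x. z x \<bullet> \<phi> x \<partial>M)"
    if t: "\<And>n. square_integrable M (t n)" and z: "square_integrable M z" and \<phi>: "square_integrable M \<phi>"
      and lim: "(\<lambda>n. \<integral>x. (norm (t n x - z x))\<^sup>2 \<partial>M) \<longlonglongrightarrow> 0" for t and z \<phi> :: "real^3 \<Rightarrow> real^3"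
  proof -
    have d: "square_integrable M (\<lambda>x. t n x - z x)" for n by (rule square_integrable_diff[OF t z])
    have "(\<lambda>n. \<integral>x. \<phi> x \<bullet> (t n x - z x) \<partial>M) \<longlonglongrightarrow> 0"
      by (rule L.form_tendsto_0) (use \<phi> d lim in \<open>auto simp: dot_square_norm\<close>)
    moreover have "(\<integral>x. \<phi> x \<bullet> (t n x - z x) \<partial>M) = (\<integral>x. t n x \<bullet> \<phi> x \<partial>M) - (\<integral>x. z x \<bullet> \<phi> x \<partial>M)" for n
      using integrable_inner[OF \<phi> t] integrable_inner[OF \<phi> z] by (simp add: inner_diff_right inner_commute)
    ultimately show ?thesis by (simp add: LIM_zero_iff)
  qed
  have "has_weak_curl \<Omega> v w"
    unfolding has_weak_curl_def
  proof
    fix \<phi> assume \<phi>: "\<phi> \<in> test_fields \<Omega>"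
    note \<phi>L = test_field_square_integrable[OF \<phi> sets_\<Omega>]
    have "(\<integral>x. curl \<Omega> (s n) x \<bullet> \<phi> x \<partial>M) = (\<integral>x. s n x \<bullet> classical_curl \<phi> x \<partial>M)" for n
      using curl_works(2)[OF sH] \<phi> by (simp add: has_weak_curl_def)
    then show "(\<integral>x. w x \<bullet> \<phi> x \<partial>M) = (\<integral>x. v x \<bullet> classical_curl \<phi> x \<partial>M)"
      using pairing[OF cL w \<phi>L(1) limw] pairing[OF sL v \<phi>L(2) limv] LIMSEQ_unique by simp
  qed
  note vH = curl_eq[OF v w this]
  have lim: "(\<lambda>n. graph_form (\<lambda>x. s n x - v x) (\<lambda>x. s n x - v x)) \<longlonglongrightarrow> 0"
  proof -
    have "(\<integral>x. (norm (curl \<Omega> (s n) x - curl \<Omega> v x))\<^sup>2 \<partial>M) = (\<integral>x. (norm (curl \<Omega> (s n) x - w x))\<^sup>2 \<partial>M)" for n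
    proof (rule integral_cong_AE)
      show "AE x in M. (norm (curl \<Omega> (s n) x - curl \<Omega> v x))\<^sup>2 = (norm (curl \<Omega> (s n) x - w x))\<^sup>2"
        using vH(2) by eventually_elim simp
      note [measurable] = cL[of n] curl_works(1)[OF vH(1)] w
      show "(\<lambda>x. (norm (curl \<Omega> (s n) x - curl \<Omega> v x))\<^sup>2) \<in> borel_measurable M"
        "(\<lambda>x. (norm (curl \<Omega> (s n) x - w x))\<^sup>2) \<in> borel_measurable M" by measurable
    qed
    then show ?thesis using tendsto_add[OF limv limw] by (simp add: graph_diff[OF sH vH(1)])
  qed
  have "v \<in> H0curl \<Omega>"
  proof (rule H0curl_closed[OF vH(1)])
    fix e :: real assume "e > 0"
    then have "\<forall>\<^sub>F n in sequentially. graph_form (\<lambda>x. s n x - v x) (\<lambda>x. s n x - v x) < e"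
      using lim by (simp add: order_tendsto_iff)
    then obtain n where n: "graph_form (\<lambda>x. s n x - v x) (\<lambda>x. s n x - v x) < e"
      by (auto simp: eventually_sequentially)
    have "graph_form (\<lambda>x. v x - s n x) (\<lambda>x. v x - s n x) = graph_form (\<lambda>x. s n x - v x) (\<lambda>x. s n x - v x)"
      unfolding graph_diff[OF sH vH(1)] graph_diff[OF vH(1) sH] by (simp add: norm_minus_commute)
    then show "\<exists>u\<in>H0curl \<Omega>. graph_form (\<lambda>x. v x - u x) (\<lambda>x. v x - u x) < e"
      using n s by (intro bexI[of _ "s n"]) simp_all
  qed
  then show ?thesis using lim by blast
qed

end

section \<open>The state problem\<close>

lemma coefficient_lower:
  assumes "coefficient \<Omega> B c"
  obtains c0 where "c0 > 0" "\<And>u. square_integrable (lebesgue_on \<Omega>) u \<Longrightarrow>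
    c0 * (\<integral>x. (norm (u x))\<^sup>2 \<partial>lebesgue_on \<Omega>) \<le> (\<integral>x. (c x *v u x) \<bullet> u x \<partial>lebesgue_on \<Omega>)"
proof -
  obtain c0 where "c0 > 0" and c0: "AE x in lebesgue_on \<Omega>. \<forall>\<xi>. c0 * (norm \<xi>)\<^sup>2 \<le> \<xi> \<bullet> (c x *v \<xi>)"
    using assms by (auto simp: coefficient_def)
  have "c0 * (\<integral>x. (norm (u x))\<^sup>2 \<partial>lebesgue_on \<Omega>) \<le> (\<integral>x. (c x *v u x) \<bullet> u x \<partial>lebesgue_on \<Omega>)"
    if u: "square_integrable (lebesgue_on \<Omega>) u" for u
  proof -
    have "(\<integral>x. c0 * (norm (u x))\<^sup>2 \<partial>lebesgue_on \<Omega>) \<le> (\<integral>x. (c x *v u x) \<bullet> u x \<partial>lebesgue_on \<Omega>)"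
    proof (rule integral_mono_AE)
      show "integrable (lebesgue_on \<Omega>) (\<lambda>x. c0 * (norm (u x))\<^sup>2)" using u by (simp add: square_integrable_def)
      show "integrable (lebesgue_on \<Omega>) (\<lambda>x. (c x *v u x) \<bullet> u x)"
        by (rule integrable_coefficient[OF nonneg_coefficient_of_coefficient[OF assms] u u])
      show "AE x in lebesgue_on \<Omega>. c0 * (norm (u x))\<^sup>2 \<le> (c x *v u x) \<bullet> u x"
        using c0 by eventually_elim (simp add: inner_commute)
    qed
    then show ?thesis by simp
  qed
  then show ?thesis using that \<open>c0 > 0\<close> by blast
qed

lemma coefficient_upper:
  assumes c: "nonneg_coefficient M c"
  obtains K where "K \<ge> 0" "\<And>u. square_integrable M u \<Longrightarrow>
    (\<integral>x. (c x *v u x) \<bullet> u x \<partial>M) \<le> K * (\<integral>x. (norm (u x))\<^sup>2 \<partial>M)"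
proof -
  obtain K where K: "AE x in M. norm (c x) \<le> K" using c by (auto simp: nonneg_coefficient_def)
  have "(\<integral>x. (c x *v u x) \<bullet> u x \<partial>M) \<le> max 0 K * (\<integral>x. (norm (u x))\<^sup>2 \<partial>M)"
    if u: "square_integrable M u" for u
  proof -
    have "(\<integral>x. (c x *v u x) \<bullet> u x \<partial>M) \<le> (\<integral>x. max 0 K * (norm (u x))\<^sup>2 \<partial>M)"
    proof (rule integral_mono_AE)
      show "integrable M (\<lambda>x. max 0 K * (norm (u x))\<^sup>2)" using u by (simp add: square_integrable_def)
      show "integrable M (\<lambda>x. (c x *v u x) \<bullet> u x)" by (rule integrable_coefficient[OF c u u])
      show "AE x in M. (c x *v u x) \<bullet> u x \<le> max 0 K * (norm (u x))\<^sup>2"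
        using K
      proof eventually_elim
        case (elim x)
        have "(c x *v u x) \<bullet> u x \<le> norm (c x *v u x) * norm (u x)" by (rule norm_cauchy_schwarz)
        also have "\<dots> \<le> (norm (c x) * norm (u x)) * norm (u x)"
          by (intro mult_right_mono norm_matrix_vector_le) auto
        also have "\<dots> \<le> (max 0 K * norm (u x)) * norm (u x)"
          by (intro mult_right_mono) (use elim in auto)
        finally show ?case by (simp add: power2_eq_square mult.assoc)
      qed
    qed
    then show ?thesis by simp
  qed
  then show ?thesis using that[of "max 0 K"] by simp
qed

lemma psd_form_subspace:
  assumes "psd_form V a" "W \<subseteq> V" "(\<lambda>_. 0) \<in> W"
    "\<And>u v c. u \<in> W \<Longrightarrow> v \<in> W \<Longrightarrow> (\<lambda>x. u x + c *\<^sub>R v x) \<in> W"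
  shows "psd_form W a"
proof -
  interpret psd_form V a by fact
  show ?thesis using assms(2-4) by unfold_locales (auto intro!: sym lin nonneg simp: subset_iff)
qed

context psd_form
begin

lemma form_diff_right:
  assumes "u \<in> V" "v \<in> V" "w \<in> V"
  shows "a u (\<lambda>x. v x - w x) = a u v - a u w"
  using lin[OF assms(2,3,1), of "-1"] sym[OF assms(1,2)] sym[OF assms(1,3)]
    sym[OF assms(1) diff_closed[OF assms(2,3)]] by simp

lemma form_diff_square:
  assumes "u \<in> V" "v \<in> V"
  shows "a (\<lambda>x. u x - v x) (\<lambda>x. u x - v x) = a u u - 2 * a u v + a v v"
  using square_add[OF assms, of "-1"] by simp

end

locale state_problem = bounded_open +
  fixes B :: "(real^3) set" and \<nu> \<epsilon> :: "real^3 \<Rightarrow> real^3^3" and jc :: real and f :: "real^3 \<Rightarrow> real^3"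
  assumes \<nu>: "coefficient \<Omega> B \<nu>" and \<epsilon>: "coefficient \<Omega> B \<epsilon>" and jc: "jc > 0"
    and f: "square_integrable (lebesgue_on \<Omega>) f"
begin

sublocale energy: psd_form "H0curl \<Omega>" "bilin \<Omega> \<nu> \<epsilon>"
proof (rule psd_form_subspace[OF psd_form_bilin])
  show "nonneg_coefficient M \<nu>" "nonneg_coefficient M \<epsilon>"
    using \<nu> \<epsilon> by (auto intro: nonneg_coefficient_of_coefficient)
  show "(\<lambda>_. 0) \<in> H0curl \<Omega>" by (rule test_fields_H0curl[OF test_fields_zero])
qed (auto intro: H0curl_Hcurl H0curl_add_scaleR)

lemma H0curl_square_integrable: "v \<in> H0curl \<Omega> \<Longrightarrow> square_integrable M v"
  by (rule Hcurl_square_integrable[OF H0curl_Hcurl])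

text \<open>The curl part is dropped as nonnegative. L^2 coercivity is what the Lipschitz bound and
  stability rest on, since the load and the nonsmooth term see no derivatives.\<close>

lemma energy_lower_L2:
  obtains c0 where "c0 > 0"
    "\<And>v. v \<in> H0curl \<Omega> \<Longrightarrow> c0 * (\<integral>x. (norm (v x))\<^sup>2 \<partial>M) \<le> bilin \<Omega> \<nu> \<epsilon> v v"
proof -
  obtain c0 where c0: "c0 > 0" "\<And>u. square_integrable M u \<Longrightarrow>
      c0 * (\<integral>x. (norm (u x))\<^sup>2 \<partial>M) \<le> (\<integral>x. (\<epsilon> x *v u x) \<bullet> u x \<partial>M)"
    using coefficient_lower[OF \<epsilon>] by blast
  have "c0 * (\<integral>x. (norm (v x))\<^sup>2 \<partial>M) \<le> bilin \<Omega> \<nu> \<epsilon> v v" if v: "v \<in> H0curl \<Omega>" for v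
  proof -
    interpret n: psd_form "{v. square_integrable M v}" "\<lambda>u v. \<integral>x. (\<nu> x *v u x) \<bullet> v x \<partial>M"
      by (rule psd_form_coefficient[OF nonneg_coefficient_of_coefficient[OF \<nu>]])
    show ?thesis
      using n.nonneg[of "curl \<Omega> v"] curl_works(1)[OF H0curl_Hcurl[OF v]] c0(2)[OF H0curl_square_integrable[OF v]]
      unfolding bilin_def by simp
  qed
  then show ?thesis using that c0(1) by blast
qed

text \<open>With the upper bound that follows, equivalence of the energy norm and the graph norm on
  \<open>H0curl\<close>, through which completeness is transferred.\<close>

lemma energy_lower_graph:
  obtains c1 where "c1 > 0" "\<And>v. v \<in> H0curl \<Omega> \<Longrightarrow> c1 * graph_form v v \<le> bilin \<Omega> \<nu> \<epsilon> v v"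
proof -
  obtain c0 where c0: "c0 > 0" "\<And>u. square_integrable M u \<Longrightarrow>
      c0 * (\<integral>x. (norm (u x))\<^sup>2 \<partial>M) \<le> (\<integral>x. (\<epsilon> x *v u x) \<bullet> u x \<partial>M)"
    using coefficient_lower[OF \<epsilon>] by blast
  obtain d0 where d0: "d0 > 0" "\<And>u. square_integrable M u \<Longrightarrow>
      d0 * (\<integral>x. (norm (u x))\<^sup>2 \<partial>M) \<le> (\<integral>x. (\<nu> x *v u x) \<bullet> u x \<partial>M)"
    using coefficient_lower[OF \<nu>] by blast
  have "min c0 d0 * graph_form v v \<le> bilin \<Omega> \<nu> \<epsilon> v v" if v: "v \<in> H0curl \<Omega>" for v
  proof -
    have "min c0 d0 * (\<integral>x. (norm (v x))\<^sup>2 \<partial>M) \<le> c0 * (\<integral>x. (norm (v x))\<^sup>2 \<partial>M)"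
      "min c0 d0 * (\<integral>x. (norm (curl \<Omega> v x))\<^sup>2 \<partial>M) \<le> d0 * (\<integral>x. (norm (curl \<Omega> v x))\<^sup>2 \<partial>M)"
      by (auto intro!: mult_right_mono)
    then show ?thesis
      using c0(2)[OF H0curl_square_integrable[OF v]] d0(2)[OF curl_works(1)[OF H0curl_Hcurl[OF v]]]
      unfolding bilin_def graph_form_eq by (simp add: distrib_left)
  qed
  then show ?thesis using that[of "min c0 d0"] c0(1) d0(1) by simp
qed

lemma energy_upper_graph:
  obtains K where "\<And>v. v \<in> H0curl \<Omega> \<Longrightarrow> bilin \<Omega> \<nu> \<epsilon> v v \<le> K * graph_form v v"
proof -
  obtain K1 where K1: "\<And>u. square_integrable M u \<Longrightarrow>
      (\<integral>x. (\<epsilon> x *v u x) \<bullet> u x \<partial>M) \<le> K1 * (\<integral>x. (norm (u x))\<^sup>2 \<partial>M)"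
    using coefficient_upper[OF nonneg_coefficient_of_coefficient[OF \<epsilon>]] by blast
  obtain K2 where K2: "\<And>u. square_integrable M u \<Longrightarrow>
      (\<integral>x. (\<nu> x *v u x) \<bullet> u x \<partial>M) \<le> K2 * (\<integral>x. (norm (u x))\<^sup>2 \<partial>M)"
    using coefficient_upper[OF nonneg_coefficient_of_coefficient[OF \<nu>]] by blast
  have "bilin \<Omega> \<nu> \<epsilon> v v \<le> max K1 K2 * graph_form v v" if v: "v \<in> H0curl \<Omega>" for v
  proof -
    have "K1 * (\<integral>x. (norm (v x))\<^sup>2 \<partial>M) \<le> max K1 K2 * (\<integral>x. (norm (v x))\<^sup>2 \<partial>M)"
      "K2 * (\<integral>x. (norm (curl \<Omega> v x))\<^sup>2 \<partial>M) \<le> max K1 K2 * (\<integral>x. (norm (curl \<Omega> v x))\<^sup>2 \<partial>M)"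
      by (auto intro!: mult_right_mono)
    then show ?thesis
      using K1[OF H0curl_square_integrable[OF v]] K2[OF curl_works(1)[OF H0curl_Hcurl[OF v]]]
      unfolding bilin_def graph_form_eq by (simp add: distrib_left)
  qed
  then show ?thesis using that by blast
qed

lemma energy_complete:
  assumes s: "\<And>n. s n \<in> H0curl \<Omega>"
    and cauchy: "\<And>e. e > 0 \<Longrightarrow> \<exists>N::nat. \<forall>m\<ge>N. \<forall>n\<ge>N. bilin \<Omega> \<nu> \<epsilon> (\<lambda>x. s m x - s n x) (\<lambda>x. s m x - s n x) < e"
  shows "\<exists>u\<in>H0curl \<Omega>. (\<lambda>n. bilin \<Omega> \<nu> \<epsilon> (\<lambda>x. s n x - u x) (\<lambda>x. s n x - u x)) \<longlonglongrightarrow> 0"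
proof -
  obtain c1 where c1: "c1 > 0" "\<And>v. v \<in> H0curl \<Omega> \<Longrightarrow> c1 * graph_form v v \<le> bilin \<Omega> \<nu> \<epsilon> v v"
    using energy_lower_graph by blast
  obtain K where K: "\<And>v. v \<in> H0curl \<Omega> \<Longrightarrow> bilin \<Omega> \<nu> \<epsilon> v v \<le> K * graph_form v v"
    using energy_upper_graph by blast
  have "\<exists>u\<in>H0curl \<Omega>. (\<lambda>n. graph_form (\<lambda>x. s n x - u x) (\<lambda>x. s n x - u x)) \<longlonglongrightarrow> 0"
  proof (rule H0curl_complete[OF s])
    fix e :: real assume "e > 0"
    obtain N where N: "\<And>m n. m \<ge> N \<Longrightarrow> n \<ge> N \<Longrightarrow> bilin \<Omega> \<nu> \<epsilon> (\<lambda>x. s m x - s n x) (\<lambda>x. s m x - s n x) < c1 * e"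
      using cauchy[of "c1 * e"] c1(1) \<open>e > 0\<close> by auto
    have "graph_form (\<lambda>x. s m x - s n x) (\<lambda>x. s m x - s n x) < e" if "m \<ge> N" "n \<ge> N" for m n
    proof -
      have "c1 * graph_form (\<lambda>x. s m x - s n x) (\<lambda>x. s m x - s n x) < c1 * e"
        by (rule le_less_trans[OF c1(2)[OF energy.diff_closed[OF s s]] N[OF that]])
      then show ?thesis using c1(1) by simp
    qed
    then show "\<exists>N. \<forall>m\<ge>N. \<forall>n\<ge>N. graph_form (\<lambda>x. s m x - s n x) (\<lambda>x. s m x - s n x) < e" by blast
  qed
  then obtain u where u: "u \<in> H0curl \<Omega>" and lim: "(\<lambda>n. graph_form (\<lambda>x. s n x - u x) (\<lambda>x. s n x - u x)) \<longlonglongrightarrow> 0"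
    by blast
  have d: "(\<lambda>x. s n x - u x) \<in> H0curl \<Omega>" for n by (rule energy.diff_closed[OF s u])
  have "(\<lambda>n. bilin \<Omega> \<nu> \<epsilon> (\<lambda>x. s n x - u x) (\<lambda>x. s n x - u x)) \<longlonglongrightarrow> 0"
  proof (rule tendsto_sandwich[OF _ _ tendsto_const])
    show "\<forall>\<^sub>F n in sequentially. 0 \<le> bilin \<Omega> \<nu> \<epsilon> (\<lambda>x. s n x - u x) (\<lambda>x. s n x - u x)"
      using energy.nonneg[OF d] by simp
    show "\<forall>\<^sub>F n in sequentially. bilin \<Omega> \<nu> \<epsilon> (\<lambda>x. s n x - u x) (\<lambda>x. s n x - u x) \<le>
        K * graph_form (\<lambda>x. s n x - u x) (\<lambda>x. s n x - u x)"
      using K[OF d] by simp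
    show "(\<lambda>n. K * graph_form (\<lambda>x. s n x - u x) (\<lambda>x. s n x - u x)) \<longlonglongrightarrow> 0"
      using tendsto_mult[OF tendsto_const lim, of K] by simp
  qed
  then show ?thesis using u by blast
qed

text \<open>Integrals over different shapes become integrals for the one measure on the domain, so
  that they can be combined under the integral sign.\<close>

lemma integral_lebesgue_on_subset:
  fixes g :: "real^3 \<Rightarrow> real"
  assumes "\<omega> \<in> sets lebesgue" "\<omega> \<subseteq> \<Omega>"
  shows "(\<integral>x. g x \<partial>lebesgue_on \<omega>) = (\<integral>x. indicator \<omega> x * g x \<partial>M)"
proof -
  have "(\<lambda>x. indicator \<Omega> x * (indicator \<omega> x * g x)) = (\<lambda>x. indicator \<omega> x * g x)"
    using assms(2) by (auto simp: indicator_def fun_eq_iff)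
  then show ?thesis using assms(1) by (simp add: integral_restrict_space)
qed

lemma integrable_indicator_norm:
  assumes "\<omega> \<in> sets lebesgue" "\<omega> \<subseteq> \<Omega>" "square_integrable M v"
  shows "integrable M (\<lambda>x. indicator \<omega> x * norm (v x))"
proof -
  have "\<omega> \<in> sets M" using assms by (simp add: sets_restrict_space_iff)
  then show ?thesis
    using integrable_mult_indicator[of \<omega> M "\<lambda>x. norm (v x)"] square_integrable_imp_integrable[OF assms(3)] by simp
qed

text \<open>Cauchy-Schwarz against the indicator of the set. The square root of the measure is the
  source of the stability estimate in terms of symmetric differences.\<close>

lemma L1_on_subset_le:
  assumes \<omega>: "\<omega> \<in> sets lebesgue" "\<omega> \<subseteq> \<Omega>" and v: "square_integrable M v"
  shows "(\<integral>x. indicator \<omega> x * norm (v x) \<partial>M) \<le> sqrt (measure lebesgue \<omega>) * sqrt (\<integral>x. (norm (v x))\<^sup>2 \<partial>M)"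
proof -
  interpret psd_form "{v :: real^3 \<Rightarrow> real. square_integrable M v}" "\<lambda>u v. \<integral>x. u x \<bullet> v x \<partial>M"
    by (rule psd_form_inner)
  have \<omega>M: "\<omega> \<in> sets M" using \<omega> by (simp add: sets_restrict_space_iff)
  have sq: "(\<lambda>x. (norm (indicator \<omega> x :: real))\<^sup>2) = indicator \<omega>" by (auto simp: indicator_def fun_eq_iff)
  have i: "square_integrable M (indicator \<omega> :: _ \<Rightarrow> real)"
    unfolding square_integrable_def sq using \<omega>M by (auto simp: emeasure_eq_measure)
  have n: "square_integrable M (\<lambda>x. norm (v x))" using v by (auto simp: square_integrable_def)
  have "(\<integral>x. indicator \<omega> x * indicator \<omega> x \<partial>M) = measure lebesgue \<omega>"
    using integral_lebesgue_on_subset[OF \<omega>, of "\<lambda>_. 1"] \<omega> lmeasurable_\<Omega>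
    by (simp add: measure_restrict_space indicator_inter_arith[symmetric])
  then show ?thesis
    using form_cauchy_schwarz[of "indicator \<omega>" "\<lambda>x. norm (v x)"] i n by (simp add: power2_eq_square)
qed

text \<open>The inequality is the optimality condition of an energy whose nonquadratic part
  \<open>\<psi>\<close>, the nonsmooth term minus the load, is convex and Lipschitz for the energy
  norm.\<close>

lemma VI_solvable:
  assumes \<omega>: "\<omega> \<in> sets lebesgue" "\<omega> \<subseteq> \<Omega>"
  shows "\<exists>E. solves_VI \<Omega> \<nu> \<epsilon> jc f \<omega> E"
proof -
  define \<psi> where "\<psi> v = jc * (\<integral>x. indicator \<omega> x * norm (v x) \<partial>M) - (\<integral>x. f x \<bullet> v x \<partial>M)" for v :: "real^3 \<Rightarrow> real^3"
  have int: "integrable M (\<lambda>x. indicator \<omega> x * norm (v x))" "integrable M (\<lambda>x. f x \<bullet> v x)" if "v \<in> H0curl \<Omega>" for v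
    using H0curl_square_integrable[OF that] f by (auto intro: integrable_inner integrable_indicator_norm[OF \<omega>])
  obtain c0 where c0: "c0 > 0" "\<And>v. v \<in> H0curl \<Omega> \<Longrightarrow> c0 * (\<integral>x. (norm (v x))\<^sup>2 \<partial>M) \<le> bilin \<Omega> \<nu> \<epsilon> v v"
    using energy_lower_L2 by blast
  \<comment> \<open>The two summands are L^2 Lipschitz constants of the nonsmooth term and of the
    load; passing to the energy norm costs the factor \<open>sqrt (1 / c0)\<close> below.\<close>
  define C where "C = jc * sqrt (measure lebesgue \<omega>) + sqrt (\<integral>x. (norm (f x))\<^sup>2 \<partial>M)"
  have C: "C \<ge> 0" using jc by (simp add: C_def)
  have "\<exists>u\<in>H0curl \<Omega>. \<forall>v\<in>H0curl \<Omega>. bilin \<Omega> \<nu> \<epsilon> u (\<lambda>x. v x - u x) + \<psi> v - \<psi> u \<ge> 0"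
  proof (rule energy.variational_inequality_solvable[OF energy_complete])
    fix u v :: "real^3 \<Rightarrow> real^3" and t :: real
    assume uv: "u \<in> H0curl \<Omega>" "v \<in> H0curl \<Omega>" and t: "0 \<le> t" "t \<le> 1"
    let ?w = "\<lambda>x. u x + t *\<^sub>R (v x - u x)"
    have w: "?w \<in> H0curl \<Omega>" using uv by (intro H0curl_add_scaleR energy.diff_closed)
    have "(\<integral>x. indicator \<omega> x * norm (?w x) \<partial>M) \<le>
        (\<integral>x. (1 - t) * (indicator \<omega> x * norm (u x)) + t * (indicator \<omega> x * norm (v x)) \<partial>M)"
    proof (rule integral_mono)
      fix x
      have "?w x = (1 - t) *\<^sub>R u x + t *\<^sub>R v x" by (simp add: algebra_simps)
      then have "norm (?w x) \<le> (1 - t) * norm (u x) + t * norm (v x)"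
        using norm_triangle_ineq[of "(1 - t) *\<^sub>R u x" "t *\<^sub>R v x"] t by simp
      then show "indicator \<omega> x * norm (?w x) \<le> (1 - t) * (indicator \<omega> x * norm (u x)) + t * (indicator \<omega> x * norm (v x))"
        by (auto simp: indicator_def)
    qed (use int(1)[OF uv(1)] int(1)[OF uv(2)] int(1)[OF w] in auto)
    also have "\<dots> = (1 - t) * (\<integral>x. indicator \<omega> x * norm (u x) \<partial>M) + t * (\<integral>x. indicator \<omega> x * norm (v x) \<partial>M)"
      using int(1)[OF uv(1)] int(1)[OF uv(2)] by simp
    finally have "jc * (\<integral>x. indicator \<omega> x * norm (?w x) \<partial>M) \<le>
        jc * ((1 - t) * (\<integral>x. indicator \<omega> x * norm (u x) \<partial>M) + t * (\<integral>x. indicator \<omega> x * norm (v x) \<partial>M))"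
      using jc by (intro mult_left_mono) auto
    moreover have "(\<integral>x. f x \<bullet> ?w x \<partial>M) = (\<integral>x. f x \<bullet> u x \<partial>M) + t * ((\<integral>x. f x \<bullet> v x \<partial>M) - (\<integral>x. f x \<bullet> u x \<partial>M))"
      using int(2)[OF uv(1)] int(2)[OF uv(2)] by (simp add: inner_add_right inner_diff_right)
    ultimately show "\<psi> ?w \<le> \<psi> u + t * (\<psi> v - \<psi> u)"
      unfolding \<psi>_def by (simp add: algebra_simps)
  next
    fix u v :: "real^3 \<Rightarrow> real^3" assume uv: "u \<in> H0curl \<Omega>" "v \<in> H0curl \<Omega>"
    let ?d = "\<lambda>x. u x - v x"
    have d: "?d \<in> H0curl \<Omega>" by (rule energy.diff_closed[OF uv])
    note dL = H0curl_square_integrable[OF d]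
    define q where "q = sqrt (\<integral>x. (norm (?d x))\<^sup>2 \<partial>M)"
    have "\<bar>(\<integral>x. indicator \<omega> x * norm (u x) \<partial>M) - (\<integral>x. indicator \<omega> x * norm (v x) \<partial>M)\<bar>
        = \<bar>\<integral>x. indicator \<omega> x * norm (u x) - indicator \<omega> x * norm (v x) \<partial>M\<bar>"
      using int(1)[OF uv(1)] int(1)[OF uv(2)] by simp
    also have "\<dots> \<le> (\<integral>x. indicator \<omega> x * norm (?d x) \<partial>M)"
    proof (rule integral_abs_bound_integral)
      show "\<bar>indicator \<omega> x * norm (u x) - indicator \<omega> x * norm (v x)\<bar> \<le> indicator \<omega> x * norm (?d x)" for x
        using norm_triangle_ineq3[of "u x" "v x"] by (auto simp: indicator_def)
    qed (use int(1)[OF uv(1)] int(1)[OF uv(2)] int(1)[OF d] in auto)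
    also have "\<dots> \<le> sqrt (measure lebesgue \<omega>) * q" unfolding q_def by (rule L1_on_subset_le[OF \<omega> dL])
    finally have 1: "jc * \<bar>(\<integral>x. indicator \<omega> x * norm (u x) \<partial>M) - (\<integral>x. indicator \<omega> x * norm (v x) \<partial>M)\<bar>
        \<le> jc * (sqrt (measure lebesgue \<omega>) * q)" using jc by (intro mult_left_mono) auto
    interpret L: psd_form "{v :: real^3 \<Rightarrow> real^3. square_integrable M v}" "\<lambda>u v. \<integral>x. u x \<bullet> v x \<partial>M"
      by (rule psd_form_inner)
    have 2: "\<bar>(\<integral>x. f x \<bullet> u x \<partial>M) - (\<integral>x. f x \<bullet> v x \<partial>M)\<bar> \<le> sqrt (\<integral>x. (norm (f x))\<^sup>2 \<partial>M) * q"
      using L.form_cauchy_schwarz[of f ?d] f dL int(2)[OF uv(1)] int(2)[OF uv(2)]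
      by (simp add: q_def inner_diff_right dot_square_norm)
    have "\<bar>\<psi> u - \<psi> v\<bar> \<le> jc * \<bar>(\<integral>x. indicator \<omega> x * norm (u x) \<partial>M) - (\<integral>x. indicator \<omega> x * norm (v x) \<partial>M)\<bar>
        + \<bar>(\<integral>x. f x \<bullet> u x \<partial>M) - (\<integral>x. f x \<bullet> v x \<partial>M)\<bar>"
    proof -
      have "\<psi> u - \<psi> v = jc * ((\<integral>x. indicator \<omega> x * norm (u x) \<partial>M) - (\<integral>x. indicator \<omega> x * norm (v x) \<partial>M))
          - ((\<integral>x. f x \<bullet> u x \<partial>M) - (\<integral>x. f x \<bullet> v x \<partial>M))"
        unfolding \<psi>_def by (simp add: algebra_simps)
      then show ?thesis
        using abs_triangle_ineq4[of "jc * ((\<integral>x. indicator \<omega> x * norm (u x) \<partial>M) - (\<integral>x. indicator \<omega> x * norm (v x) \<partial>M))"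
            "(\<integral>x. f x \<bullet> u x \<partial>M) - (\<integral>x. f x \<bullet> v x \<partial>M)"] jc by (simp add: abs_mult)
    qed
    also have "\<dots> \<le> C * q" using 1 2 unfolding C_def by (simp add: algebra_simps)
    also have "C * q \<le> C * (sqrt (1 / c0) * sqrt (bilin \<Omega> \<nu> \<epsilon> ?d ?d))"
    proof (rule mult_left_mono[OF _ C])
      have "(\<integral>x. (norm (?d x))\<^sup>2 \<partial>M) \<le> 1 / c0 * bilin \<Omega> \<nu> \<epsilon> ?d ?d"
        using c0(2)[OF d] c0(1) by (simp add: field_simps)
      then show "q \<le> sqrt (1 / c0) * sqrt (bilin \<Omega> \<nu> \<epsilon> ?d ?d)"
        unfolding q_def real_sqrt_mult[symmetric] by (rule real_sqrt_le_mono)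
    qed
    finally show "\<bar>\<psi> u - \<psi> v\<bar> \<le> (C * sqrt (1 / c0)) * sqrt (bilin \<Omega> \<nu> \<epsilon> ?d ?d)" by (simp add: mult.assoc)
  qed
  then obtain E where E: "E \<in> H0curl \<Omega>"
    and VI: "\<And>v. v \<in> H0curl \<Omega> \<Longrightarrow> bilin \<Omega> \<nu> \<epsilon> E (\<lambda>x. v x - E x) + \<psi> v - \<psi> E \<ge> 0" by blast
  have "solves_VI \<Omega> \<nu> \<epsilon> jc f \<omega> E"
    unfolding solves_VI_def
  proof (intro conjI ballI E)
    fix v assume v: "v \<in> H0curl \<Omega>"
    have "(\<integral>x. f x \<bullet> (v x - E x) \<partial>M) = (\<integral>x. f x \<bullet> v x \<partial>M) - (\<integral>x. f x \<bullet> E x \<partial>M)"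
      using int(2)[OF v] int(2)[OF E] by (simp add: inner_diff_right)
    then show "(\<integral>x. f x \<bullet> (v x - E x) \<partial>M) \<le> bilin \<Omega> \<nu> \<epsilon> E (\<lambda>x. v x - E x)
        + jc * (\<integral>x. norm (v x) \<partial>lebesgue_on \<omega>) - jc * (\<integral>x. norm (E x) \<partial>lebesgue_on \<omega>)"
      using VI[OF v] unfolding \<psi>_def integral_lebesgue_on_subset[OF \<omega>] by simp
  qed
  then show ?thesis by blast
qed

text \<open>Testing each inequality with the other solution and adding them up; this bounds the distance
  of the states by the measure of the symmetric difference and contains uniqueness.\<close>

lemma VI_stability:
  obtains C where "C \<ge> 0"
    "\<And>\<omega> \<omega>' E E'. \<omega> \<in> sets lebesgue \<Longrightarrow> \<omega> \<subseteq> \<Omega> \<Longrightarrow> \<omega>' \<in> sets lebesgue \<Longrightarrow> \<omega>' \<subseteq> \<Omega> \<Longrightarrow>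
       solves_VI \<Omega> \<nu> \<epsilon> jc f \<omega> E \<Longrightarrow> solves_VI \<Omega> \<nu> \<epsilon> jc f \<omega>' E' \<Longrightarrow>
       (\<integral>x. (norm (E x - E' x))\<^sup>2 \<partial>M) \<le> C * measure lebesgue (sym_diff \<omega> \<omega>')"
proof -
  obtain c0 where c0: "c0 > 0" "\<And>v. v \<in> H0curl \<Omega> \<Longrightarrow> c0 * (\<integral>x. (norm (v x))\<^sup>2 \<partial>M) \<le> bilin \<Omega> \<nu> \<epsilon> v v"
    using energy_lower_L2 by blast
  \<comment> \<open>For the L^2 distance \<open>q\<close> of the states and the measure
    \<open>m\<close> of the symmetric difference, \<open>c0 * q\<^sup>2\<close> is at most
    \<open>jc * sqrt m * q\<close>; cancelling \<open>q\<close> and squaring gives the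
    constant.\<close>
  have "(\<integral>x. (norm (E x - E' x))\<^sup>2 \<partial>M) \<le> (jc / c0)\<^sup>2 * measure lebesgue (sym_diff \<omega> \<omega>')"
    if \<omega>: "\<omega> \<in> sets lebesgue" "\<omega> \<subseteq> \<Omega>" and \<omega>': "\<omega>' \<in> sets lebesgue" "\<omega>' \<subseteq> \<Omega>"
      and sol: "solves_VI \<Omega> \<nu> \<epsilon> jc f \<omega> E" "solves_VI \<Omega> \<nu> \<epsilon> jc f \<omega>' E'" for \<omega> \<omega>' E E'
  proof -
    let ?a = "bilin \<Omega> \<nu> \<epsilon>" and ?D = "sym_diff \<omega> \<omega>'" and ?d = "\<lambda>x. E x - E' x"
    let ?j = "\<lambda>\<omega> v. \<integral>x. indicator \<omega> x * norm (v x) \<partial>M"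
    have E: "E \<in> H0curl \<Omega>" and E': "E' \<in> H0curl \<Omega>" using sol by (auto simp: solves_VI_def)
    note EL = H0curl_square_integrable[OF E] and EL' = H0curl_square_integrable[OF E']
    have d: "?d \<in> H0curl \<Omega>" by (rule energy.diff_closed[OF E E'])
    note dL = H0curl_square_integrable[OF d]
    have D: "?D \<in> sets lebesgue" "?D \<subseteq> \<Omega>" using \<omega> \<omega>' by auto
    have i: "integrable M (\<lambda>x. indicator W x * norm (v x))"
      if "W \<in> sets lebesgue" "W \<subseteq> \<Omega>" "square_integrable M v" for W and v :: "real^3 \<Rightarrow> real^3"
      by (rule integrable_indicator_norm[OF that])
    have fE: "(\<integral>x. f x \<bullet> (E' x - E x) \<partial>M) = - (\<integral>x. f x \<bullet> (E x - E' x) \<partial>M)"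
      by (simp add: inner_diff_right flip: Bochner_Integration.integral_minus)
    have "(\<integral>x. f x \<bullet> (E' x - E x) \<partial>M) \<le> ?a E (\<lambda>x. E' x - E x) + jc * ?j \<omega> E' - jc * ?j \<omega> E"
      using sol(1) E' unfolding solves_VI_def integral_lebesgue_on_subset[OF \<omega>] by blast
    moreover have "(\<integral>x. f x \<bullet> (E x - E' x) \<partial>M) \<le> ?a E' (\<lambda>x. E x - E' x) + jc * ?j \<omega>' E - jc * ?j \<omega>' E'"
      using sol(2) E unfolding solves_VI_def integral_lebesgue_on_subset[OF \<omega>'] by blast
    \<comment> \<open>In the sum the loads cancel and the two energy terms add up to minus the
      energy of the difference.\<close>
    ultimately have le: "?a ?d ?d \<le> jc * ((?j \<omega> E' - ?j \<omega> E) + (?j \<omega>' E - ?j \<omega>' E'))"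
      using energy.form_diff_right[OF E E' E] energy.form_diff_right[OF E' E E']
        energy.form_diff_square[OF E E'] energy.sym[OF E E'] fE by (simp add: algebra_simps)
    have "(?j \<omega> E' - ?j \<omega> E) + (?j \<omega>' E - ?j \<omega>' E') =
        (\<integral>x. (indicator \<omega> x * norm (E' x) - indicator \<omega> x * norm (E x)) + (indicator \<omega>' x * norm (E x) - indicator \<omega>' x * norm (E' x)) \<partial>M)"
      using i[OF \<omega> EL] i[OF \<omega> EL'] i[OF \<omega>' EL] i[OF \<omega>' EL'] by simp
    \<comment> \<open>On the intersection the four terms cancel, outside the union they vanish, and
      on the symmetric difference a difference of two norms remains, bounded by the reverse triangle
      inequality.\<close>
    also have "\<dots> \<le> (\<integral>x. indicator ?D x * norm (?d x) \<partial>M)"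
    proof (rule integral_mono)
      fix x
      show "(indicator \<omega> x * norm (E' x) - indicator \<omega> x * norm (E x)) + (indicator \<omega>' x * norm (E x) - indicator \<omega>' x * norm (E' x))
          \<le> indicator ?D x * norm (?d x)"
        using norm_triangle_ineq3[of "E x" "E' x"] by (auto simp: indicator_def)
    qed (use i[OF \<omega> EL] i[OF \<omega> EL'] i[OF \<omega>' EL] i[OF \<omega>' EL'] i[OF D dL] in auto)
    also have "\<dots> \<le> sqrt (measure lebesgue ?D) * sqrt (\<integral>x. (norm (?d x))\<^sup>2 \<partial>M)"
      by (rule L1_on_subset_le[OF D dL])
    finally have "jc * ((?j \<omega> E' - ?j \<omega> E) + (?j \<omega>' E - ?j \<omega>' E')) \<le>
        jc * (sqrt (measure lebesgue ?D) * sqrt (\<integral>x. (norm (?d x))\<^sup>2 \<partial>M))"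
      using jc by (intro mult_left_mono) auto
    then have *: "c0 * (\<integral>x. (norm (?d x))\<^sup>2 \<partial>M) \<le> jc * (sqrt (measure lebesgue ?D) * sqrt (\<integral>x. (norm (?d x))\<^sup>2 \<partial>M))"
      using le c0(2)[OF d] by (meson order_trans)
    define q where "q = sqrt (\<integral>x. (norm (?d x))\<^sup>2 \<partial>M)"
    have q: "q \<ge> 0" "(\<integral>x. (norm (?d x))\<^sup>2 \<partial>M) = q\<^sup>2" by (simp_all add: q_def)
    have "q \<le> jc / c0 * sqrt (measure lebesgue ?D)"
    proof (cases "q = 0")
      case True then show ?thesis using jc c0(1) by simp
    next
      case False
      then have "q > 0" using q(1) by simp
      have "q * (c0 * q) \<le> q * (jc * sqrt (measure lebesgue ?D))"
        using *[folded q_def] unfolding q(2) by (simp add: power2_eq_square ac_simps)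
      then have "c0 * q \<le> jc * sqrt (measure lebesgue ?D)" using \<open>q > 0\<close> by simp
      then show ?thesis using c0(1) by (simp add: field_simps)
    qed
    then have "q\<^sup>2 \<le> (jc / c0 * sqrt (measure lebesgue ?D))\<^sup>2" using q(1) by (rule power_mono)
    then show ?thesis unfolding q(2) power_mult_distrib by simp
  qed
  then show ?thesis using that[of "(jc / c0)\<^sup>2"] by simp
qed

text \<open>Equal shapes have an empty symmetric difference, so the stability bound is zero.\<close>

lemma VI_unique:
  assumes \<omega>: "\<omega> \<in> sets lebesgue" "\<omega> \<subseteq> \<Omega>" and "solves_VI \<Omega> \<nu> \<epsilon> jc f \<omega> E" "solves_VI \<Omega> \<nu> \<epsilon> jc f \<omega> E'"
  shows "AE x in M. E' x = E x"
proof -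
  have E: "square_integrable M (\<lambda>x. E' x - E x)"
    using assms by (auto simp: solves_VI_def intro: square_integrable_diff H0curl_square_integrable)
  obtain C where "(\<integral>x. (norm (E' x - E x))\<^sup>2 \<partial>M) \<le> C * measure lebesgue (sym_diff \<omega> \<omega>)"
    by (rule VI_stability) (rule that, use assms in blast)
  then have "(\<integral>x. (norm (E' x - E x))\<^sup>2 \<partial>M) \<le> 0" by simp
  then have "(\<integral>x. (norm (E' x - E x))\<^sup>2 \<partial>M) = 0" by (simp add: order_antisym)
  then have "AE x in M. (norm (E' x - E x))\<^sup>2 = 0"
    using E by (subst (asm) integral_nonneg_eq_0_iff_AE) (auto simp: square_integrable_def)
  then show ?thesis by simp
qed

lemma solves_VI_state:
  assumes "\<omega> \<in> sets lebesgue" "\<omega> \<subseteq> \<Omega>"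
  shows "solves_VI \<Omega> \<nu> \<epsilon> jc f \<omega> (state \<Omega> \<nu> \<epsilon> jc f \<omega>)"
  unfolding state_def using VI_solvable[OF assms] by (rule someI_ex)

end

section \<open>The cost functional\<close>

lemma C1_bounded_continuous_on: "g \<in> C1_bounded B \<Longrightarrow> continuous_on B g"
  unfolding C1_bounded_def
  by (intro continuous_at_imp_continuous_on ballI) (blast intro: has_derivative_continuous)

lemma C1_bounded_bound:
  assumes "g \<in> C1_bounded B"
  obtains K where "\<And>x. x \<in> B \<Longrightarrow> norm (g x) \<le> K"
  using assms unfolding C1_bounded_def bounded_iff by auto

lemma C1_bounded_measurable:
  fixes g :: "real^3 \<Rightarrow> 'b::euclidean_space"
  shows "g \<in> C1_bounded B \<Longrightarrow> B \<in> sets lebesgue \<Longrightarrow> g \<in> borel_measurable (lebesgue_on B)"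
  by (intro continuous_imp_measurable_on_sets_lebesgue C1_bounded_continuous_on)

lemma integrable_lebesgue_on_subset:
  fixes g :: "'a::euclidean_space \<Rightarrow> real"
  assumes g: "integrable (lebesgue_on \<Omega>) g" and s: "\<Omega> \<in> sets lebesgue" "B \<in> sets lebesgue" "B \<subseteq> \<Omega>"
  shows "integrable (lebesgue_on B) g"
    "(\<integral>x. g x \<partial>lebesgue_on B) = (\<integral>x. indicator B x * g x \<partial>lebesgue_on \<Omega>)"
proof -
  have eq: "(\<lambda>x. indicator B x *\<^sub>R (indicator \<Omega> x *\<^sub>R g x)) = (\<lambda>x. indicator B x *\<^sub>R g x)"
    "(\<lambda>x. indicator \<Omega> x *\<^sub>R (indicator B x * g x)) = (\<lambda>x. indicator B x *\<^sub>R g x)"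
    using s(3) by (auto simp: indicator_def fun_eq_iff)
  have "integrable lebesgue (\<lambda>x. indicator \<Omega> x *\<^sub>R g x)" using g s(1) by (simp add: integrable_restrict_space)
  from integrable_mult_indicator[OF s(2) this] show "integrable (lebesgue_on B) g"
    unfolding eq using s(2) by (simp add: integrable_restrict_space)
  show "(\<integral>x. g x \<partial>lebesgue_on B) = (\<integral>x. indicator B x * g x \<partial>lebesgue_on \<Omega>)"
    using s(1,2) eq(2) by (simp add: integral_restrict_space)
qed

text \<open>At almost every point the indicator of the symmetric difference is eventually 0, and the
  indicator of \<open>S\<close> is an integrable majorant.\<close>

lemma sym_diff_measure_tendsto_0:
  fixes \<omega> :: "nat \<Rightarrow> 'a::euclidean_space set"
  assumes S: "S \<in> lmeasurable" and sub: "\<And>n. \<omega> n \<subseteq> S" "A \<subseteq> S"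
    and meas: "\<And>n. \<omega> n \<in> sets lebesgue" "A \<in> sets lebesgue"
    and lim: "negligible {x. \<not> (\<forall>\<^sub>F n in sequentially. x \<in> \<omega> n \<longleftrightarrow> x \<in> A)}"
  shows "(\<lambda>n. measure lebesgue (sym_diff (\<omega> n) A)) \<longlonglongrightarrow> 0"
proof -
  have "(\<lambda>n. \<integral>x. indicator (sym_diff (\<omega> n) A) x \<partial>lebesgue) \<longlonglongrightarrow> (\<integral>x. (0::real) \<partial>(lebesgue :: 'a measure))"
  proof (rule integral_dominated_convergence[where w="indicator S :: 'a \<Rightarrow> real"])
    show "integrable lebesgue (indicator S :: 'a \<Rightarrow> real)" using S by (intro integrable_real_indicator) (auto simp: fmeasurable_def)
    show "(indicator (sym_diff (\<omega> n) A) :: 'a \<Rightarrow> real) \<in> borel_measurable lebesgue" for n using meas by auto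
    show "AE x in lebesgue. norm (indicator (sym_diff (\<omega> n) A) x :: real) \<le> indicator S x" for n
      using sub by (intro AE_I2) (auto simp: indicator_def)
    have "{x. \<not> (\<forall>\<^sub>F n in sequentially. x \<in> \<omega> n \<longleftrightarrow> x \<in> A)} \<in> null_sets lebesgue"
      using lim by (simp add: negligible_iff_null_sets)
    then have "AE x in lebesgue. \<forall>\<^sub>F n in sequentially. x \<in> \<omega> n \<longleftrightarrow> x \<in> A" by (rule AE_I') auto
    then show "AE x in lebesgue. (\<lambda>n. indicator (sym_diff (\<omega> n) A) x :: real) \<longlonglongrightarrow> 0"
    proof eventually_elim
      case (elim x)
      then have "\<forall>\<^sub>F n in sequentially. (indicator (sym_diff (\<omega> n) A) x :: real) = 0"
        by eventually_elim (auto simp: indicator_def)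
      then show ?case by (rule tendsto_eventually)
    qed
  qed simp
  moreover have "(\<integral>x. indicator (sym_diff (\<omega> n) A) x \<partial>lebesgue) = measure lebesgue (sym_diff (\<omega> n) A)" for n
    by simp
  ultimately show ?thesis by simp
qed

lemma measure_sym_diff_le:
  assumes "A \<in> lmeasurable" "B \<in> lmeasurable"
  shows "\<bar>measure lebesgue A - measure lebesgue B\<bar> \<le> measure lebesgue (sym_diff A B)"
proof -
  have D: "sym_diff A B \<in> lmeasurable" using assms by (simp add: fmeasurable.Un fmeasurable.Diff)
  have "measure lebesgue A \<le> measure lebesgue B + measure lebesgue (sym_diff A B)"
    by (rule order_trans[OF measure_mono_fmeasurable measure_Un_le]) (use assms D in \<open>auto intro: fmeasurable.Un\<close>)
  moreover have "measure lebesgue B \<le> measure lebesgue A + measure lebesgue (sym_diff A B)"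
    by (rule order_trans[OF measure_mono_fmeasurable measure_Un_le]) (use assms D in \<open>auto intro: fmeasurable.Un\<close>)
  ultimately show ?thesis by linarith
qed

section \<open>Continuity and lower bound of the cost\<close>

context state_problem
begin

text \<open>With the weight absorbed as a factor \<open>sqrt (\<kappa> x)\<close> the tracking term
  is a squared L^2 norm, which is continuous under L^2 convergence; the stability estimate supplies
  that convergence. The volumes differ by at most the measure of the symmetric difference.\<close>

lemma cost_tendsto:
  assumes B: "open B" "B \<subseteq> \<Omega>" and \<kappa>: "\<kappa> \<in> C1_bounded B" "\<And>x. x \<in> B \<Longrightarrow> \<kappa> x > 0" and Ed: "Ed \<in> C1_bounded B"
    and \<omega>: "\<And>n. \<omega> n \<in> sets lebesgue" "\<And>n. \<omega> n \<subseteq> \<Omega>" and A: "A \<in> sets lebesgue" "A \<subseteq> \<Omega>"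
    and lim: "(\<lambda>n. measure lebesgue (sym_diff (\<omega> n) A)) \<longlonglongrightarrow> 0"
  shows "(\<lambda>n. cost \<Omega> B \<nu> \<epsilon> jc f \<kappa> Ed (\<omega> n)) \<longlonglongrightarrow> cost \<Omega> B \<nu> \<epsilon> jc f \<kappa> Ed A"
proof -
  have Bm: "B \<in> sets lebesgue" using B(1) by auto
  have Bf: "finite_measure (lebesgue_on B)"
    using B bounded_\<Omega> bounded_subset by (intro finite_measure_lebesgue_on lmeasurable_open) blast+
  let ?E = "\<lambda>n. state \<Omega> \<nu> \<epsilon> jc f (\<omega> n)" and ?F = "state \<Omega> \<nu> \<epsilon> jc f A"
  have EL: "square_integrable M (?E n)" for n
    using solves_VI_state[OF \<omega>] by (auto simp: solves_VI_def intro: H0curl_square_integrable)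
  have FL: "square_integrable M ?F"
    using solves_VI_state[OF A] by (auto simp: solves_VI_def intro: H0curl_square_integrable)
  obtain C where C: "(\<integral>x. (norm (?E n x - ?F x))\<^sup>2 \<partial>M) \<le> C * measure lebesgue (sym_diff (\<omega> n) A)" for n
  proof (rule VI_stability)
    fix C
    assume stab: "\<And>\<omega> \<omega>' E E'. \<omega> \<in> sets lebesgue \<Longrightarrow> \<omega> \<subseteq> \<Omega> \<Longrightarrow> \<omega>' \<in> sets lebesgue \<Longrightarrow> \<omega>' \<subseteq> \<Omega> \<Longrightarrow>
       solves_VI \<Omega> \<nu> \<epsilon> jc f \<omega> E \<Longrightarrow> solves_VI \<Omega> \<nu> \<epsilon> jc f \<omega>' E' \<Longrightarrow>
       (\<integral>x. (norm (E x - E' x))\<^sup>2 \<partial>M) \<le> C * measure lebesgue (sym_diff \<omega> \<omega>')"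
    show ?thesis
      by (rule that) (rule stab[OF \<omega> A solves_VI_state[OF \<omega>] solves_VI_state[OF A]])
  qed
  have limE: "(\<lambda>n. \<integral>x. (norm (?E n x - ?F x))\<^sup>2 \<partial>M) \<longlonglongrightarrow> 0"
  proof (rule tendsto_sandwich[OF _ _ tendsto_const])
    show "\<forall>\<^sub>F n in sequentially. (\<integral>x. (norm (?E n x - ?F x))\<^sup>2 \<partial>M) \<le> C * measure lebesgue (sym_diff (\<omega> n) A)"
      using C by simp
    show "(\<lambda>n. C * measure lebesgue (sym_diff (\<omega> n) A)) \<longlonglongrightarrow> 0"
      using tendsto_mult[OF tendsto_const lim, of C] by simp
  qed simp
  obtain K where K: "\<And>x. x \<in> B \<Longrightarrow> norm (\<kappa> x) \<le> K" using C1_bounded_bound[OF \<kappa>(1)] by blast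
  obtain K' where K': "\<And>x. x \<in> B \<Longrightarrow> norm (Ed x) \<le> K'" using C1_bounded_bound[OF Ed] by blast
  have LB: "square_integrable (lebesgue_on B) v" if "square_integrable M v" for v :: "real^3 \<Rightarrow> real^3"
    unfolding square_integrable_def
  proof
    show "v \<in> borel_measurable (lebesgue_on B)"
      by (rule measurable_restrict_mono[OF _ B(2)]) (rule square_integrable_measurable[OF that])
    show "integrable (lebesgue_on B) (\<lambda>x. (norm (v x))\<^sup>2)"
      by (rule integrable_lebesgue_on_subset(1)[OF _ sets_\<Omega> Bm B(2)])
         (rule that[unfolded square_integrable_def, THEN conjunct2])
  qed
  have EdL: "square_integrable (lebesgue_on B) Ed"
  proof (rule square_integrable_bound)
    show "integrable (lebesgue_on B) (\<lambda>_. K'\<^sup>2)" using Bf finite_measure.integrable_const by blast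
    show "AE x in lebesgue_on B. (norm (Ed x))\<^sup>2 \<le> K'\<^sup>2"
      using K' by (auto intro!: AE_I2 power_mono)
  qed (rule C1_bounded_measurable[OF Ed Bm])
  let ?T = "\<lambda>v x. sqrt (\<kappa> x) *\<^sub>R (v x :: real^3)"
  have TL: "square_integrable (lebesgue_on B) (?T v)" if v: "square_integrable (lebesgue_on B) v" for v
  proof (rule square_integrable_bound)
    note [measurable] = v C1_bounded_measurable[OF \<kappa>(1) Bm]
    show "?T v \<in> borel_measurable (lebesgue_on B)" by measurable
    show "integrable (lebesgue_on B) (\<lambda>x. K * (norm (v x))\<^sup>2)" using v by (simp add: square_integrable_def)
    show "AE x in lebesgue_on B. (norm (?T v x))\<^sup>2 \<le> K * (norm (v x))\<^sup>2"
    proof (rule AE_I2)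
      fix x assume "x \<in> space (lebesgue_on B)"
      then have x: "x \<in> B" by simp
      then show "(norm (?T v x))\<^sup>2 \<le> K * (norm (v x))\<^sup>2"
        using K[OF x] \<kappa>(2)[OF x] by (simp add: power_mult_distrib mult_right_mono)
    qed
  qed
  have T_sq: "(\<integral>x. ?T v x \<bullet> ?T v x \<partial>lebesgue_on B) = (\<integral>x. \<kappa> x * (norm (v x))\<^sup>2 \<partial>lebesgue_on B)" for v
  proof (rule Bochner_Integration.integral_cong)
    fix x assume "x \<in> space (lebesgue_on B)"
    then show "?T v x \<bullet> ?T v x = \<kappa> x * (norm (v x))\<^sup>2"
      using \<kappa>(2)[of x] by (simp add: dot_square_norm power_mult_distrib)
  qed simp
  interpret L: psd_form "{v :: real^3 \<Rightarrow> real^3. square_integrable (lebesgue_on B) v}" "\<lambda>u v. \<integral>x. u x \<bullet> v x \<partial>lebesgue_on B"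
    by (rule psd_form_inner)
  have "(\<lambda>n. \<integral>x. ?T (\<lambda>x. ?E n x - Ed x) x \<bullet> ?T (\<lambda>x. ?E n x - Ed x) x \<partial>lebesgue_on B) \<longlonglongrightarrow>
      (\<integral>x. ?T (\<lambda>x. ?F x - Ed x) x \<bullet> ?T (\<lambda>x. ?F x - Ed x) x \<partial>lebesgue_on B)"
  proof (rule L.form_square_tendsto)
    show "?T (\<lambda>x. ?F x - Ed x) \<in> {v. square_integrable (lebesgue_on B) v}"
      "?T (\<lambda>x. ?E n x - Ed x) \<in> {v. square_integrable (lebesgue_on B) v}" for n
      using TL square_integrable_diff[OF LB[OF FL] EdL] square_integrable_diff[OF LB[OF EL] EdL] by blast+
    have diff: "(\<lambda>x. ?T (\<lambda>x. ?E n x - Ed x) x - ?T (\<lambda>x. ?F x - Ed x) x) = ?T (\<lambda>x. ?E n x - ?F x)" for n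
      by (simp add: fun_eq_iff flip: scaleR_diff_right)
    have dL: "square_integrable M (\<lambda>x. ?E n x - ?F x)" for n by (rule square_integrable_diff[OF EL FL])
    have lower: "0 \<le> (\<integral>x. \<kappa> x * (norm (?E n x - ?F x))\<^sup>2 \<partial>lebesgue_on B)" for n
      using \<kappa>(2) by (intro Bochner_Integration.integral_nonneg) (auto simp: less_imp_le)
    \<comment> \<open>\<open>\<kappa>\<close> is bounded by \<open>K\<close> on \<open>B\<close>,
      and enlarging \<open>B\<close> to the domain only adds a nonnegative amount. The maximum with
      0 makes the factor monotone in this second estimate.\<close>
    have upper: "(\<integral>x. \<kappa> x * (norm (?E n x - ?F x))\<^sup>2 \<partial>lebesgue_on B) \<le> max 0 K * (\<integral>x. (norm (?E n x - ?F x))\<^sup>2 \<partial>M)" for n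
    proof -
      have i: "integrable (lebesgue_on B) (\<lambda>x. (norm (?E n x - ?F x))\<^sup>2)"
        using LB[OF dL] by (simp add: square_integrable_def)
      have k: "integrable (lebesgue_on B) (\<lambda>x. \<kappa> x * (norm (?E n x - ?F x))\<^sup>2)"
      proof (rule Bochner_Integration.integrable_bound)
        show "integrable (lebesgue_on B) (\<lambda>x. max 0 K * (norm (?E n x - ?F x))\<^sup>2)" using i by simp
        note [measurable] = C1_bounded_measurable[OF \<kappa>(1) Bm] LB[OF dL]
        show "(\<lambda>x. \<kappa> x * (norm (?E n x - ?F x))\<^sup>2) \<in> borel_measurable (lebesgue_on B)"
          using i by (intro borel_measurable_times) auto
        show "AE x in lebesgue_on B. norm (\<kappa> x * (norm (?E n x - ?F x))\<^sup>2) \<le> norm (max 0 K * (norm (?E n x - ?F x))\<^sup>2)"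
        proof (rule AE_I2)
          fix x assume "x \<in> space (lebesgue_on B)"
          then have "\<bar>\<kappa> x\<bar> \<le> max 0 K" using K[of x] by (simp add: le_max_iff_disj)
          then show "norm (\<kappa> x * (norm (?E n x - ?F x))\<^sup>2) \<le> norm (max 0 K * (norm (?E n x - ?F x))\<^sup>2)"
            by (simp add: abs_mult mult_right_mono)
        qed
      qed
      have "(\<integral>x. \<kappa> x * (norm (?E n x - ?F x))\<^sup>2 \<partial>lebesgue_on B) \<le> (\<integral>x. max 0 K * (norm (?E n x - ?F x))\<^sup>2 \<partial>lebesgue_on B)"
      proof (rule integral_mono[OF k])
        show "integrable (lebesgue_on B) (\<lambda>x. max 0 K * (norm (?E n x - ?F x))\<^sup>2)" using i by simp
        fix x assume "x \<in> space (lebesgue_on B)"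
        then have "\<kappa> x \<le> max 0 K" using K[of x] by (simp add: le_max_iff_disj abs_le_iff)
        then show "\<kappa> x * (norm (?E n x - ?F x))\<^sup>2 \<le> max 0 K * (norm (?E n x - ?F x))\<^sup>2"
          by (rule mult_right_mono) simp
      qed
      also have "\<dots> = max 0 K * (\<integral>x. (norm (?E n x - ?F x))\<^sup>2 \<partial>lebesgue_on B)" by simp
      also have "(\<integral>x. (norm (?E n x - ?F x))\<^sup>2 \<partial>lebesgue_on B) \<le> (\<integral>x. (norm (?E n x - ?F x))\<^sup>2 \<partial>M)"
      proof -
        have iM: "integrable M (\<lambda>x. (norm (?E n x - ?F x))\<^sup>2)" using dL by (simp add: square_integrable_def)
        have "B \<in> sets M" using Bm B(2) by (simp add: sets_restrict_space_iff)
        then have "integrable M (\<lambda>x. indicator B x * (norm (?E n x - ?F x))\<^sup>2)"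
          using integrable_mult_indicator[of B M "\<lambda>x. (norm (?E n x - ?F x))\<^sup>2"] iM by simp
        then show ?thesis
          unfolding integrable_lebesgue_on_subset(2)[OF iM sets_\<Omega> Bm B(2)]
          by (rule integral_mono[OF _ iM]) (auto simp: indicator_def)
      qed
      finally show ?thesis by (simp add: mult_left_mono)
    qed
    have lim\<kappa>: "(\<lambda>n. \<integral>x. \<kappa> x * (norm (?E n x - ?F x))\<^sup>2 \<partial>lebesgue_on B) \<longlonglongrightarrow> 0"
    proof (rule tendsto_sandwich[OF _ _ tendsto_const])
      show "\<forall>\<^sub>F n in sequentially. 0 \<le> (\<integral>x. \<kappa> x * (norm (?E n x - ?F x))\<^sup>2 \<partial>lebesgue_on B)"
        by (rule always_eventually) (rule allI, rule lower)
      show "\<forall>\<^sub>F n in sequentially. (\<integral>x. \<kappa> x * (norm (?E n x - ?F x))\<^sup>2 \<partial>lebesgue_on B) \<le>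
          max 0 K * (\<integral>x. (norm (?E n x - ?F x))\<^sup>2 \<partial>M)"
        by (rule always_eventually) (rule allI, rule upper)
      show "(\<lambda>n. max 0 K * (\<integral>x. (norm (?E n x - ?F x))\<^sup>2 \<partial>M)) \<longlonglongrightarrow> 0"
        using tendsto_mult[OF tendsto_const limE, of "max 0 K"] by (simp only: mult_zero_right)
    qed
    show "(\<lambda>n. \<integral>x. (?T (\<lambda>x. ?E n x - Ed x) x - ?T (\<lambda>x. ?F x - Ed x) x) \<bullet>
        (?T (\<lambda>x. ?E n x - Ed x) x - ?T (\<lambda>x. ?F x - Ed x) x) \<partial>lebesgue_on B) \<longlonglongrightarrow> 0"
    proof -
      have "(\<integral>x. (?T (\<lambda>x. ?E n x - Ed x) x - ?T (\<lambda>x. ?F x - Ed x) x) \<bullet>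
          (?T (\<lambda>x. ?E n x - Ed x) x - ?T (\<lambda>x. ?F x - Ed x) x) \<partial>lebesgue_on B) =
          (\<integral>x. \<kappa> x * (norm (?E n x - ?F x))\<^sup>2 \<partial>lebesgue_on B)" for n
        unfolding T_sq[of "\<lambda>x. ?E n x - ?F x", symmetric] diff[of n, THEN fun_cong] ..
      then show ?thesis using lim\<kappa> by (simp only:)
    qed
  qed
  then have 1: "(\<lambda>n. \<integral>x. \<kappa> x * (norm (?E n x - Ed x))\<^sup>2 \<partial>lebesgue_on B) \<longlonglongrightarrow> (\<integral>x. \<kappa> x * (norm (?F x - Ed x))\<^sup>2 \<partial>lebesgue_on B)"
    unfolding T_sq .
  have lm: "W \<in> lmeasurable" if "W \<in> sets lebesgue" "W \<subseteq> \<Omega>" for W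
    by (rule fmeasurableI2[OF lmeasurable_\<Omega> that(2,1)])
  have 2: "(\<lambda>n. measure lebesgue (\<omega> n)) \<longlonglongrightarrow> measure lebesgue A"
  proof (rule LIM_zero_cancel, rule Lim_null_comparison[OF _ lim])
    show "\<forall>\<^sub>F n in sequentially. norm (measure lebesgue (\<omega> n) - measure lebesgue A) \<le> measure lebesgue (sym_diff (\<omega> n) A)"
      using measure_sym_diff_le[OF lm[OF \<omega>] lm[OF A]] by simp
  qed
  show ?thesis unfolding cost_def by (intro tendsto_intros 1 2)
qed

lemma cost_nonneg:
  assumes "\<And>x. x \<in> B \<Longrightarrow> \<kappa> x > 0"
  shows "0 \<le> cost \<Omega> B \<nu> \<epsilon> jc f \<kappa> Ed \<omega>"
proof -
  have "0 \<le> (\<integral>x. \<kappa> x * (norm (state \<Omega> \<nu> \<epsilon> jc f \<omega> x - Ed x))\<^sup>2 \<partial>lebesgue_on B)"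
    using assms by (intro Bochner_Integration.integral_nonneg) (auto simp: less_imp_le)
  then show ?thesis by (simp add: cost_def)
qed

end

theorem theorem2p4:
  fixes \<Omega> B :: "(real^3) set"
    and \<nu> \<epsilon> :: "real^3 \<Rightarrow> real^3^3"
    and f Ed :: "real^3 \<Rightarrow> real^3"
    and \<kappa> :: "real^3 \<Rightarrow> real"
    and jc L r :: real
  assumes "lipschitz_domain \<Omega>" and "bounded \<Omega>"
    and "lipschitz_domain B" and "B \<subseteq> \<Omega>"
    and "Ed \<in> C1_bounded B"
    and "\<kappa> \<in> C1_bounded B" and "\<forall>x\<in>B. \<kappa> x > 0"
    and "jc > 0"
    and "coefficient \<Omega> B \<epsilon>" and "coefficient \<Omega> B \<nu>"
    and "f \<in> L2_fields \<Omega>" and "f \<in> C1_bounded B"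
    and "L \<ge> 0" and "r > 0"
    and "admissible B L r \<noteq> {}"
  shows "(\<forall>\<omega>\<in>admissible B L r.
            \<exists>E. solves_VI \<Omega> \<nu> \<epsilon> jc f \<omega> E \<and>
                (\<forall>E'. solves_VI \<Omega> \<nu> \<epsilon> jc f \<omega> E' \<longrightarrow> (AE x in lebesgue_on \<Omega>. E' x = E x))) \<and>
         (\<exists>\<omega>\<^sub>0\<in>admissible B L r. \<forall>\<omega>\<in>admissible B L r.
            cost \<Omega> B \<nu> \<epsilon> jc f \<kappa> Ed \<omega>\<^sub>0 \<le> cost \<Omega> B \<nu> \<epsilon> jc f \<kappa> Ed \<omega>)"
proof
  interpret state_problem \<Omega> B \<nu> \<epsilon> jc f
    using assms by unfold_locales (auto simp: lipschitz_domain_def L2_fields_iff)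
  have adm: "\<omega> \<in> sets lebesgue" "\<omega> \<subseteq> \<Omega>" if "\<omega> \<in> admissible B L r" for \<omega>
    using that \<open>B \<subseteq> \<Omega>\<close> by (auto simp: admissible_def)
  show "\<forall>\<omega>\<in>admissible B L r. \<exists>E. solves_VI \<Omega> \<nu> \<epsilon> jc f \<omega> E \<and>
      (\<forall>E'. solves_VI \<Omega> \<nu> \<epsilon> jc f \<omega> E' \<longrightarrow> (AE x in lebesgue_on \<Omega>. E' x = E x))"
    using VI_solvable[OF adm] VI_unique[OF adm] by blast
  let ?J = "cost \<Omega> B \<nu> \<epsilon> jc f \<kappa> Ed" and ?O = "admissible B L r"
  \<comment> \<open>The direct method: the costs are nonnegative and the class is nonempty, so the
    infimum is finite and a minimizing sequence exists.\<close>
  define I where "I = Inf (?J ` ?O)"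
  have bdd: "bdd_below (?J ` ?O)"
    by (rule bdd_belowI2[where m=0]) (rule cost_nonneg, use assms(7) in blast)
  have "\<exists>\<omega>\<in>?O. ?J \<omega> < I + 1 / real (Suc n)" for n
    using cInf_lessD[of "?J ` ?O" "I + 1 / real (Suc n)"] assms(15) unfolding I_def by auto
  then obtain \<omega> where \<omega>: "\<And>n. \<omega> n \<in> ?O" and J\<omega>: "\<And>n. ?J (\<omega> n) < I + 1 / real (Suc n)" by metis
  \<comment> \<open>The limit shape stays in the class because chart size and Lipschitz constant are
    uniform over it.\<close>
  obtain k A where k: "strict_mono (k :: nat \<Rightarrow> nat)" and A: "A \<in> ?O"
    and neg: "negligible {x. \<not> (\<forall>\<^sub>F n in sequentially. x \<in> \<omega> (k n) \<longleftrightarrow> x \<in> A)}"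
    using admissible_compact[of r \<omega> B L] \<omega> assms(14) by blast
  \<comment> \<open>The bounded domain contains all the symmetric differences, so agreement almost
    everywhere becomes convergence of their measures, along which the cost is continuous.\<close>
  have "(\<lambda>n. measure lebesgue (sym_diff (\<omega> (k n)) A)) \<longlonglongrightarrow> 0"
    by (rule sym_diff_measure_tendsto_0[OF lmeasurable_\<Omega> adm(2)[OF \<omega>] adm(2)[OF A] adm(1)[OF \<omega>] adm(1)[OF A] neg])
  then have lim: "(\<lambda>n. ?J (\<omega> (k n))) \<longlonglongrightarrow> ?J A"
  proof (rule cost_tendsto[rotated 5, OF adm[OF \<omega>] adm[OF A]])
    show "open B" using assms(3) by (simp add: lipschitz_domain_def)
  qed (use assms(4-7) in blast)+
  have "?J A \<le> I"
  proof (rule LIMSEQ_le[OF lim])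
    have "(\<lambda>n. I + 1 / real (Suc n)) \<longlonglongrightarrow> I"
      using tendsto_add[OF tendsto_const LIMSEQ_inverse_real_of_nat, of I] by (simp add: inverse_eq_divide)
    from LIMSEQ_subseq_LIMSEQ[OF this k] show "(\<lambda>n. I + 1 / real (Suc (k n))) \<longlonglongrightarrow> I" by (simp add: o_def)
    show "\<exists>N. \<forall>n\<ge>N. ?J (\<omega> (k n)) \<le> I + 1 / real (Suc (k n))" using J\<omega> less_imp_le by blast
  qed
  moreover have "I \<le> ?J \<omega>'" if "\<omega>' \<in> ?O" for \<omega>'
    unfolding I_def using bdd that by (simp add: cINF_lower)
  ultimately show "\<exists>\<omega>\<^sub>0\<in>?O. \<forall>\<omega>\<in>?O. ?J \<omega>\<^sub>0 \<le> ?J \<omega>" using A order_trans by blast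
qed

end
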